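(* Let $Q$ be a Hopf algebra over $\mathbb{C}$ with counit $\varepsilon$ and antipode $T$ satisfying $T^2=\mathrm{id}$, and let $A$ be a $Q$-module algebra. Let $H=A\otimes_{\mathbb{C}}Q\otimes_{\mathbb{C}}A$ with multiplication $$(a\otimes q\otimes b)(a'\otimes q'\otimes b')=a(q_{(1)}a')\otimes q_{(2)}q'\otimes(q_{(3)}b')b .$$ Define, over the base $A_l=A$, $$s_l(a)=a\otimes1\otimes1,\quad t_l(b)=1\otimes1\otimes b,\quad \Delta_l(a\otimes q\otimes b)=(a\otimes q_{(1)}\otimes1)\otimes_A(1\otimes q_{(2)}\otimes b),\quad \varepsilon_l(a\otimes q\otimes b)=a(q\cdot 1_A)b=a\,\varepsilon(q)\,b;$$ over the base $A_r=A^{op}$, $$s_r(b)=1\otimes1\otimes b,\quad t_r(a)=a\otimes1\otimes1,\quad \Delta_r(a\otimes q\otimes b)=(a\otimes q_{(1)}\otimes1)\otimes_{A^{op}}(1\otimes q_{(2)}\otimes b),\quad \varepsilon_r(a\otimes q\otimes b)=T(q)(ba);$$ and $$S(a\otimes q\otimes b)=T(q_{(3)})b\otimes T(q_{(2)})\otimes T(q_{(1)})a .$$ With these structure maps $H$ is a Hopf algebroid.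
   Context: Sweedler notation $q_{(1)}\otimes q_{(2)}\otimes\cdots$ is used for the iterated coproduct of $Q$. All algebras are unital associative $\mathbb{C}$-algebras. An $(s,t)$-ring over $A$ is an algebra $H$ with algebra homomorphisms $s:A\to H$, $t:A^{op}\to H$ whose images commute. Left bialgebroid over $A_l$: an $(s_l,t_l)$-ring $H$ over $A_l$ with $(A_l,A_l)$-bimodule structure $a_1\cdot h\cdot a_2=s_l(a_1)t_l(a_2)h$ and bimodule maps $\Delta_l:H\to H\otimes_{A_l}H$, $\varepsilon_l:H\to A_l$, coassociative and counital, such that (i) $\Delta_l$ takes values in $\{\sum_ih_i\otimes h_i'\mid\sum_ih_it_l(a)\otimes h_i'=\sum_ih_i\otimes h_i's_l(a)\ \forall a\in A_l\}$ and is a unital algebra homomorphism into this algebra (factorwise multiplication); (ii) $\varepsilon_l(hh')=\varepsilon_l(hs_l(\varepsilon_l(h')))=\varepsilon_l(ht_l(\varepsilon_l(h')))$. Right bialgebroid over $A_r$: an $(s_r,t_r)$-ring $H$ over $A_r$ with bimodule structure $a_1\cdot h\cdot a_2=ht_r(a_1)s_r(a_2)$ and coassociative, counital bimodule maps $\Delta_r:H\to H\otimes_{A_r}H$, $\varepsilon_r:H\to A_r$, such that (i) $\Delta_r$ takes values in $\{\sum_ih_i\otimes h_i'\mid\sum_is_r(a)h_i\otimes h_i'=\sum_ih_i\otimes t_r(a)h_i'\ \forall a\in A_r\}$ and is a unital algebra homomorphism into this algebra; (ii) $\varepsilon_r(hh')=\varepsilon_r(s_r(\varepsilon_r(h))h')=\varepsilon_r(t_r(\varepsilon_r(h))h')$.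 A Hopf algebroid is a left $A_l$-bialgebroid and a right $A_r$-bialgebroid structure on the same algebra $H$ with an invertible $\mathbb{C}$-linear $S:H\to H$ such that: (i) $s_l\varepsilon_lt_r=t_r$, $t_l\varepsilon_ls_r=s_r$, $s_r\varepsilon_rt_l=t_l$, $t_r\varepsilon_rs_l=s_l$; (ii) $(\Delta_l\otimes\mathrm{id})\Delta_r=(\mathrm{id}\otimes\Delta_r)\Delta_l$ and $(\Delta_r\otimes\mathrm{id})\Delta_l=(\mathrm{id}\otimes\Delta_l)\Delta_r$; (iii) $S(t_l(a_1)ht_r(a_2))=s_r(a_2)S(h)s_l(a_1)$ for $a_1\in A_l$, $a_2\in A_r$, $h\in H$; (iv) $\mu_H(S\otimes\mathrm{id})\Delta_l=s_r\varepsilon_r$ and $\mu_H(\mathrm{id}\otimes S)\Delta_r=s_l\varepsilon_l$, where $\mu_H$ is the multiplication. *)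

theory Defs
  imports Complex_Main "HOL-Library.Poly_Mapping" "HOL-Library.Set_Algebras"
begin

section \<open>Complex vector spaces\<close>

class complex_vector = ab_group_add +
  fixes scaleC :: "complex \<Rightarrow> 'a \<Rightarrow> 'a"  (infixr "*\<^sub>C" 75)
  assumes scaleC_add_right: "c *\<^sub>C (x + y) = c *\<^sub>C x + c *\<^sub>C y"
    and scaleC_add_left: "(c + d) *\<^sub>C x = c *\<^sub>C x + d *\<^sub>C x"
    and scaleC_scaleC: "c *\<^sub>C d *\<^sub>C x = (c * d) *\<^sub>C x"
    and scaleC_one: "1 *\<^sub>C x = x"

global_interpretation complex_vector: vector_space "scaleC :: complex \<Rightarrow> 'a \<Rightarrow> 'a::complex_vector"
  by standard (fact scaleC_add_right scaleC_add_left scaleC_scaleC scaleC_one)+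

global_interpretation complex_vector: vector_space_pair
  "scaleC :: complex \<Rightarrow> 'a \<Rightarrow> 'a::complex_vector" "scaleC :: complex \<Rightarrow> 'b \<Rightarrow> 'b::complex_vector"
  by standard

abbreviation clinear :: "('a::complex_vector \<Rightarrow> 'b::complex_vector) \<Rightarrow> bool"
  where "clinear \<equiv> Vector_Spaces.linear scaleC scaleC"

abbreviation cspan :: "'a::complex_vector set \<Rightarrow> 'a set"
  where "cspan \<equiv> complex_vector.span"

definition cbilinear :: "('a::complex_vector \<Rightarrow> 'b::complex_vector \<Rightarrow> 'c::complex_vector) \<Rightarrow> bool"
  where "cbilinear f \<longleftrightarrow> (\<forall>x. clinear (f x)) \<and> (\<forall>y. clinear (\<lambda>x. f x y))"

lemma clinearI:
  assumes "\<And>x y. f (x + y) = f x + f y" and "\<And>c x. f (c *\<^sub>C x) = c *\<^sub>C f x"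
  shows "clinear f"
  using assms by unfold_locales

instantiation complex :: complex_vector
begin

definition scaleC_complex :: "complex \<Rightarrow> complex \<Rightarrow> complex"
  where "scaleC_complex c x = c * x"

instance
  by standard (simp_all add: scaleC_complex_def algebra_simps)

end

instantiation poly_mapping :: (type, complex_vector) complex_vector
begin

lift_definition scaleC_poly_mapping :: "complex \<Rightarrow> ('a \<Rightarrow>\<^sub>0 'b) \<Rightarrow> 'a \<Rightarrow>\<^sub>0 'b"
  is "\<lambda>c f k. c *\<^sub>C f k"
  by (erule rev_finite_subset) auto

instance
  by standard
    (transfer; simp add: scaleC_add_right scaleC_add_left scaleC_scaleC scaleC_one)+

end


section \<open>Tensor products over the complex numbers\<close>

definition bilinear_relations ::
  "(('a::complex_vector \<times> 'b::complex_vector) \<Rightarrow>\<^sub>0 complex) set" where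
  "bilinear_relations =
     {Poly_Mapping.single (a + a', b) 1 - Poly_Mapping.single (a, b) 1
        - Poly_Mapping.single (a', b) 1 | a a' b. True}
   \<union> {Poly_Mapping.single (a, b + b') 1 - Poly_Mapping.single (a, b) 1
        - Poly_Mapping.single (a, b') 1 | a b b'. True}
   \<union> {Poly_Mapping.single (c *\<^sub>C a, b) 1 - c *\<^sub>C Poly_Mapping.single (a, b) 1 | c a b. True}
   \<union> {Poly_Mapping.single (a, c *\<^sub>C b) 1 - c *\<^sub>C Poly_Mapping.single (a, b) 1 | c a b. True}"

definition tensor_rel ::
  "(('a::complex_vector \<times> 'b::complex_vector) \<Rightarrow>\<^sub>0 complex) \<Rightarrow> (('a \<times> 'b) \<Rightarrow>\<^sub>0 complex) \<Rightarrow> bool"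
  where "tensor_rel p q \<longleftrightarrow> p - q \<in> cspan bilinear_relations"

lemma equivp_tensor_rel: "equivp tensor_rel"
proof (rule equivpI)
  show "reflp tensor_rel"
    by (simp add: reflp_def tensor_rel_def complex_vector.span_zero)
  show "symp tensor_rel"
    unfolding symp_def tensor_rel_def by (metis complex_vector.span_neg minus_diff_eq)
  show "transp tensor_rel"
  proof (rule transpI)
    fix p q r
    assume "tensor_rel p q" "tensor_rel q r"
    then show "tensor_rel p r"
      using complex_vector.span_add[of "p - q" bilinear_relations "q - r"] by (simp add: tensor_rel_def)
  qed
qed

quotient_type (overloaded) ('a, 'b) tensor (infixr "\<otimes>" 80) =
  "('a::complex_vector \<times> 'b::complex_vector) \<Rightarrow>\<^sub>0 complex" / tensor_rel
  by (rule equivp_tensor_rel)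

instantiation tensor :: (complex_vector, complex_vector) complex_vector
begin

lift_definition zero_tensor :: "'a \<otimes> 'b" is 0 .

lift_definition plus_tensor :: "'a \<otimes> 'b \<Rightarrow> 'a \<otimes> 'b \<Rightarrow> 'a \<otimes> 'b" is "(+)"
  unfolding tensor_rel_def by (metis add_diff_add complex_vector.span_add)

lift_definition minus_tensor :: "'a \<otimes> 'b \<Rightarrow> 'a \<otimes> 'b \<Rightarrow> 'a \<otimes> 'b" is "(-)"
  subgoal for p p' q q'
    using complex_vector.span_diff[of "p - p'" bilinear_relations "q - q'"]
    by (simp add: tensor_rel_def algebra_simps)
  done

lift_definition uminus_tensor :: "'a \<otimes> 'b \<Rightarrow> 'a \<otimes> 'b" is uminus
  unfolding tensor_rel_def by (metis minus_diff_minus complex_vector.span_neg)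

lift_definition scaleC_tensor :: "complex \<Rightarrow> 'a \<otimes> 'b \<Rightarrow> 'a \<otimes> 'b" is scaleC
  unfolding tensor_rel_def
  by (metis complex_vector.scale_right_diff_distrib complex_vector.span_scale)

instance
  by standard
    (transfer; simp add: tensor_rel_def complex_vector.span_zero algebra_simps
      scaleC_add_right scaleC_add_left scaleC_scaleC scaleC_one)+

end

lift_definition tensor_pure :: "'a::complex_vector \<Rightarrow> 'b::complex_vector \<Rightarrow> 'a \<otimes> 'b"  (infixr "\<otimes>" 80)
  is "\<lambda>a b. Poly_Mapping.single (a, b) 1" .

lemma cbilinear_tensor_pure: "cbilinear (\<otimes>)"
proof -
  have "a \<otimes> (b + b') = a \<otimes> b + a \<otimes> b'" for a :: 'a and b b' :: 'b
    by (transfer, unfold tensor_rel_def, rule complex_vector.span_base)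
      (simp add: bilinear_relations_def diff_diff_add[symmetric], blast)
  moreover have "a \<otimes> (c *\<^sub>C b) = c *\<^sub>C (a \<otimes> b)" for a :: 'a and b :: 'b and c
    by (transfer, unfold tensor_rel_def, rule complex_vector.span_base)
      (simp add: bilinear_relations_def, blast)
  moreover have "(a + a') \<otimes> b = a \<otimes> b + a' \<otimes> b" for a a' :: 'a and b :: 'b
    by (transfer, unfold tensor_rel_def, rule complex_vector.span_base)
      (simp add: bilinear_relations_def diff_diff_add[symmetric], blast)
  moreover have "(c *\<^sub>C a) \<otimes> b = c *\<^sub>C (a \<otimes> b)" for a :: 'a and b :: 'b and c
    by (transfer, unfold tensor_rel_def, rule complex_vector.span_base)
      (simp add: bilinear_relations_def, blast)
  ultimately show ?thesis
    by (auto simp: cbilinear_def intro!: clinearI)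
qed

lemma single_eq_scaleC: "Poly_Mapping.single k c = c *\<^sub>C Poly_Mapping.single k (1::complex)"
  by transfer (auto simp: fun_eq_iff when_def scaleC_complex_def complex_vector.scale_zero_right)

lemma span_tensor_pure: "cspan {a \<otimes> b | a b. True} = UNIV"
proof -
  have "abs_tensor p \<in> cspan {a \<otimes> b | a b. True}" for p :: "'a \<times> 'b \<Rightarrow>\<^sub>0 complex"
  proof (induction p rule: update_induct)
    case const
    then show ?case by (simp add: zero_tensor.abs_eq[symmetric] complex_vector.span_zero)
  next
    case (update p k c)
    obtain a b where k: "k = (a, b)" by force
    have "Poly_Mapping.update k c p = p + c *\<^sub>C Poly_Mapping.single k 1"
      by (subst single_eq_scaleC[symmetric], rule poly_mapping_eqI)
        (use update in \<open>auto simp: lookup_update lookup_add lookup_single in_keys_iff when_def\<close>)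
    then have "abs_tensor (Poly_Mapping.update k c p) = abs_tensor p + c *\<^sub>C (a \<otimes> b)"
      by (simp add: k plus_tensor.abs_eq scaleC_tensor.abs_eq tensor_pure.abs_eq)
    moreover have "c *\<^sub>C (a \<otimes> b) \<in> cspan {a \<otimes> b | a b. True}"
      by (intro complex_vector.span_scale complex_vector.span_base) auto
    ultimately show ?case using update by (simp add: complex_vector.span_add)
  qed
  then show ?thesis by (metis UNIV_eq_I Quotient3_abs_rep[OF Quotient3_tensor])
qed

definition tlift ::
  "('a::complex_vector \<Rightarrow> 'b::complex_vector \<Rightarrow> 'c::complex_vector) \<Rightarrow> 'a \<otimes> 'b \<Rightarrow> 'c"
  where "tlift f = (THE F. clinear F \<and> (\<forall>a b. F (a \<otimes> b) = f a b))"

lemma tensor_eqI: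
  fixes F G :: "'a::complex_vector \<otimes> 'b::complex_vector \<Rightarrow> 'c::complex_vector"
  assumes "clinear F" and "clinear G" and "\<And>a b. F (a \<otimes> b) = G (a \<otimes> b)"
  shows "F = G"
proof
  fix x :: "'a \<otimes> 'b"
  have "x \<in> cspan {a \<otimes> b | a b. True}" unfolding span_tensor_pure by simp
  then show "F x = G x"
    by (rule complex_vector.linear_eq_on[OF assms(1,2)]) (auto simp: assms(3))
qed

definition free_extend ::
  "('a::complex_vector \<Rightarrow> 'b::complex_vector \<Rightarrow> 'c::complex_vector) \<Rightarrow> ('a \<times> 'b \<Rightarrow>\<^sub>0 complex) \<Rightarrow> 'c"
  where "free_extend f p = (\<Sum>k\<in>Poly_Mapping.keys p. Poly_Mapping.lookup p k *\<^sub>C f (fst k) (snd k))"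

lemma free_extend_superset:
  assumes "finite K" and "Poly_Mapping.keys p \<subseteq> K"
  shows "free_extend f p = (\<Sum>k\<in>K. Poly_Mapping.lookup p k *\<^sub>C f (fst k) (snd k))"
  unfolding free_extend_def
  by (rule sum.mono_neutral_left) (use assms in \<open>auto simp: in_keys_iff\<close>)

lemma clinear_free_extend: "clinear (free_extend f)"
proof (rule clinearI)
  fix p q :: "'a \<times> 'b \<Rightarrow>\<^sub>0 complex" and c
  let ?K = "Poly_Mapping.keys p \<union> Poly_Mapping.keys q"
  have "free_extend f (p + q) = (\<Sum>k\<in>?K. Poly_Mapping.lookup (p + q) k *\<^sub>C f (fst k) (snd k))"
    by (rule free_extend_superset) (simp_all add: Poly_Mapping.keys_add)
  also have "\<dots> = free_extend f p + free_extend f q"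
    by (subst (1 2) free_extend_superset[of ?K])
      (auto simp: lookup_add scaleC_add_left sum.distrib)
  finally show "free_extend f (p + q) = free_extend f p + free_extend f q" .
  have lookup_scale: "Poly_Mapping.lookup (c *\<^sub>C p) k = c * Poly_Mapping.lookup p k" for k
    by transfer (simp add: scaleC_complex_def)
  have "free_extend f (c *\<^sub>C p) =
      (\<Sum>k\<in>Poly_Mapping.keys p. Poly_Mapping.lookup (c *\<^sub>C p) k *\<^sub>C f (fst k) (snd k))"
    by (rule free_extend_superset) (auto simp: in_keys_iff lookup_scale)
  also have "\<dots> = c *\<^sub>C free_extend f p"
    by (simp add: free_extend_def lookup_scale complex_vector.scale_sum_right scaleC_scaleC)
  finally show "free_extend f (c *\<^sub>C p) = c *\<^sub>C free_extend f p" .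
qed

lemma free_extend_single: "free_extend f (Poly_Mapping.single (a, b) 1) = f a b"
  by (simp add: free_extend_def scaleC_one)

lemma free_extend_relations:
  assumes "cbilinear f" and "p \<in> cspan bilinear_relations"
  shows "free_extend f p = 0"
proof -
  interpret F: Vector_Spaces.linear scaleC scaleC "free_extend f" by (rule clinear_free_extend)
  have L: "clinear (f x)" and R: "clinear (\<lambda>x. f x y)" for x y
    using assms(1) by (auto simp: cbilinear_def)
  have "free_extend f r = 0" if "r \<in> bilinear_relations" for r
    using that unfolding bilinear_relations_def
    by (auto simp: F.diff F.scale free_extend_single
        complex_vector.linear_add[OF L] complex_vector.linear_add[OF R]
        complex_vector.linear_scale[OF L] complex_vector.linear_scale[OF R])
  then show ?thesis
    using complex_vector.linear_eq_0_on_span[OF clinear_free_extend _ assms(2)] by blast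
qed

lemma tlift_exists:
  assumes "cbilinear f"
  shows "\<exists>F. clinear F \<and> (\<forall>a b. F (a \<otimes> b) = f a b)"
proof -
  define F where "F t = free_extend f (rep_tensor t)" for t
  interpret E: Vector_Spaces.linear scaleC scaleC "free_extend f" by (rule clinear_free_extend)
  have F_abs: "F (abs_tensor p) = free_extend f p" for p
  proof -
    have "tensor_rel (rep_tensor (abs_tensor p)) p"
      by (metis Quotient3_rep_abs[OF Quotient3_tensor] equivp_reflp[OF equivp_tensor_rel])
    then have "free_extend f (rep_tensor (abs_tensor p) - p) = 0"
      by (intro free_extend_relations[OF assms]) (simp add: tensor_rel_def)
    then show ?thesis by (simp add: F_def E.diff)
  qed
  have ex: "\<exists>p. t = abs_tensor p" for t :: "'a \<otimes> 'b"
    by (metis Quotient3_abs_rep[OF Quotient3_tensor])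
  have "clinear F"
  proof (rule clinearI)
    fix s t :: "'a \<otimes> 'b" and c
    obtain p q where "s = abs_tensor p" "t = abs_tensor q" using ex by blast
    then show "F (s + t) = F s + F t" and "F (c *\<^sub>C s) = c *\<^sub>C F s"
      by (simp_all add: plus_tensor.abs_eq scaleC_tensor.abs_eq F_abs E.add E.scale)
  qed
  moreover have "F (a \<otimes> b) = f a b" for a b
    by (simp add: tensor_pure.abs_eq F_abs free_extend_single)
  ultimately show ?thesis by blast
qed

lemma tlift:
  assumes "cbilinear f"
  shows "clinear (tlift f)" and "tlift f (a \<otimes> b) = f a b"
proof -
  have "\<exists>!F. clinear F \<and> (\<forall>a b. F (a \<otimes> b) = f a b)"
    using tlift_exists[OF assms] by (metis tensor_eqI)
  from theI'[OF this] show "clinear (tlift f)" and "tlift f (a \<otimes> b) = f a b"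
    by (simp_all add: tlift_def)
qed

definition tlift3 ::
  "('a::complex_vector \<Rightarrow> 'b::complex_vector \<Rightarrow> 'c::complex_vector \<Rightarrow> 'd::complex_vector)
     \<Rightarrow> 'a \<otimes> 'b \<otimes> 'c \<Rightarrow> 'd"
  where "tlift3 f = tlift (\<lambda>x. tlift (f x))"

definition tmap ::
  "('a::complex_vector \<Rightarrow> 'c::complex_vector) \<Rightarrow> ('b::complex_vector \<Rightarrow> 'd::complex_vector)
     \<Rightarrow> 'a \<otimes> 'b \<Rightarrow> 'c \<otimes> 'd"
  where "tmap f g = tlift (\<lambda>x y. f x \<otimes> g y)"

definition tassoc ::
  "('a::complex_vector \<otimes> 'b::complex_vector) \<otimes> 'c::complex_vector \<Rightarrow> 'a \<otimes> 'b \<otimes> 'c"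
  where "tassoc = tlift (\<lambda>u z. tlift (\<lambda>x y. x \<otimes> y \<otimes> z) u)"


section \<open>Algebras, Hopf algebras and module algebras\<close>

record 'a alg =
  amult :: "'a \<Rightarrow> 'a \<Rightarrow> 'a"  (infixl "\<cdot>\<index>" 70)
  aunit :: 'a  ("\<one>\<index>")

locale complex_algebra =
  fixes A :: "'a::complex_vector alg"
  assumes bilinear: "cbilinear (amult A)"
    and assoc: "(x \<cdot>\<^bsub>A\<^esub> y) \<cdot>\<^bsub>A\<^esub> z = x \<cdot>\<^bsub>A\<^esub> (y \<cdot>\<^bsub>A\<^esub> z)"
    and unit_left: "\<one>\<^bsub>A\<^esub> \<cdot>\<^bsub>A\<^esub> x = x"
    and unit_right: "x \<cdot>\<^bsub>A\<^esub> \<one>\<^bsub>A\<^esub> = x"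

definition opposite :: "'a alg \<Rightarrow> 'a alg"
  where "opposite A = \<lparr>amult = (\<lambda>x y. y \<cdot>\<^bsub>A\<^esub> x), aunit = \<one>\<^bsub>A\<^esub>\<rparr>"

definition complex_numbers :: "complex alg"
  where "complex_numbers = \<lparr>amult = (*), aunit = 1\<rparr>"

definition tensor_alg ::
  "'a::complex_vector alg \<Rightarrow> 'b::complex_vector alg \<Rightarrow> ('a \<otimes> 'b) alg"
  where "tensor_alg A B =
    \<lparr>amult = (\<lambda>u v. tlift (\<lambda>a b. tmap (\<lambda>a'. a \<cdot>\<^bsub>A\<^esub> a') (\<lambda>b'. b \<cdot>\<^bsub>B\<^esub> b') v) u),
     aunit = \<one>\<^bsub>A\<^esub> \<otimes> \<one>\<^bsub>B\<^esub>\<rparr>"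

definition alg_hom ::
  "'a::complex_vector alg \<Rightarrow> 'b::complex_vector alg \<Rightarrow> ('a \<Rightarrow> 'b) \<Rightarrow> bool"
  where "alg_hom A B f \<longleftrightarrow>
    clinear f \<and> (\<forall>x y. f (x \<cdot>\<^bsub>A\<^esub> y) = f x \<cdot>\<^bsub>B\<^esub> f y) \<and> f \<one>\<^bsub>A\<^esub> = \<one>\<^bsub>B\<^esub>"

locale hopf_algebra = complex_algebra Q
  for Q :: "'q::complex_vector alg" +
  fixes \<Delta> :: "'q \<Rightarrow> 'q \<otimes> 'q"
    and \<epsilon> :: "'q \<Rightarrow> complex"
    and T :: "'q \<Rightarrow> 'q"
  assumes comult_hom: "alg_hom Q (tensor_alg Q Q) \<Delta>"
    and counit_hom: "alg_hom Q complex_numbers \<epsilon>"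
    and coassoc: "tassoc (tmap \<Delta> id (\<Delta> q)) = tmap id \<Delta> (\<Delta> q)"
    and counit_left: "tlift (\<lambda>x y. \<epsilon> x *\<^sub>C y) (\<Delta> q) = q"
    and counit_right: "tlift (\<lambda>x y. \<epsilon> y *\<^sub>C x) (\<Delta> q) = q"
    and antipode_linear: "clinear T"
    and antipode_left: "tlift (\<lambda>x y. T x \<cdot>\<^bsub>Q\<^esub> y) (\<Delta> q) = \<epsilon> q *\<^sub>C \<one>\<^bsub>Q\<^esub>"
    and antipode_right: "tlift (\<lambda>x y. x \<cdot>\<^bsub>Q\<^esub> T y) (\<Delta> q) = \<epsilon> q *\<^sub>C \<one>\<^bsub>Q\<^esub>"

locale module_algebra = complex_algebra A
  for Q :: "'q::complex_vector alg"
    and \<Delta> :: "'q \<Rightarrow> 'q \<otimes> 'q"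
    and \<epsilon> :: "'q \<Rightarrow> complex"
    and A :: "'a::complex_vector alg" +
  fixes act :: "'q \<Rightarrow> 'a \<Rightarrow> 'a"
  assumes act_bilinear: "cbilinear act"
    and act_mult: "act (p \<cdot>\<^bsub>Q\<^esub> q) a = act p (act q a)"
    and act_unit: "act \<one>\<^bsub>Q\<^esub> a = a"
    and act_on_mult: "act q (a \<cdot>\<^bsub>A\<^esub> b) = tlift (\<lambda>x y. act x a \<cdot>\<^bsub>A\<^esub> act y b) (\<Delta> q)"
    and act_on_unit: "act q \<one>\<^bsub>A\<^esub> = \<epsilon> q *\<^sub>C \<one>\<^bsub>A\<^esub>"


section \<open>Quotient spaces and balanced tensor products\<close>

text \<open>
  For a subspace \<open>N\<close> of \<open>V\<close>, elements of \<open>V/N\<close> are cosets \<open>x +o N\<close>, which are added by the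
  elementwise sum of sets.  The map \<open>V/M \<rightarrow> W/N\<close> induced by a linear map \<open>f\<close> with \<open>f ` M \<subseteq> N\<close>
  is \<open>X \<mapsto> f ` X + N\<close>.
\<close>

definition quotient_space :: "'v::complex_vector set \<Rightarrow> 'v set set"
  where "quotient_space N = range (\<lambda>x. x +o N)"

definition induced :: "('v \<Rightarrow> 'w) \<Rightarrow> 'w::complex_vector set \<Rightarrow> 'v set \<Rightarrow> 'w set"
  where "induced f N X = f ` X + N"

definition linear_to_quotient ::
  "'w::complex_vector set \<Rightarrow> ('v::complex_vector \<Rightarrow> 'w set) \<Rightarrow> bool"
  where "linear_to_quotient N D \<longleftrightarrow>
    (\<forall>x. D x \<in> quotient_space N) \<and>
    (\<forall>x y. D (x + y) = D x + D y) \<and>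
    (\<forall>c x. D (c *\<^sub>C x) = induced (scaleC c) N (D x))"

definition linear_lifts :: "('v::complex_vector \<Rightarrow> 'w::complex_vector set) \<Rightarrow> ('v \<Rightarrow> 'w) set"
  where "linear_lifts D = {\<delta>. clinear \<delta> \<and> (\<forall>x. \<delta> x \<in> D x)}"

lemma linear_lifts_nonempty:
  fixes D :: "'v::complex_vector \<Rightarrow> 'w::complex_vector set"
  assumes "complex_vector.subspace N" and D: "linear_to_quotient N D"
  shows "linear_lifts D \<noteq> {}"
proof -
  have zero: "0 \<in> N" by (rule complex_vector.subspace_0[OF assms(1)])
  have nonempty: "D x \<noteq> {}" for x
  proof -
    obtain y where "D x = y +o N" using D unfolding linear_to_quotient_def quotient_space_def by blast
    then show ?thesis using zero by (auto simp: elt_set_plus_def)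
  qed
  have D0: "0 \<in> D 0"
  proof -
    have "D (0 *\<^sub>C 0) = induced (scaleC 0) N (D 0)"
      using D unfolding linear_to_quotient_def by blast
    then have "D 0 = (\<lambda>_. 0) ` D 0 + N"
      by (simp add: induced_def complex_vector.scale_zero_left complex_vector.scale_zero_right)
    then show ?thesis using nonempty[of 0] zero by (auto simp: set_plus_def image_constant_conv)
  qed
  define B :: "'v set" where "B = complex_vector.extend_basis {}"
  have B: "complex_vector.independent B" "cspan B = UNIV"
    unfolding B_def
    by (rule complex_vector.independent_extend_basis complex_vector.span_extend_basis,
        rule complex_vector.independent_empty)+
  define g where "g x = (SOME y. y \<in> D x)" for x
  have g: "g x \<in> D x" for x unfolding g_def using nonempty[of x] by (simp add: some_in_eq)
  obtain \<delta> where \<delta>: "clinear \<delta>" "\<And>x. x \<in> B \<Longrightarrow> \<delta> x = g x"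
    using complex_vector.linear_independent_extend[OF B(1), of g] by blast
  have "complex_vector.subspace {x. \<delta> x \<in> D x}"
  proof (rule complex_vector.subspaceI; simp)
    show "\<delta> 0 \<in> D 0" using D0 by (simp add: complex_vector.linear_0[OF \<delta>(1)])
  next
    fix x y assume "\<delta> x \<in> D x" "\<delta> y \<in> D y"
    moreover have "D (x + y) = D x + D y" using D by (simp add: linear_to_quotient_def)
    ultimately show "\<delta> (x + y) \<in> D (x + y)"
      by (simp add: complex_vector.linear_add[OF \<delta>(1)] set_plus_intro)
  next
    fix c x assume "\<delta> x \<in> D x"
    moreover have "D (c *\<^sub>C x) = induced (scaleC c) N (D x)"
      using D by (simp add: linear_to_quotient_def)
    ultimately show "\<delta> (c *\<^sub>C x) \<in> D (c *\<^sub>C x)"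
      using set_plus_intro[OF imageI zero, of "\<delta> x" "D x" "scaleC c"]
      by (simp add: induced_def complex_vector.linear_scale[OF \<delta>(1)])
  qed
  moreover have "B \<subseteq> {x. \<delta> x \<in> D x}" using \<delta>(2) g by auto
  ultimately have "cspan B \<subseteq> {x. \<delta> x \<in> D x}" by (rule complex_vector.span_minimal[rotated])
  then have "\<delta> \<in> linear_lifts D" using \<delta>(1) B(2) by (auto simp: linear_lifts_def)
  then show ?thesis by blast
qed

text \<open>
  The tensor product over \<open>A\<close> is the tensor product over the complex numbers modulo the following
  subspace, where \<open>r a\<close> is the right action of \<open>a\<close> on the first and \<open>l a\<close> the left action of
  \<open>a\<close> on the second factor.  In threefold tensor products \<open>r\<close>, \<open>l\<close> balance the first two
  and \<open>r'\<close>, \<open>l'\<close> the last two factors.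
\<close>

definition balanced ::
  "('a \<Rightarrow> 'm::complex_vector \<Rightarrow> 'm) \<Rightarrow> ('a \<Rightarrow> 'n::complex_vector \<Rightarrow> 'n) \<Rightarrow> ('m \<otimes> 'n) set"
  where "balanced r l = cspan {r a x \<otimes> y - x \<otimes> l a y | a x y. True}"

definition balanced3 ::
  "('a \<Rightarrow> 'm::complex_vector \<Rightarrow> 'm) \<Rightarrow> ('a \<Rightarrow> 'n::complex_vector \<Rightarrow> 'n) \<Rightarrow>
   ('b \<Rightarrow> 'n \<Rightarrow> 'n) \<Rightarrow> ('b \<Rightarrow> 'k::complex_vector \<Rightarrow> 'k) \<Rightarrow> ('m \<otimes> 'n \<otimes> 'k) set"
  where "balanced3 r l r' l' = cspan
    ({r a x \<otimes> y \<otimes> z - x \<otimes> l a y \<otimes> z | a x y z. True} \<union>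
     {x \<otimes> r' b y \<otimes> z - x \<otimes> y \<otimes> l' b z | b x y z. True})"

text \<open>
  The maps \<open>D \<otimes> id\<close> and \<open>id \<otimes> D\<close> on cosets, with values modulo \<open>N\<close>, computed from all linear
  lifts of \<open>D\<close>.  If these maps are well defined, the results do not depend on the lift and on the
  representative, so that the sets below are single cosets of \<open>N\<close>.
\<close>

definition map_left ::
  "('h::complex_vector \<otimes> 'h \<otimes> 'h) set \<Rightarrow> ('h \<Rightarrow> ('h \<otimes> 'h) set) \<Rightarrow> ('h \<otimes> 'h) set \<Rightarrow> ('h \<otimes> 'h \<otimes> 'h) set"
  where "map_left N D X = (\<Union>\<delta>\<in>linear_lifts D. induced (\<lambda>x. tassoc (tmap \<delta> id x)) N X)"

definition map_right ::
  "('h::complex_vector \<otimes> 'h \<otimes> 'h) set \<Rightarrow> ('h \<Rightarrow> ('h \<otimes> 'h) set) \<Rightarrow> ('h \<otimes> 'h) set \<Rightarrow> ('h \<otimes> 'h \<otimes> 'h) set"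
  where "map_right N D X = (\<Union>\<delta>\<in>linear_lifts D. induced (tmap id \<delta>) N X)"

definition coset_mult ::
  "'h::complex_vector alg \<Rightarrow> ('h \<otimes> 'h) set \<Rightarrow> ('h \<otimes> 'h) set \<Rightarrow> ('h \<otimes> 'h) set \<Rightarrow> ('h \<otimes> 'h) set"
  where "coset_mult H N X Y = {x \<cdot>\<^bsub>tensor_alg H H\<^esub> y | x y. x \<in> X \<and> y \<in> Y} + N"


section \<open>Bialgebroids and Hopf algebroids\<close>

locale st_ring = H: complex_algebra H + A: complex_algebra A
  for H :: "'h::complex_vector alg" and A :: "'a::complex_vector alg" +
  fixes s t :: "'a \<Rightarrow> 'h"
  assumes source_hom: "alg_hom A H s"
    and target_hom: "alg_hom (opposite A) H t"
    and source_target_commute: "s a \<cdot>\<^bsub>H\<^esub> t b = t b \<cdot>\<^bsub>H\<^esub> s a"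

definition left_tensor_rel :: "'h::complex_vector alg \<Rightarrow> ('a \<Rightarrow> 'h) \<Rightarrow> ('a \<Rightarrow> 'h) \<Rightarrow> ('h \<otimes> 'h) set"
  where "left_tensor_rel H s t = balanced (\<lambda>a h. t a \<cdot>\<^bsub>H\<^esub> h) (\<lambda>a h. s a \<cdot>\<^bsub>H\<^esub> h)"

definition right_tensor_rel :: "'h::complex_vector alg \<Rightarrow> ('a \<Rightarrow> 'h) \<Rightarrow> ('a \<Rightarrow> 'h) \<Rightarrow> ('h \<otimes> 'h) set"
  where "right_tensor_rel H s t = balanced (\<lambda>a h. h \<cdot>\<^bsub>H\<^esub> s a) (\<lambda>a h. h \<cdot>\<^bsub>H\<^esub> t a)"

definition left_takeuchi ::
  "'h::complex_vector alg \<Rightarrow> ('a \<Rightarrow> 'h) \<Rightarrow> ('a \<Rightarrow> 'h) \<Rightarrow> ('h \<otimes> 'h) set set"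
  where "left_takeuchi H s t =
    (let N = left_tensor_rel H s t in
      {X \<in> quotient_space N. \<forall>a.
         induced (tmap (\<lambda>h. h \<cdot>\<^bsub>H\<^esub> t a) id) N X = induced (tmap id (\<lambda>h. h \<cdot>\<^bsub>H\<^esub> s a)) N X})"

definition right_takeuchi ::
  "'h::complex_vector alg \<Rightarrow> ('a \<Rightarrow> 'h) \<Rightarrow> ('a \<Rightarrow> 'h) \<Rightarrow> ('h \<otimes> 'h) set set"
  where "right_takeuchi H s t =
    (let N = right_tensor_rel H s t in
      {X \<in> quotient_space N. \<forall>a.
         induced (tmap (\<lambda>h. s a \<cdot>\<^bsub>H\<^esub> h) id) N X = induced (tmap id (\<lambda>h. t a \<cdot>\<^bsub>H\<^esub> h)) N X})"

locale left_bialgebroid = st_ring H A s t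
  for H :: "'h::complex_vector alg" and A :: "'a::complex_vector alg" and s t +
  fixes \<Delta> :: "'h \<Rightarrow> ('h \<otimes> 'h) set"
    and \<epsilon> :: "'h \<Rightarrow> 'a"
  assumes comult_linear: "linear_to_quotient (left_tensor_rel H s t) \<Delta>"
    and comult_bimodule: "\<Delta> (s a \<cdot>\<^bsub>H\<^esub> t b \<cdot>\<^bsub>H\<^esub> h) =
      induced (tmap (\<lambda>x. s a \<cdot>\<^bsub>H\<^esub> x) (\<lambda>y. t b \<cdot>\<^bsub>H\<^esub> y)) (left_tensor_rel H s t) (\<Delta> h)"
    and counit_linear: "clinear \<epsilon>"
    and counit_bimodule: "\<epsilon> (s a \<cdot>\<^bsub>H\<^esub> t b \<cdot>\<^bsub>H\<^esub> h) = a \<cdot>\<^bsub>A\<^esub> \<epsilon> h \<cdot>\<^bsub>A\<^esub> b"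
    and coassoc:
      "let N = balanced3 (\<lambda>a h. t a \<cdot>\<^bsub>H\<^esub> h) (\<lambda>a h. s a \<cdot>\<^bsub>H\<^esub> h) (\<lambda>a h. t a \<cdot>\<^bsub>H\<^esub> h) (\<lambda>a h. s a \<cdot>\<^bsub>H\<^esub> h)
       in map_left N \<Delta> (\<Delta> h) = map_right N \<Delta> (\<Delta> h)"
    and counit_left: "x \<in> \<Delta> h \<Longrightarrow> tlift (\<lambda>u v. s (\<epsilon> u) \<cdot>\<^bsub>H\<^esub> v) x = h"
    and counit_right: "x \<in> \<Delta> h \<Longrightarrow> tlift (\<lambda>u v. t (\<epsilon> v) \<cdot>\<^bsub>H\<^esub> u) x = h"
    and comult_takeuchi: "\<Delta> h \<in> left_takeuchi H s t"
    and comult_unit: "\<Delta> \<one>\<^bsub>H\<^esub> = (\<one>\<^bsub>H\<^esub> \<otimes> \<one>\<^bsub>H\<^esub>) +o left_tensor_rel H s t"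
    and comult_mult: "\<Delta> (h \<cdot>\<^bsub>H\<^esub> k) = coset_mult H (left_tensor_rel H s t) (\<Delta> h) (\<Delta> k)"
    and counit_mult_source: "\<epsilon> (h \<cdot>\<^bsub>H\<^esub> k) = \<epsilon> (h \<cdot>\<^bsub>H\<^esub> s (\<epsilon> k))"
    and counit_mult_target: "\<epsilon> (h \<cdot>\<^bsub>H\<^esub> k) = \<epsilon> (h \<cdot>\<^bsub>H\<^esub> t (\<epsilon> k))"

locale right_bialgebroid = st_ring H A s t
  for H :: "'h::complex_vector alg" and A :: "'a::complex_vector alg" and s t +
  fixes \<Delta> :: "'h \<Rightarrow> ('h \<otimes> 'h) set"
    and \<epsilon> :: "'h \<Rightarrow> 'a"
  assumes comult_linear: "linear_to_quotient (right_tensor_rel H s t) \<Delta>"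
    and comult_bimodule: "\<Delta> (h \<cdot>\<^bsub>H\<^esub> t a \<cdot>\<^bsub>H\<^esub> s b) =
      induced (tmap (\<lambda>x. x \<cdot>\<^bsub>H\<^esub> t a) (\<lambda>y. y \<cdot>\<^bsub>H\<^esub> s b)) (right_tensor_rel H s t) (\<Delta> h)"
    and counit_linear: "clinear \<epsilon>"
    and counit_bimodule: "\<epsilon> (h \<cdot>\<^bsub>H\<^esub> t a \<cdot>\<^bsub>H\<^esub> s b) = a \<cdot>\<^bsub>A\<^esub> \<epsilon> h \<cdot>\<^bsub>A\<^esub> b"
    and coassoc:
      "let N = balanced3 (\<lambda>a h. h \<cdot>\<^bsub>H\<^esub> s a) (\<lambda>a h. h \<cdot>\<^bsub>H\<^esub> t a) (\<lambda>a h. h \<cdot>\<^bsub>H\<^esub> s a) (\<lambda>a h. h \<cdot>\<^bsub>H\<^esub> t a)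
       in map_left N \<Delta> (\<Delta> h) = map_right N \<Delta> (\<Delta> h)"
    and counit_left: "x \<in> \<Delta> h \<Longrightarrow> tlift (\<lambda>u v. v \<cdot>\<^bsub>H\<^esub> t (\<epsilon> u)) x = h"
    and counit_right: "x \<in> \<Delta> h \<Longrightarrow> tlift (\<lambda>u v. u \<cdot>\<^bsub>H\<^esub> s (\<epsilon> v)) x = h"
    and comult_takeuchi: "\<Delta> h \<in> right_takeuchi H s t"
    and comult_unit: "\<Delta> \<one>\<^bsub>H\<^esub> = (\<one>\<^bsub>H\<^esub> \<otimes> \<one>\<^bsub>H\<^esub>) +o right_tensor_rel H s t"
    and comult_mult: "\<Delta> (h \<cdot>\<^bsub>H\<^esub> k) = coset_mult H (right_tensor_rel H s t) (\<Delta> h) (\<Delta> k)"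
    and counit_mult_source: "\<epsilon> (h \<cdot>\<^bsub>H\<^esub> k) = \<epsilon> (s (\<epsilon> h) \<cdot>\<^bsub>H\<^esub> k)"
    and counit_mult_target: "\<epsilon> (h \<cdot>\<^bsub>H\<^esub> k) = \<epsilon> (t (\<epsilon> h) \<cdot>\<^bsub>H\<^esub> k)"

text \<open>
  In the mixed coassociativity conditions the common targets are
  \<open>H \<otimes>\<^bsub>L\<^esub> H \<otimes>\<^bsub>R\<^esub> H\<close> and \<open>H \<otimes>\<^bsub>R\<^esub> H \<otimes>\<^bsub>L\<^esub> H\<close>.
\<close>

locale hopf_algebroid =
  left: left_bialgebroid H L s\<^sub>l t\<^sub>l \<Delta>\<^sub>l \<epsilon>\<^sub>l + right: right_bialgebroid H R s\<^sub>r t\<^sub>r \<Delta>\<^sub>r \<epsilon>\<^sub>r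
  for H :: "'h::complex_vector alg"
    and L :: "'l::complex_vector alg" and s\<^sub>l t\<^sub>l \<Delta>\<^sub>l \<epsilon>\<^sub>l
    and R :: "'r::complex_vector alg" and s\<^sub>r t\<^sub>r \<Delta>\<^sub>r \<epsilon>\<^sub>r +
  fixes S :: "'h \<Rightarrow> 'h"
  assumes antipode_linear: "clinear S"
    and antipode_bij: "bij S"
    and left_right_target: "s\<^sub>l (\<epsilon>\<^sub>l (t\<^sub>r b)) = t\<^sub>r b"
    and left_right_source: "t\<^sub>l (\<epsilon>\<^sub>l (s\<^sub>r b)) = s\<^sub>r b"
    and right_left_target: "s\<^sub>r (\<epsilon>\<^sub>r (t\<^sub>l a)) = t\<^sub>l a"
    and right_left_source: "t\<^sub>r (\<epsilon>\<^sub>r (s\<^sub>l a)) = s\<^sub>l a"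
    and mixed_coassoc_left_right:
      "let N = balanced3 (\<lambda>a h. t\<^sub>l a \<cdot>\<^bsub>H\<^esub> h) (\<lambda>a h. s\<^sub>l a \<cdot>\<^bsub>H\<^esub> h) (\<lambda>b h. h \<cdot>\<^bsub>H\<^esub> s\<^sub>r b) (\<lambda>b h. h \<cdot>\<^bsub>H\<^esub> t\<^sub>r b)
       in map_left N \<Delta>\<^sub>l (\<Delta>\<^sub>r h) = map_right N \<Delta>\<^sub>r (\<Delta>\<^sub>l h)"
    and mixed_coassoc_right_left:
      "let N = balanced3 (\<lambda>b h. h \<cdot>\<^bsub>H\<^esub> s\<^sub>r b) (\<lambda>b h. h \<cdot>\<^bsub>H\<^esub> t\<^sub>r b) (\<lambda>a h. t\<^sub>l a \<cdot>\<^bsub>H\<^esub> h) (\<lambda>a h. s\<^sub>l a \<cdot>\<^bsub>H\<^esub> h)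
       in map_left N \<Delta>\<^sub>r (\<Delta>\<^sub>l h) = map_right N \<Delta>\<^sub>l (\<Delta>\<^sub>r h)"
    and antipode_bimodule:
      "S (t\<^sub>l a \<cdot>\<^bsub>H\<^esub> h \<cdot>\<^bsub>H\<^esub> t\<^sub>r b) = s\<^sub>r b \<cdot>\<^bsub>H\<^esub> S h \<cdot>\<^bsub>H\<^esub> s\<^sub>l a"
    and antipode_left: "x \<in> \<Delta>\<^sub>l h \<Longrightarrow> tlift (\<lambda>u v. S u \<cdot>\<^bsub>H\<^esub> v) x = s\<^sub>r (\<epsilon>\<^sub>r h)"
    and antipode_right: "x \<in> \<Delta>\<^sub>r h \<Longrightarrow> tlift (\<lambda>u v. u \<cdot>\<^bsub>H\<^esub> S v) x = s\<^sub>l (\<epsilon>\<^sub>l h)"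


section \<open>The structure maps on \<open>A \<otimes> Q \<otimes> A\<close>\<close>

definition comult3 :: "('q::complex_vector \<Rightarrow> 'q \<otimes> 'q) \<Rightarrow> 'q \<Rightarrow> 'q \<otimes> 'q \<otimes> 'q"
  where "comult3 \<Delta> q = tmap id \<Delta> (\<Delta> q)"

definition aqa_alg ::
  "'q::complex_vector alg \<Rightarrow> ('q \<Rightarrow> 'q \<otimes> 'q) \<Rightarrow> 'a::complex_vector alg \<Rightarrow> ('q \<Rightarrow> 'a \<Rightarrow> 'a)
     \<Rightarrow> ('a \<otimes> 'q \<otimes> 'a) alg"
  where "aqa_alg Q \<Delta> A act =
    \<lparr>amult = (\<lambda>h h'. tlift3 (\<lambda>a q b. tlift3 (\<lambda>a' q' b'.
        tlift3 (\<lambda>q1 q2 q3. (a \<cdot>\<^bsub>A\<^esub> act q1 a') \<otimes> (q2 \<cdot>\<^bsub>Q\<^esub> q') \<otimes> (act q3 b' \<cdot>\<^bsub>A\<^esub> b)) (comult3 \<Delta> q)) h') h),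
     aunit = \<one>\<^bsub>A\<^esub> \<otimes> \<one>\<^bsub>Q\<^esub> \<otimes> \<one>\<^bsub>A\<^esub>\<rparr>"

definition incl_left :: "'q::complex_vector alg \<Rightarrow> 'a::complex_vector alg \<Rightarrow> 'a \<Rightarrow> 'a \<otimes> 'q \<otimes> 'a"
  where "incl_left Q A a = a \<otimes> \<one>\<^bsub>Q\<^esub> \<otimes> \<one>\<^bsub>A\<^esub>"

definition incl_right :: "'q::complex_vector alg \<Rightarrow> 'a::complex_vector alg \<Rightarrow> 'a \<Rightarrow> 'a \<otimes> 'q \<otimes> 'a"
  where "incl_right Q A b = \<one>\<^bsub>A\<^esub> \<otimes> \<one>\<^bsub>Q\<^esub> \<otimes> b"

definition aqa_comult ::
  "('q::complex_vector \<Rightarrow> 'q \<otimes> 'q) \<Rightarrow> 'a::complex_vector alg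
     \<Rightarrow> (('a \<otimes> 'q \<otimes> 'a) \<otimes> ('a \<otimes> 'q \<otimes> 'a)) set
     \<Rightarrow> 'a \<otimes> 'q \<otimes> 'a \<Rightarrow> (('a \<otimes> 'q \<otimes> 'a) \<otimes> ('a \<otimes> 'q \<otimes> 'a)) set"
  where "aqa_comult \<Delta> A N h =
    tlift3 (\<lambda>a q b. tlift (\<lambda>q1 q2. (a \<otimes> q1 \<otimes> \<one>\<^bsub>A\<^esub>) \<otimes> (\<one>\<^bsub>A\<^esub> \<otimes> q2 \<otimes> b)) (\<Delta> q)) h +o N"

definition aqa_left_comult where
  "aqa_left_comult Q \<Delta> A act =
    aqa_comult \<Delta> A (left_tensor_rel (aqa_alg Q \<Delta> A act) (incl_left Q A) (incl_right Q A))"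

definition aqa_right_comult where
  "aqa_right_comult Q \<Delta> A act =
    aqa_comult \<Delta> A (right_tensor_rel (aqa_alg Q \<Delta> A act) (incl_right Q A) (incl_left Q A))"

definition aqa_left_counit ::
  "'a::complex_vector alg \<Rightarrow> ('q::complex_vector \<Rightarrow> 'a \<Rightarrow> 'a) \<Rightarrow> 'a \<otimes> 'q \<otimes> 'a \<Rightarrow> 'a"
  where "aqa_left_counit A act = tlift3 (\<lambda>a q b. a \<cdot>\<^bsub>A\<^esub> act q \<one>\<^bsub>A\<^esub> \<cdot>\<^bsub>A\<^esub> b)"

definition aqa_right_counit ::
  "('q::complex_vector \<Rightarrow> 'q) \<Rightarrow> 'a::complex_vector alg \<Rightarrow> ('q \<Rightarrow> 'a \<Rightarrow> 'a) \<Rightarrow> 'a \<otimes> 'q \<otimes> 'a \<Rightarrow> 'a"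
  where "aqa_right_counit T A act = tlift3 (\<lambda>a q b. act (T q) (b \<cdot>\<^bsub>A\<^esub> a))"

definition aqa_antipode ::
  "('q::complex_vector \<Rightarrow> 'q \<otimes> 'q) \<Rightarrow> ('q \<Rightarrow> 'q) \<Rightarrow> ('q \<Rightarrow> 'a::complex_vector \<Rightarrow> 'a)
     \<Rightarrow> 'a \<otimes> 'q \<otimes> 'a \<Rightarrow> 'a \<otimes> 'q \<otimes> 'a"
  where "aqa_antipode \<Delta> T act = tlift3 (\<lambda>a q b.
    tlift3 (\<lambda>q1 q2 q3. act (T q3) b \<otimes> T q2 \<otimes> act (T q1) a) (comult3 \<Delta> q))"

end

theory Submission
  imports Defs
begin

text \<open>
  Write \<open>q\<^sub>1 \<otimes> q\<^sub>2 \<otimes> \<dots>\<close> for the iterated coproduct of \<open>Q\<close>, and \<open>iL a\<close>, \<open>iR b\<close>, \<open>incl_mid q\<close> for the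
  elements \<open>a \<otimes> 1 \<otimes> 1\<close>, \<open>1 \<otimes> 1 \<otimes> b\<close>, \<open>1 \<otimes> q \<otimes> 1\<close> of \<open>H = A \<otimes> Q \<otimes> A\<close>.  Three ideas carry the proof.

  \<^item> These three kinds of elements generate \<open>H\<close>: \<open>a \<otimes> q \<otimes> b\<close> is the product of \<open>iL a\<close>, \<open>iR b\<close> and
    \<open>incl_mid q\<close> (\<open>pure_eq_product\<close>).  Associativity of \<open>H\<close> (\<open>assoc_H\<close>) and the multiplicativity of
    the coproduct (\<open>split_comult_mult\<close>) need to be computed only when one factor is a generator.

  \<^item> The left and the right comultiplication come from one and the same linear map
    \<open>split_comult : a \<otimes> q \<otimes> b \<mapsto> (a \<otimes> q\<^sub>1 \<otimes> 1) \<otimes> (1 \<otimes> q\<^sub>2 \<otimes> b)\<close> into \<open>H \<otimes> H\<close> over the complex numbers,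
    and already this map is a coassociative homomorphism of unital algebras (\<open>split_comult_mult\<close>,
    \<open>split_comult_coassoc\<close>).  The bimodule laws and all four coassociativity laws, pure and mixed,
    are obtained by passing to the quotients (\<open>split_comult_mixed_coassoc\<close>).  For multiplicativity modulo
    the balancing relations, the Takeuchi condition has to be added (\<open>left_takeuchi_split_comult\<close>,
    \<open>right_takeuchi_split_comult\<close>).

  \<^item> As \<open>T\<close> is an anti-homomorphism, applying it to the antipode axioms gives, because of
    \<open>T \<circ> T = id\<close>, also \<open>T q\<^sub>2 \<cdot> q\<^sub>1 = \<epsilon> q = q\<^sub>2 \<cdot> T q\<^sub>1\<close>.  These two identities are used for the right
    counit, for the Takeuchi condition on the right, and for the antipode \<open>S\<close>, which is an involution
    and therefore invertible.

  Computations in Sweedler notation become rewriting as follows.  An expression that is bilinear in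
  \<open>q\<^sub>1\<close> and \<open>q\<^sub>2\<close> is written \<open>sw q (\<lambda>q\<^sub>1 q\<^sub>2. \<dots>)\<close>, and longer coproducts are nested applications of
  \<open>sw\<close>.  Coassociativity brings them into right-nested form, in which both sides of an identity
  agree up to cancelling factors such as \<open>T q\<^sub>1 \<cdot> q\<^sub>2\<close>.
\<close>


section \<open>Multilinear maps\<close>

lemma clinear_add: "clinear f \<Longrightarrow> f (x + y) = f x + f y"
  by (rule complex_vector.linear_add)

lemma clinear_scale: "clinear f \<Longrightarrow> f (c *\<^sub>C x) = c *\<^sub>C f x"
  by (rule complex_vector.linear_scale)

lemma cbilinearI:
  assumes "\<And>x. clinear (f x)" and "\<And>y. clinear (\<lambda>x. f x y)"
  shows "cbilinear f"
  using assms by (simp add: cbilinear_def)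

lemma cbilinearD:
  assumes "cbilinear f"
  shows "clinear (f x)" and "clinear (\<lambda>x. f x y)"
  using assms by (simp_all add: cbilinear_def)

text \<open>
  As rewrite rules, the facts collected here decide whether an expression is linear in a variable,
  by recursion on the expression.  They discharge the multilinearity conditions of all later rules.
\<close>

named_theorems linearity

lemma clinear_ident [linearity]: "clinear (\<lambda>x. x)"
  by (rule clinearI) simp_all

lemma clinear_id [linearity]: "clinear id"
  by (rule clinearI) simp_all

lemma clinear_comp: "clinear f \<Longrightarrow> clinear g \<Longrightarrow> clinear (\<lambda>x. f (g x))"
  by (rule clinearI) (simp_all add: clinear_add clinear_scale)

lemma cbilinear_compose_left: "cbilinear f \<Longrightarrow> clinear g \<Longrightarrow> clinear (\<lambda>x. f (g x) c)"
  using clinear_comp[of "\<lambda>x. f x c" g] cbilinearD(2)[of f c] by simp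

lemma cbilinear_compose_right: "cbilinear f \<Longrightarrow> clinear g \<Longrightarrow> clinear (\<lambda>x. f c (g x))"
  using clinear_comp[of "f c" g] cbilinearD(1)[of f c] by simp

lemmas cbilinear_compose = cbilinear_compose_left cbilinear_compose_right

lemmas clinear_pure [linearity] = cbilinear_compose[OF cbilinear_tensor_pure]

lemma clinear_scaleC [linearity]:
  "clinear f \<Longrightarrow> clinear (\<lambda>x. c *\<^sub>C f x)"
  "clinear g \<Longrightarrow> clinear (\<lambda>x. g x *\<^sub>C y)"
  by (rule clinearI; simp add: clinear_add clinear_scale scaleC_add_right scaleC_add_left
      scaleC_scaleC scaleC_complex_def mult.commute)+

lemma clinear_plus [linearity]:
  "clinear f \<Longrightarrow> clinear g \<Longrightarrow> clinear (\<lambda>x. f x + g x)"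
  by (rule clinearI) (simp_all add: clinear_add clinear_scale scaleC_add_right)

lemma clinear_diff [linearity]:
  "clinear f \<Longrightarrow> clinear g \<Longrightarrow> clinear (\<lambda>x. f x - g x)"
  by (rule clinearI)
    (simp_all add: clinear_add clinear_scale complex_vector.scale_right_diff_distrib)

lemma tensor_induct [case_names pure add]:
  assumes pure: "\<And>a b. P (a \<otimes> b)" and add: "\<And>x y. P x \<Longrightarrow> P y \<Longrightarrow> P (x + y)"
  shows "P (x :: 'a::complex_vector \<otimes> 'b::complex_vector)"
proof -
  have scale: "c *\<^sub>C (a \<otimes> b) = (c *\<^sub>C a) \<otimes> b" for c and a :: 'a and b :: 'b
    by (simp add: clinear_scale[OF cbilinearD(2)[OF cbilinear_tensor_pure]])
  have "x \<in> cspan {a \<otimes> b | a b. True}" unfolding span_tensor_pure by simp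
  then show ?thesis
  proof (induction rule: complex_vector.span_induct_alt)
    case base
    show ?case using pure[of 0 0]
      by (simp add: complex_vector.linear_0[OF cbilinearD(2)[OF cbilinear_tensor_pure]])
  next
    case (step c x y)
    then show ?case using pure add by (auto simp: scale)
  qed
qed

lemma tensor_eq:
  fixes F G :: "'a::complex_vector \<otimes> 'b::complex_vector \<Rightarrow> 'c::complex_vector"
  assumes "clinear F" and "clinear G" and "\<And>a b. F (a \<otimes> b) = G (a \<otimes> b)"
  shows "F x = G x"
  using tensor_eqI[OF assms] by simp

lemma tensor_eq3:
  fixes F G :: "'a::complex_vector \<otimes> 'b::complex_vector \<otimes> 'c::complex_vector \<Rightarrow> 'd::complex_vector"
  assumes "clinear F" and "clinear G" and "\<And>a b c. F (a \<otimes> b \<otimes> c) = G (a \<otimes> b \<otimes> c)"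
  shows "F x = G x"
proof (rule tensor_eq[OF assms(1,2)])
  fix a and y :: "'b \<otimes> 'c"
  show "F (a \<otimes> y) = G (a \<otimes> y)"
    by (rule tensor_eq[of "\<lambda>y. F (a \<otimes> y)" "\<lambda>y. G (a \<otimes> y)"])
      (simp_all add: assms linearity clinear_comp[OF assms(1)] clinear_comp[OF assms(2)])
qed

lemma clinear_tlift [linearity]:
  assumes "cbilinear f" and "clinear g"
  shows "clinear (\<lambda>x. tlift f (g x))"
  using clinear_comp[OF tlift(1)[OF assms(1)] assms(2)] .

text \<open>
  Bilinearity is reduced to linearity in each variable, so that the rules apply to it, too.
\<close>

lemma cbilinear_iff [linearity]:
  "cbilinear f \<longleftrightarrow> (\<forall>x. clinear (f x)) \<and> (\<forall>y. clinear (\<lambda>x. f x y))"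
  by (rule cbilinear_def)

text \<open>
  Here the variable occurs in the bilinear map rather than in the tensor to which it is applied.
\<close>

lemma clinear_tlift_param [linearity]:
  assumes "\<And>x. cbilinear (f x)" and "\<And>a b. clinear (\<lambda>x. f x a b)"
  shows "clinear (\<lambda>x. tlift (f x) t)"
proof (rule clinearI)
  fix x y c
  have [linearity]: "clinear (f x a)" "clinear (\<lambda>a. f x a b)" for x a b
    using cbilinearD[OF assms(1)] by auto
  show "tlift (f (x + y)) t = tlift (f x) t + tlift (f y) t"
    by (rule tensor_eq)
      (simp_all add: linearity tlift clinear_add[OF assms(2)])
  show "tlift (f (c *\<^sub>C x)) t = c *\<^sub>C tlift (f x) t"
    by (rule tensor_eq)
      (simp_all add: linearity tlift clinear_scale[OF assms(2)])
qed

lemma linear_tlift: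
  assumes "clinear g" and "cbilinear f"
  shows "g (tlift f t) = tlift (\<lambda>a b. g (f a b)) t"
proof (rule tensor_eq[of "\<lambda>t. g (tlift f t)" "tlift (\<lambda>a b. g (f a b))"])
  have "cbilinear (\<lambda>a b. g (f a b))"
    by (intro cbilinearI clinear_comp[OF assms(1)] cbilinearD[OF assms(2)])
  from tlift[OF this] show "clinear (tlift (\<lambda>a b. g (f a b)))"
    and "g (tlift f (a \<otimes> b)) = tlift (\<lambda>a b. g (f a b)) (a \<otimes> b)" for a b
    using tlift(2)[OF assms(2)] by simp_all
  show "clinear (\<lambda>t. g (tlift f t))"
    by (rule clinear_comp[OF assms(1) tlift(1)[OF assms(2)]])
qed

lemma tlift_swap:
  assumes "\<And>a b. cbilinear (\<lambda>c d. f a b c d)" and "\<And>c d. cbilinear (\<lambda>a b. f a b c d)"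
  shows "tlift (\<lambda>a b. tlift (\<lambda>c d. f a b c d) u) t = tlift (\<lambda>c d. tlift (\<lambda>a b. f a b c d) t) u"
  by (rule tensor_eq[where x=t])
    (use assms in \<open>simp_all add: linearity tlift\<close>)

lemma clinear_tmap [linearity]:
  assumes "clinear f" and "clinear g" and "clinear k"
  shows "clinear (\<lambda>x. tmap f g (k x))"
  unfolding tmap_def using assms by (simp add: linearity clinear_comp)

lemma tmap_pure [simp]:
  assumes "clinear f" and "clinear g"
  shows "tmap f g (x \<otimes> y) = f x \<otimes> g y"
  unfolding tmap_def using assms by (subst tlift(2)) (simp_all add: linearity)

lemma tmap_tmap:
  assumes "clinear f" "clinear g" "clinear f'" "clinear g'"
  shows "tmap f g (tmap f' g' t) = tmap (\<lambda>x. f (f' x)) (\<lambda>y. g (g' y)) t"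
  by (rule tensor_eq[where x=t])
    (simp_all add: linearity assms clinear_comp[OF assms(1)] clinear_comp[OF assms(2)])

lemma clinear_tassoc [linearity]: "clinear k \<Longrightarrow> clinear (\<lambda>x. tassoc (k x))"
  unfolding tassoc_def by (simp add: linearity)

lemma tassoc_pure [simp]: "tassoc ((x \<otimes> y) \<otimes> z) = x \<otimes> y \<otimes> z"
  unfolding tassoc_def by (simp add: linearity tlift)

lemma tlift3_pure:
  assumes [linearity]: "\<And>y z. clinear (\<lambda>x. f x y z)" "\<And>x z. clinear (\<lambda>y. f x y z)"
    "\<And>x y. clinear (\<lambda>z. f x y z)"
  shows "tlift3 f (x \<otimes> y \<otimes> z) = f x y z"
  unfolding tlift3_def by (simp add: linearity tlift)


section \<open>Cosets and balanced tensor products\<close>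

lemma image_subspace_subset:
  assumes "clinear f" and "complex_vector.subspace N" and "\<And>x. x \<in> G \<Longrightarrow> f x \<in> N"
  shows "x \<in> cspan G \<Longrightarrow> f x \<in> N"
proof -
  assume "x \<in> cspan G"
  have "complex_vector.subspace {x. f x \<in> N}"
    using assms(2) by (simp add: complex_vector.subspace_def clinear_add[OF assms(1)]
        clinear_scale[OF assms(1)] complex_vector.linear_0[OF assms(1)])
  then show ?thesis
    using complex_vector.span_minimal[of G "{x. f x \<in> N}"] assms(3) \<open>x \<in> cspan G\<close> by blast
qed

lemma subspace_balanced: "complex_vector.subspace (balanced r l)"
  unfolding balanced_def by (rule complex_vector.subspace_span)

lemma subspace_balanced3: "complex_vector.subspace (balanced3 r l r' l')"
  unfolding balanced3_def by (rule complex_vector.subspace_span)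

lemma balanced_relation: "r a x \<otimes> y - x \<otimes> l a y \<in> balanced r l"
  unfolding balanced_def by (rule complex_vector.span_base) blast

lemma balanced3_relation_left: "r a x \<otimes> y \<otimes> z - x \<otimes> l a y \<otimes> z \<in> balanced3 r l r' l'"
  unfolding balanced3_def by (rule complex_vector.span_base) blast

lemma balanced3_relation_right: "x \<otimes> r' b y \<otimes> z - x \<otimes> y \<otimes> l' b z \<in> balanced3 r l r' l'"
  unfolding balanced3_def by (rule complex_vector.span_base) blast

lemma balanced_mapped:
  assumes "n \<in> balanced r l" and "clinear f" and "complex_vector.subspace N"
    and "\<And>a x y. f (r a x \<otimes> y) - f (x \<otimes> l a y) \<in> N"
  shows "f n \<in> N"
  using assms(1) unfolding balanced_def
  by (rule image_subspace_subset[OF assms(2,3), rotated])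
    (use assms(4) in \<open>auto simp: complex_vector.linear_diff[OF assms(2)]\<close>)

lemma balanced_vanishing:
  assumes "n \<in> balanced r l" and "clinear f"
    and "\<And>a x y. f (r a x \<otimes> y) = f (x \<otimes> l a y)"
  shows "f n = 0"
  using balanced_mapped[OF assms(1,2) complex_vector.subspace_single_0] assms(3) by auto

lemma coset_member_iff: "x \<in> y +o (N :: 'v::complex_vector set) \<longleftrightarrow> x - y \<in> N"
proof
  show "x - y \<in> N \<Longrightarrow> x \<in> y +o N"
    unfolding elt_set_plus_def by (intro CollectI bexI[of _ "x - y"]) simp_all
qed (auto simp: elt_set_plus_def)

lemma coset_eqI:
  assumes "complex_vector.subspace N" and "x - y \<in> N"
  shows "x +o N = y +o N"
proof -
  have "z - x \<in> N \<longleftrightarrow> z - y \<in> N" for z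
    using complex_vector.subspace_add[OF assms(1) _ assms(2), of "z - x"]
      complex_vector.subspace_diff[OF assms(1) _ assms(2), of "z - y"] by auto
  then show ?thesis by (auto simp: coset_member_iff)
qed

text \<open>
  Induced maps and products of cosets are defined as sums \<open>X + N\<close>.  Such a sum is a single coset
  when the elements of \<open>X\<close> are congruent modulo \<open>N\<close>.
\<close>

lemma coset_plus_subspace:
  assumes N: "complex_vector.subspace N" and "x \<in> X" and "\<And>y. y \<in> X \<Longrightarrow> y - x \<in> N"
  shows "X + N = x +o N"
proof (intro equalityI subsetI)
  fix z assume "z \<in> X + N"
  then obtain y n where z: "z = y + n" and y: "y \<in> X" "n \<in> N" by (rule set_plus_elim)
  then have "(y - x) + n \<in> N" using assms(3) complex_vector.subspace_add[OF N] by blast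
  then show "z \<in> x +o N" by (simp add: coset_member_iff z algebra_simps)
next
  fix z assume "z \<in> x +o N"
  then show "z \<in> X + N" using assms(2) by (auto simp: elt_set_plus_def)
qed

lemma induced_coset:
  assumes "clinear f" and "complex_vector.subspace M" and "complex_vector.subspace N"
    and "\<And>n. n \<in> M \<Longrightarrow> f n \<in> N"
  shows "induced f N (x +o M) = f x +o N"
  unfolding induced_def
proof (rule coset_plus_subspace[OF assms(3)])
  show "f x \<in> f ` (x +o M)"
    using complex_vector.subspace_0[OF assms(2)] by (auto simp: coset_member_iff)
  show "y - f x \<in> N" if y: "y \<in> f ` (x +o M)" for y
  proof -
    from y obtain z where z: "y = f z" "z - x \<in> M" by (auto simp: coset_member_iff)
    then show ?thesis using assms(4) by (metis complex_vector.linear_diff[OF assms(1)])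
  qed
qed

lemma linear_to_quotient_cosets:
  assumes "clinear \<delta>" and N: "complex_vector.subspace N"
  shows "linear_to_quotient N (\<lambda>h. \<delta> h +o N)"
  unfolding linear_to_quotient_def
proof (intro conjI allI)
  show "\<delta> x +o N \<in> quotient_space N" for x by (auto simp: quotient_space_def)
  have NN: "N + N = N"
    using coset_plus_subspace[OF N complex_vector.subspace_0[OF N]] by simp
  show "\<delta> (x + y) +o N = (\<delta> x +o N) + (\<delta> y +o N)" for x y
    by (simp add: clinear_add[OF assms(1)] set_plus_rearrange NN)
  show "\<delta> (c *\<^sub>C x) +o N = induced (scaleC c) N (\<delta> x +o N)" for c x
    by (subst induced_coset[OF _ N N])
      (simp_all add: linearity clinear_scale[OF assms(1)] complex_vector.subspace_scale[OF N])
qed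

lemma coset_mult_coset:
  assumes "complex_vector.subspace N"
    and "\<And>x' y'. x' - x \<in> N \<Longrightarrow> y' - y \<in> N \<Longrightarrow> x' \<cdot>\<^bsub>tensor_alg H H\<^esub> y' - x \<cdot>\<^bsub>tensor_alg H H\<^esub> y \<in> N"
  shows "coset_mult H N (x +o N) (y +o N) = x \<cdot>\<^bsub>tensor_alg H H\<^esub> y +o N"
  unfolding coset_mult_def
proof (rule coset_plus_subspace[OF assms(1)])
  have "x \<in> x +o N" "y \<in> y +o N"
    by (simp_all add: coset_member_iff complex_vector.subspace_0[OF assms(1)])
  then show "x \<cdot>\<^bsub>tensor_alg H H\<^esub> y \<in> {x' \<cdot>\<^bsub>tensor_alg H H\<^esub> y' | x' y'. x' \<in> x +o N \<and> y' \<in> y +o N}"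
    by blast
qed (use assms(2) in \<open>auto simp: coset_member_iff\<close>)

text \<open>
  Axioms that speak of all representatives \<open>x\<close> of a coset are reduced to one representative.
\<close>

lemma coset_evaluation:
  assumes "x \<in> y +o balanced r l" and "clinear f"
    and "\<And>a u v. f (r a u \<otimes> v) = f (u \<otimes> l a v)"
  shows "f x = f y"
proof -
  have "f (x - y) = 0"
    using balanced_vanishing[OF _ assms(2,3)] assms(1) by (simp add: coset_member_iff)
  then show ?thesis by (simp add: complex_vector.linear_diff[OF assms(2)])
qed

text \<open>
  A lift of \<open>h \<mapsto> \<delta> h + M\<close> differs from \<open>\<delta>\<close> by a linear map into \<open>M\<close>, so that its extensions to
  a tensor factor differ by elements of \<open>M \<otimes> H\<close> or \<open>H \<otimes> M\<close>, which are balanced.  What remains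
  is that \<open>\<delta> \<otimes> id\<close> (respectively \<open>id \<otimes> \<delta>\<close>) respects the other balancing relation, and this holds
  because \<open>\<delta>\<close> commutes with the action on the factor where the new relation lives.
\<close>

lemma map_left_coset:
  assumes \<delta>: "clinear \<delta>" and r': "\<And>a. clinear (r' a)"
    and \<delta>r: "\<And>a u. \<delta> (r' a u) = tmap id (r' a) (\<delta> u)"
  shows "map_left (balanced3 r l r' l') (\<lambda>h. \<delta> h +o balanced r l) (x +o balanced r' l')
    = tassoc (tmap \<delta> id x) +o balanced3 r l r' l'"
proof -
  let ?N = "balanced3 r l r' l'"
  have first: "tassoc (n \<otimes> v) \<in> ?N" if "n \<in> balanced r l" for n v
  proof (rule balanced_mapped[where f="\<lambda>t. tassoc (t \<otimes> v)", OF that _ subspace_balanced3])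
    show "tassoc ((r a x \<otimes> y) \<otimes> v) - tassoc ((x \<otimes> l a y) \<otimes> v) \<in> ?N" for a x y
      using balanced3_relation_left by simp
  qed (simp add: linearity)
  have respects: "tassoc (tmap \<delta> id n) \<in> ?N" if "n \<in> balanced r' l'" for n
  proof (rule balanced_mapped[where f="\<lambda>t. tassoc (tmap \<delta> id t)", OF that _ subspace_balanced3])
    fix a u v
    have "tassoc (tmap id (r' a) t \<otimes> v) - tassoc (t \<otimes> l' a v) \<in> ?N" for t
    proof (induction t rule: tensor_induct)
      case (pure x y)
      show ?case using balanced3_relation_right by (simp add: r' linearity)
    next
      case (add s t)
      have "tassoc (tmap id (r' a) (s + t) \<otimes> v) - tassoc ((s + t) \<otimes> l' a v) =
        (tassoc (tmap id (r' a) s \<otimes> v) - tassoc (s \<otimes> l' a v)) +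
        (tassoc (tmap id (r' a) t \<otimes> v) - tassoc (t \<otimes> l' a v))"
        by (simp add: clinear_add[of "\<lambda>t. tassoc (tmap id (r' a) t \<otimes> v)"]
            clinear_add[of "\<lambda>t. tassoc (t \<otimes> l' a v)"] linearity r')
      then show ?case using add complex_vector.subspace_add[OF subspace_balanced3] by metis
    qed
    then show "tassoc (tmap \<delta> id (r' a u \<otimes> v)) - tassoc (tmap \<delta> id (u \<otimes> l' a v)) \<in> ?N"
      by (simp add: \<delta> \<delta>r linearity)
  qed (simp add: linearity \<delta>)
  have "induced (\<lambda>x. tassoc (tmap \<delta>' id x)) ?N (x +o balanced r' l') = tassoc (tmap \<delta> id x) +o ?N"
    if "\<delta>' \<in> linear_lifts (\<lambda>h. \<delta> h +o balanced r l)" for \<delta>'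
  proof -
    have \<delta>': "clinear \<delta>'" and diff: "\<delta>' h - \<delta> h \<in> balanced r l" for h
      using that by (auto simp: linear_lifts_def coset_member_iff)
    have near: "tassoc (tmap \<delta>' id t) - tassoc (tmap \<delta> id t) \<in> ?N" for t
    proof (induction t rule: tensor_induct)
      case (pure u v)
      have "tassoc (tmap \<delta>' id (u \<otimes> v)) - tassoc (tmap \<delta> id (u \<otimes> v)) = tassoc ((\<delta>' u - \<delta> u) \<otimes> v)"
        by (simp add: \<delta> \<delta>' linearity complex_vector.linear_diff[of "\<lambda>t. tassoc (t \<otimes> v)"])
      then show ?case using first[OF diff] by (simp only:)
    next
      case (add s t)
      have "tassoc (tmap \<delta>' id (s + t)) - tassoc (tmap \<delta> id (s + t)) =
        (tassoc (tmap \<delta>' id s) - tassoc (tmap \<delta> id s)) + (tassoc (tmap \<delta>' id t) - tassoc (tmap \<delta> id t))"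
        by (simp add: clinear_add[of "\<lambda>t. tassoc (tmap \<delta> id t)"]
            clinear_add[of "\<lambda>t. tassoc (tmap \<delta>' id t)"] linearity \<delta> \<delta>')
      then show ?case using add complex_vector.subspace_add[OF subspace_balanced3] by metis
    qed
    have "tassoc (tmap \<delta>' id n) \<in> ?N" if "n \<in> balanced r' l'" for n
      using complex_vector.subspace_add[OF subspace_balanced3 near[of n] respects[OF that]] by simp
    then have "induced (\<lambda>x. tassoc (tmap \<delta>' id x)) ?N (x +o balanced r' l') = tassoc (tmap \<delta>' id x) +o ?N"
      by (intro induced_coset subspace_balanced subspace_balanced3) (simp_all add: linearity \<delta>')
    also have "\<dots> = tassoc (tmap \<delta> id x) +o ?N"
      by (rule coset_eqI[OF subspace_balanced3 near])
    finally show ?thesis .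
  qed
  moreover have "\<delta> \<in> linear_lifts (\<lambda>h. \<delta> h +o balanced r l)"
    using \<delta> by (simp add: linear_lifts_def coset_member_iff complex_vector.subspace_0[OF subspace_balanced])
  ultimately show ?thesis unfolding map_left_def by blast
qed

lemma map_right_coset:
  assumes \<delta>: "clinear \<delta>" and l: "\<And>a. clinear (l a)"
    and \<delta>l: "\<And>a v. \<delta> (l a v) = tmap (l a) id (\<delta> v)"
  shows "map_right (balanced3 r l r' l') (\<lambda>h. \<delta> h +o balanced r' l') (x +o balanced r l)
    = tmap id \<delta> x +o balanced3 r l r' l'"
proof -
  let ?N = "balanced3 r l r' l'"
  have second: "u \<otimes> n \<in> ?N" if "n \<in> balanced r' l'" for n u
  proof (rule balanced_mapped[where f="\<lambda>t. u \<otimes> t", OF that _ subspace_balanced3])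
    show "u \<otimes> r' a x \<otimes> y - u \<otimes> x \<otimes> l' a y \<in> ?N" for a x y
      by (rule balanced3_relation_right)
  qed (simp add: linearity)
  have respects: "tmap id \<delta> n \<in> ?N" if "n \<in> balanced r l" for n
  proof (rule balanced_mapped[where f="tmap id \<delta>", OF that _ subspace_balanced3])
    fix a u v
    have "r a u \<otimes> t - u \<otimes> tmap (l a) id t \<in> ?N" for t
    proof (induction t rule: tensor_induct)
      case (pure x y)
      show ?case using balanced3_relation_left by (simp add: l linearity)
    next
      case (add s t)
      have "r a u \<otimes> (s + t) - u \<otimes> tmap (l a) id (s + t) =
        (r a u \<otimes> s - u \<otimes> tmap (l a) id s) + (r a u \<otimes> t - u \<otimes> tmap (l a) id t)"
        by (simp add: clinear_add[of "\<lambda>t. r a u \<otimes> t"]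
            clinear_add[of "\<lambda>t. u \<otimes> tmap (l a) id t"] linearity l)
      then show ?case using add complex_vector.subspace_add[OF subspace_balanced3] by metis
    qed
    then show "tmap id \<delta> (r a u \<otimes> v) - tmap id \<delta> (u \<otimes> l a v) \<in> ?N"
      by (simp add: \<delta> \<delta>l linearity)
  qed (rule clinear_tmap[OF clinear_id \<delta> clinear_ident])
  have "induced (tmap id \<delta>') ?N (x +o balanced r l) = tmap id \<delta> x +o ?N"
    if "\<delta>' \<in> linear_lifts (\<lambda>h. \<delta> h +o balanced r' l')" for \<delta>'
  proof -
    have \<delta>': "clinear \<delta>'" and diff: "\<delta>' h - \<delta> h \<in> balanced r' l'" for h
      using that by (auto simp: linear_lifts_def coset_member_iff)
    have near: "tmap id \<delta>' t - tmap id \<delta> t \<in> ?N" for t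
    proof (induction t rule: tensor_induct)
      case (pure u v)
      have "tmap id \<delta>' (u \<otimes> v) - tmap id \<delta> (u \<otimes> v) = u \<otimes> (\<delta>' v - \<delta> v)"
        by (simp add: \<delta> \<delta>' linearity complex_vector.linear_diff[of "\<lambda>t. u \<otimes> t"])
      then show ?case using second[OF diff] by (simp only:)
    next
      case (add s t)
      have "tmap id \<delta>' (s + t) - tmap id \<delta> (s + t) =
        (tmap id \<delta>' s - tmap id \<delta> s) + (tmap id \<delta>' t - tmap id \<delta> t)"
        by (simp add: clinear_add[of "tmap id \<delta>"]
            clinear_add[of "tmap id \<delta>'"] clinear_tmap[OF clinear_id _ clinear_ident] \<delta> \<delta>')
      then show ?case using add complex_vector.subspace_add[OF subspace_balanced3] by metis
    qed
    have lin: "clinear (tmap id \<delta>')" by (rule clinear_tmap[OF clinear_id \<delta>' clinear_ident])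
    have "tmap id \<delta>' n \<in> ?N" if "n \<in> balanced r l" for n
      using complex_vector.subspace_add[OF subspace_balanced3 near[of n] respects[OF that]] by simp
    then have "induced (tmap id \<delta>') ?N (x +o balanced r l) = tmap id \<delta>' x +o ?N"
      by (intro induced_coset subspace_balanced subspace_balanced3 lin)
    also have "\<dots> = tmap id \<delta> x +o ?N"
      by (rule coset_eqI[OF subspace_balanced3 near])
    finally show ?thesis .
  qed
  moreover have "\<delta> \<in> linear_lifts (\<lambda>h. \<delta> h +o balanced r' l')"
    using \<delta> by (simp add: linear_lifts_def coset_member_iff complex_vector.subspace_0[OF subspace_balanced])
  ultimately show ?thesis unfolding map_right_def by blast
qed


section \<open>Opposite algebras and tensor products of algebras\<close>

lemma cbilinear_scale:
  assumes "cbilinear f"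
  shows "f (c *\<^sub>C x) y = c *\<^sub>C f x y" and "f x (c *\<^sub>C y) = c *\<^sub>C f x y"
  using clinear_scale[OF cbilinearD(2)[OF assms]] clinear_scale[OF cbilinearD(1)[OF assms]] by auto

text \<open>
  The rewrite rules for computations in Sweedler notation.  They pull scalars and coproducts out of
  products and tensors, and bring nested coproducts into right-nested form.
\<close>

named_theorems sweedler

text \<open>
  Scalars are kept apart rather than multiplied together, so that the counit law can find the factor
  \<open>\<epsilon> q\<^sub>i\<close> that it removes.
\<close>

declare complex_vector.scale_scale [simp del] scaleC_scaleC [symmetric, sweedler]

lemmas pure_scale [sweedler] = cbilinear_scale[OF cbilinear_tensor_pure]

context complex_algebra
begin

lemmas clinear_mult [linearity] = cbilinear_compose[OF bilinear]

lemmas mult_scale [sweedler] = cbilinear_scale[OF bilinear]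

lemmas algebra_laws [sweedler] = assoc unit_left unit_right

end

lemma opposite_opposite [simp]: "opposite (opposite A) = A"
  by (simp add: opposite_def)

lemma complex_algebra_opposite:
  assumes "complex_algebra A"
  shows "complex_algebra (opposite A)"
proof -
  interpret A: complex_algebra A by fact
  show ?thesis
    by standard (simp_all add: opposite_def linearity A.assoc A.unit_left A.unit_right)
qed

lemma complex_algebra_tensor_alg:
  assumes "complex_algebra A" and "complex_algebra B"
  shows "complex_algebra (tensor_alg A B)"
proof -
  interpret A: complex_algebra A by fact
  interpret B: complex_algebra B by fact
  have bilin: "clinear (\<lambda>x. x \<cdot>\<^bsub>tensor_alg A B\<^esub> y)" "clinear (\<lambda>x. y \<cdot>\<^bsub>tensor_alg A B\<^esub> x)" for y
    by (simp_all add: tensor_alg_def tmap_def linearity)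
  have pure: "(a \<otimes> b) \<cdot>\<^bsub>tensor_alg A B\<^esub> (c \<otimes> d) = (a \<cdot>\<^bsub>A\<^esub> c) \<otimes> (b \<cdot>\<^bsub>B\<^esub> d)" for a b c d
    by (simp add: tensor_alg_def tmap_def linearity tlift)
  have bilinear: "cbilinear (amult (tensor_alg A B))" by (intro cbilinearI bilin)
  note lin = cbilinear_compose[OF bilinear] linearity
  show ?thesis
  proof
    show "cbilinear (amult (tensor_alg A B))" by (rule bilinear)
  next
    fix x y z
    let ?m = "amult (tensor_alg A B)"
    have 1: "?m (?m (a \<otimes> b) (c \<otimes> d)) z = ?m (a \<otimes> b) (?m (c \<otimes> d) z)" for a b c d
      by (rule tensor_eq[where x=z]) (simp_all add: lin pure A.assoc B.assoc)
    have 2: "?m (?m (a \<otimes> b) y) z = ?m (a \<otimes> b) (?m y z)" for a b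
      by (rule tensor_eq[where x=y]) (simp_all add: lin 1)
    show "?m (?m x y) z = ?m x (?m y z)"
      by (rule tensor_eq[where x=x]) (simp_all add: lin 2)
  next
    fix x
    have one: "\<one>\<^bsub>tensor_alg A B\<^esub> = \<one>\<^bsub>A\<^esub> \<otimes> \<one>\<^bsub>B\<^esub>" by (simp add: tensor_alg_def)
    show "\<one>\<^bsub>tensor_alg A B\<^esub> \<cdot>\<^bsub>tensor_alg A B\<^esub> x = x"
      by (rule tensor_eq[where x=x]) (simp_all add: lin one pure A.unit_left B.unit_left)
    show "x \<cdot>\<^bsub>tensor_alg A B\<^esub> \<one>\<^bsub>tensor_alg A B\<^esub> = x"
      by (rule tensor_eq[where x=x]) (simp_all add: lin one pure A.unit_right B.unit_right)
  qed
qed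

lemma tensor_alg_pure [simp]:
  assumes "complex_algebra A" and "complex_algebra B"
  shows "(a \<otimes> b) \<cdot>\<^bsub>tensor_alg A B\<^esub> (c \<otimes> d) = (a \<cdot>\<^bsub>A\<^esub> c) \<otimes> (b \<cdot>\<^bsub>B\<^esub> d)"
proof -
  interpret A: complex_algebra A by fact
  interpret B: complex_algebra B by fact
  show ?thesis by (simp add: tensor_alg_def tmap_def linearity tlift)
qed

section \<open>Sweedler calculus\<close>

context hopf_algebra
begin

lemma clinear_comult [linearity]: "clinear f \<Longrightarrow> clinear (\<lambda>x. \<Delta> (f x))"
  using comult_hom by (auto simp: alg_hom_def intro: clinear_comp)

lemma clinear_counit [linearity]: "clinear f \<Longrightarrow> clinear (\<lambda>x. \<epsilon> (f x))"
  using counit_hom by (auto simp: alg_hom_def intro: clinear_comp)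

lemma clinear_antipode [linearity]: "clinear f \<Longrightarrow> clinear (\<lambda>x. T (f x))"
  using antipode_linear by (rule clinear_comp)

lemma counit_mult [sweedler]: "\<epsilon> (x \<cdot>\<^bsub>Q\<^esub> y) = \<epsilon> x * \<epsilon> y"
  using counit_hom by (simp add: alg_hom_def complex_numbers_def)

lemma counit_one [sweedler]: "\<epsilon> \<one>\<^bsub>Q\<^esub> = 1"
  using counit_hom by (simp add: alg_hom_def complex_numbers_def)

lemmas antipode_scale [sweedler] = clinear_scale[OF antipode_linear]

text \<open>
  This is the expression \<open>f q\<^sub>1 q\<^sub>2\<close> of Sweedler notation, for bilinear \<open>f\<close>.
\<close>

definition sw :: "'q \<Rightarrow> ('q \<Rightarrow> 'q \<Rightarrow> 'v::complex_vector) \<Rightarrow> 'v"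
  where "sw q f = tlift f (\<Delta> q)"

lemma sw_cong: "(\<And>x y. f x y = g x y) \<Longrightarrow> sw q f = sw q g"
  by presburger

lemma clinear_sw [linearity]:
  "cbilinear f \<Longrightarrow> clinear g \<Longrightarrow> clinear (\<lambda>x. sw (g x) f)"
  unfolding sw_def by (intro clinear_tlift clinear_comult)

lemma clinear_sw_param [linearity]:
  "(\<And>x. cbilinear (f x)) \<Longrightarrow> (\<And>a b. clinear (\<lambda>x. f x a b)) \<Longrightarrow> clinear (\<lambda>x. sw q (f x))"
  unfolding sw_def by (intro clinear_tlift_param)

lemma sw_linear: "clinear g \<Longrightarrow> cbilinear f \<Longrightarrow> g (sw q f) = sw q (\<lambda>x y. g (f x y))"
  unfolding sw_def by (rule linear_tlift)

lemma sw_out_pure [sweedler]: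
  "cbilinear f \<Longrightarrow> sw q f \<otimes> z = sw q (\<lambda>x y. f x y \<otimes> z)"
  "cbilinear f \<Longrightarrow> w \<otimes> sw q f = sw q (\<lambda>x y. w \<otimes> f x y)"
  using sw_linear[of "\<lambda>x. x \<otimes> z" f] sw_linear[of "\<lambda>x. w \<otimes> x" f]
  by (simp_all add: linearity)

lemma sw_scale [sweedler]: "cbilinear f \<Longrightarrow> sw q (\<lambda>x y. c *\<^sub>C f x y) = c *\<^sub>C sw q f"
  using sw_linear[of "\<lambda>x. c *\<^sub>C x" f] by (simp add: linearity)

lemma sw_out_mult [sweedler]:
  "cbilinear f \<Longrightarrow> sw q f \<cdot>\<^bsub>Q\<^esub> z = sw q (\<lambda>x y. f x y \<cdot>\<^bsub>Q\<^esub> z)"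
  "cbilinear f \<Longrightarrow> z \<cdot>\<^bsub>Q\<^esub> sw q f = sw q (\<lambda>x y. z \<cdot>\<^bsub>Q\<^esub> f x y)"
  using sw_linear[of "\<lambda>x. x \<cdot>\<^bsub>Q\<^esub> z" f] sw_linear[of "\<lambda>x. z \<cdot>\<^bsub>Q\<^esub> x" f]
  by (simp_all add: linearity)

lemma comult_eq_sw: "\<Delta> q = sw q (\<otimes>)"
  unfolding sw_def
  by (rule tensor_eq[of "\<lambda>t. t" "tlift (\<otimes>)"]) (simp_all add: linearity tlift)

lemma sw_counit_left [sweedler]: "clinear f \<Longrightarrow> sw q (\<lambda>x y. \<epsilon> x *\<^sub>C f y) = f q"
  using sw_linear[of f "\<lambda>x y. \<epsilon> x *\<^sub>C y" q] counit_left[of q]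
  by (simp add: sw_def linearity clinear_scale)

lemma sw_counit_right [sweedler]: "clinear f \<Longrightarrow> sw q (\<lambda>x y. \<epsilon> y *\<^sub>C f x) = f q"
  using sw_linear[of f "\<lambda>x y. \<epsilon> y *\<^sub>C x" q] counit_right[of q]
  by (simp add: sw_def linearity clinear_scale)

lemma sw_one [sweedler]: "cbilinear f \<Longrightarrow> sw \<one>\<^bsub>Q\<^esub> f = f \<one>\<^bsub>Q\<^esub> \<one>\<^bsub>Q\<^esub>"
  using comult_hom by (simp add: sw_def alg_hom_def tensor_alg_def tlift)

lemma sw_swap:
  assumes "\<And>a b. cbilinear (\<lambda>c d. f a b c d)" and "\<And>c d. cbilinear (\<lambda>a b. f a b c d)"
  shows "sw p (\<lambda>a b. sw q (\<lambda>c d. f a b c d)) = sw q (\<lambda>c d. sw p (\<lambda>a b. f a b c d))"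
  unfolding sw_def by (rule tlift_swap[OF assms])

text \<open>
  Coassociativity, oriented towards the right-nested form.
\<close>

lemma sw_assoc [sweedler]:
  assumes [linearity]: "\<And>y z. clinear (\<lambda>x. f x y z)" "\<And>x z. clinear (\<lambda>y. f x y z)"
    "\<And>x y. clinear (\<lambda>z. f x y z)"
  shows "sw q (\<lambda>x z. sw x (\<lambda>x y. f x y z)) = sw q (\<lambda>x y. sw y (\<lambda>y z. f x y z))"
proof -
  have "tlift3 f (tassoc (tmap \<Delta> id t)) = tlift (\<lambda>x z. sw x (\<lambda>x y. f x y z)) t" for t
  proof (rule tensor_eq[where x=t])
    fix x z
    have "tlift3 f (tassoc (u \<otimes> z)) = tlift (\<lambda>x y. f x y z) u" for u
      by (rule tensor_eq[where x=u]) (simp_all add: linearity tlift tlift3_def)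
    then show "tlift3 f (tassoc (tmap \<Delta> id (x \<otimes> z))) = tlift (\<lambda>x z. sw x (\<lambda>x y. f x y z)) (x \<otimes> z)"
      by (simp add: linearity tlift sw_def)
  qed (simp_all add: linearity tlift3_def sw_def)
  moreover have "tlift3 f (tmap id \<Delta> t) = tlift (\<lambda>x y. sw y (\<lambda>y z. f x y z)) t" for t
    by (rule tensor_eq[where x=t]) (simp_all add: linearity tlift tlift3_def sw_def)
  ultimately show ?thesis using coassoc[of q] by (metis sw_def)
qed

lemma comult3_eq_sw:
  assumes [linearity]: "\<And>y z. clinear (\<lambda>x. f x y z)" "\<And>x z. clinear (\<lambda>y. f x y z)"
    "\<And>x y. clinear (\<lambda>z. f x y z)"
  shows "tlift3 f (comult3 \<Delta> q) = sw q (\<lambda>x y. sw y (\<lambda>y z. f x y z))"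
proof -
  have "tlift3 f (tmap id \<Delta> t) = tlift (\<lambda>x y. sw y (\<lambda>y z. f x y z)) t" for t
    by (rule tensor_eq[where x=t]) (simp_all add: linearity tlift tlift3_def sw_def)
  then show ?thesis by (simp add: comult3_def sw_def)
qed

lemma sw_mult [sweedler]:
  assumes [linearity]: "\<And>y. clinear (\<lambda>x. f x y)" "\<And>x. clinear (f x)"
  shows "sw (p \<cdot>\<^bsub>Q\<^esub> q) f = sw p (\<lambda>p\<^sub>1 p\<^sub>2. sw q (\<lambda>q\<^sub>1 q\<^sub>2. f (p\<^sub>1 \<cdot>\<^bsub>Q\<^esub> q\<^sub>1) (p\<^sub>2 \<cdot>\<^bsub>Q\<^esub> q\<^sub>2)))"
proof -
  have "tlift f (tlift (\<lambda>a b. tmap (\<lambda>a'. a \<cdot>\<^bsub>Q\<^esub> a') (\<lambda>b'. b \<cdot>\<^bsub>Q\<^esub> b') v) u) =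
    tlift (\<lambda>a b. tlift (\<lambda>c d. f (a \<cdot>\<^bsub>Q\<^esub> c) (b \<cdot>\<^bsub>Q\<^esub> d)) v) u" for u v
  proof (rule tensor_eq[where x=u])
    fix a b
    have "tlift f (tmap (\<lambda>a'. a \<cdot>\<^bsub>Q\<^esub> a') (\<lambda>b'. b \<cdot>\<^bsub>Q\<^esub> b') v) = tlift (\<lambda>c d. f (a \<cdot>\<^bsub>Q\<^esub> c) (b \<cdot>\<^bsub>Q\<^esub> d)) v"
      by (rule tensor_eq[where x=v]) (simp_all add: linearity clinear_comp[OF assms(1)] clinear_comp[OF assms(2)] tlift)
    then show "tlift f (tlift (\<lambda>a b. tmap (\<lambda>a'. a \<cdot>\<^bsub>Q\<^esub> a') (\<lambda>b'. b \<cdot>\<^bsub>Q\<^esub> b') v) (a \<otimes> b)) =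
      tlift (\<lambda>a b. tlift (\<lambda>c d. f (a \<cdot>\<^bsub>Q\<^esub> c) (b \<cdot>\<^bsub>Q\<^esub> d)) v) (a \<otimes> b)"
      by (simp add: linearity clinear_comp[OF assms(1)] clinear_comp[OF assms(2)] tlift tmap_def)
  qed (simp_all add: linearity clinear_comp[OF assms(1)] clinear_comp[OF assms(2)] tmap_def)
  then show ?thesis
    using comult_hom by (simp add: sw_def alg_hom_def tensor_alg_def)
qed

text \<open>
  Coassociativity when the first factor of a threefold coproduct is split below the binder of the
  other two: the two inner coproducts are exchanged first.
\<close>

lemma sw_assoc_under [sweedler]:
  assumes [linearity]: "\<And>b c d. clinear (\<lambda>a. f a b c d)" "\<And>a c d. clinear (\<lambda>b. f a b c d)"
    "\<And>a b d. clinear (\<lambda>c. f a b c d)" "\<And>a b c. clinear (\<lambda>d. f a b c d)"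
  shows "sw q (\<lambda>x r. sw r (\<lambda>c d. sw x (\<lambda>a b. f a b c d))) =
    sw q (\<lambda>a s. sw s (\<lambda>b r. sw r (\<lambda>c d. f a b c d)))"
proof -
  have "sw q (\<lambda>x r. sw r (\<lambda>c d. sw x (\<lambda>a b. f a b c d))) =
    sw q (\<lambda>x r. sw x (\<lambda>a b. sw r (\<lambda>c d. f a b c d)))"
    by (rule sw_cong, rule sw_swap) (simp_all add: linearity)
  then show ?thesis by (simp add: linearity sw_assoc)
qed

lemma sw3_swap:
  assumes [linearity]: "\<And>b c d e. clinear (\<lambda>a. f a b c d e)" "\<And>a c d e. clinear (\<lambda>b. f a b c d e)"
    "\<And>a b d e. clinear (\<lambda>c. f a b c d e)" "\<And>a b c e. clinear (\<lambda>d. f a b c d e)"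
    "\<And>a b c d. clinear (\<lambda>e. f a b c d e)"
  shows "sw p (\<lambda>a r. sw r (\<lambda>b c. sw q (\<lambda>d e. f a b c d e))) =
    sw q (\<lambda>d e. sw p (\<lambda>a r. sw r (\<lambda>b c. f a b c d e)))"
proof -
  have "sw p (\<lambda>a r. sw r (\<lambda>b c. sw q (\<lambda>d e. f a b c d e))) =
    sw p (\<lambda>a r. sw q (\<lambda>d e. sw r (\<lambda>b c. f a b c d e)))"
    by (rule sw_cong, rule sw_swap) (simp_all add: linearity)
  also have "\<dots> = sw q (\<lambda>d e. sw p (\<lambda>a r. sw r (\<lambda>b c. f a b c d e)))"
    by (rule sw_swap) (simp_all add: linearity)
  finally show ?thesis .
qed

text \<open>
  The threefold coproduct of a product, arranged such that the factors of \<open>p\<close> are bound outside those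
  of \<open>q\<close>.  Applying the twofold rule twice would interleave them, and coassociativity in \<open>p\<close>
  could no longer be applied as a rewrite rule.
\<close>

lemma sw3_mult:
  assumes [linearity]: "\<And>y z. clinear (\<lambda>x. f x y z)" "\<And>x z. clinear (\<lambda>y. f x y z)"
    "\<And>x y. clinear (\<lambda>z. f x y z)"
  shows "sw (p \<cdot>\<^bsub>Q\<^esub> q) (\<lambda>x r. sw r (\<lambda>y z. f x y z)) =
    sw p (\<lambda>p\<^sub>1 p'. sw p' (\<lambda>p\<^sub>2 p\<^sub>3. sw q (\<lambda>q\<^sub>1 q'. sw q' (\<lambda>q\<^sub>2 q\<^sub>3.
      f (p\<^sub>1 \<cdot>\<^bsub>Q\<^esub> q\<^sub>1) (p\<^sub>2 \<cdot>\<^bsub>Q\<^esub> q\<^sub>2) (p\<^sub>3 \<cdot>\<^bsub>Q\<^esub> q\<^sub>3)))))"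
proof -
  note [linearity] = clinear_comp[OF assms(1)] clinear_comp[OF assms(2)] clinear_comp[OF assms(3)]
  have "sw (p \<cdot>\<^bsub>Q\<^esub> q) (\<lambda>x r. sw r (\<lambda>y z. f x y z)) =
    sw p (\<lambda>p\<^sub>1 p'. sw q (\<lambda>q\<^sub>1 q'. sw p' (\<lambda>p\<^sub>2 p\<^sub>3. sw q' (\<lambda>q\<^sub>2 q\<^sub>3.
      f (p\<^sub>1 \<cdot>\<^bsub>Q\<^esub> q\<^sub>1) (p\<^sub>2 \<cdot>\<^bsub>Q\<^esub> q\<^sub>2) (p\<^sub>3 \<cdot>\<^bsub>Q\<^esub> q\<^sub>3)))))"
    by (simp add: linearity sw_mult)
  also have "\<dots> = sw p (\<lambda>p\<^sub>1 p'. sw p' (\<lambda>p\<^sub>2 p\<^sub>3. sw q (\<lambda>q\<^sub>1 q'. sw q' (\<lambda>q\<^sub>2 q\<^sub>3.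
      f (p\<^sub>1 \<cdot>\<^bsub>Q\<^esub> q\<^sub>1) (p\<^sub>2 \<cdot>\<^bsub>Q\<^esub> q\<^sub>2) (p\<^sub>3 \<cdot>\<^bsub>Q\<^esub> q\<^sub>3)))))"
    by (rule sw_cong, rule sw_swap) (simp_all add: linearity)
  finally show ?thesis .
qed

lemma sw_in_subspace:
  assumes "complex_vector.subspace N" and "cbilinear f" and "\<And>x y. f x y \<in> N"
  shows "sw q f \<in> N"
proof -
  have "tlift f t \<in> N" for t
    by (induction t rule: tensor_induct)
      (simp_all add: tlift[OF assms(2)] assms(3) clinear_add[OF tlift(1)[OF assms(2)]]
        complex_vector.subspace_add[OF assms(1)])
  then show ?thesis by (simp add: sw_def)
qed

lemma sw_diff:
  assumes "cbilinear f" and "cbilinear g"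
  shows "sw q (\<lambda>x y. f x y - g x y) = sw q f - sw q g"
  unfolding sw_def
  by (rule tensor_eq[where x="\<Delta> q"]) (use assms in \<open>simp_all add: linearity tlift\<close>)

lemma sw_out_tlift [sweedler]:
  "cbilinear g \<Longrightarrow> cbilinear f \<Longrightarrow> tlift g (sw q f) = sw q (\<lambda>x y. tlift g (f x y))"
  by (rule sw_linear) (simp_all add: tlift(1))

end


section \<open>The antipode of a Hopf algebra\<close>

context hopf_algebra
begin

text \<open>
  A bilinear expression \<open>e\<close> with \<open>e q\<^sub>1 q\<^sub>2 = \<epsilon> q\<close> can be cancelled inside any longer linear
  expression.
\<close>

lemma cancel_last:
  assumes "cbilinear e" and "\<And>q. sw q e = \<epsilon> q *\<^sub>C \<one>\<^bsub>Q\<^esub>" and "clinear g"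
  shows "sw q (\<lambda>x y. g (e x y)) = \<epsilon> q *\<^sub>C g \<one>\<^bsub>Q\<^esub>"
  using sw_linear[OF assms(3,1), of q] by (simp add: assms(2) clinear_scale[OF assms(3)])

lemma cancel_first:
  assumes e: "cbilinear e" and "\<And>q. sw q e = \<epsilon> q *\<^sub>C \<one>\<^bsub>Q\<^esub>"
    and g: "\<And>y. clinear (\<lambda>x. g x y)" "\<And>x. clinear (g x)"
  shows "sw q (\<lambda>x r. sw r (\<lambda>y z. g (e x y) z)) = g \<one>\<^bsub>Q\<^esub> q"
proof -
  have "sw q (\<lambda>x r. sw r (\<lambda>y z. g (e x y) z)) = sw q (\<lambda>s z. sw s (\<lambda>x y. g (e x y) z))"
    by (rule sw_assoc[symmetric])
      (intro clinear_comp[OF g(1)] cbilinearD[OF e] g(2))+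
  also have "\<dots> = g \<one>\<^bsub>Q\<^esub> q"
    by (simp add: cancel_last[OF assms(1,2) g(1)] g(2) sweedler)
  finally show ?thesis .
qed

lemma sw_antipode_left: "sw q (\<lambda>x y. T x \<cdot>\<^bsub>Q\<^esub> y) = \<epsilon> q *\<^sub>C \<one>\<^bsub>Q\<^esub>"
  and sw_antipode_right: "sw q (\<lambda>x y. x \<cdot>\<^bsub>Q\<^esub> T y) = \<epsilon> q *\<^sub>C \<one>\<^bsub>Q\<^esub>"
  using antipode_left antipode_right by (simp_all add: sw_def)

lemmas cancel_antipode_left = cancel_last[OF _ sw_antipode_left] cancel_first[OF _ sw_antipode_left]
lemmas cancel_antipode_right = cancel_last[OF _ sw_antipode_right] cancel_first[OF _ sw_antipode_right]

lemma antipode_one [sweedler]: "T \<one>\<^bsub>Q\<^esub> = \<one>\<^bsub>Q\<^esub>"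
  using sw_antipode_left[of "\<one>\<^bsub>Q\<^esub>"]
  by (simp add: linearity sweedler)

lemma counit_antipode [sweedler]: "\<epsilon> (T q) = \<epsilon> q"
proof -
  have "\<epsilon> (T q) = sw q (\<lambda>x y. \<epsilon> (T x \<cdot>\<^bsub>Q\<^esub> y))"
    using sw_counit_right[of "\<lambda>x. \<epsilon> (T x)" q] by (simp add: linearity sweedler scaleC_complex_def mult.commute)
  also have "\<dots> = \<epsilon> q"
    by (subst cancel_antipode_left(1)) (simp_all add: linearity sweedler scaleC_complex_def)
  finally show ?thesis .
qed

text \<open>
  In the convolution algebra of maps on \<open>Q \<otimes> Q\<close>, the left-hand side is a left inverse of the
  multiplication \<open>Q \<otimes> Q \<rightarrow> Q\<close> and the right-hand side is a right inverse, so that they coincide.  The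
  proof evaluates \<open>T (p\<^sub>1 \<cdot> q\<^sub>1) \<cdot> p\<^sub>2 \<cdot> q\<^sub>2 \<cdot> T q\<^sub>3 \<cdot> T p\<^sub>3\<close> in two ways.
\<close>

lemma antipode_mult [sweedler]: "T (p \<cdot>\<^bsub>Q\<^esub> q) = T q \<cdot>\<^bsub>Q\<^esub> T p"
proof -
  let ?F = "\<lambda>p\<^sub>1 p\<^sub>2 p\<^sub>3 q\<^sub>1 q\<^sub>2 q\<^sub>3. T (p\<^sub>1 \<cdot>\<^bsub>Q\<^esub> q\<^sub>1) \<cdot>\<^bsub>Q\<^esub> (p\<^sub>2 \<cdot>\<^bsub>Q\<^esub> (q\<^sub>2 \<cdot>\<^bsub>Q\<^esub> (T q\<^sub>3 \<cdot>\<^bsub>Q\<^esub> T p\<^sub>3)))"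
  have "T q \<cdot>\<^bsub>Q\<^esub> T p = sw p (\<lambda>s p\<^sub>3. sw q (\<lambda>t q\<^sub>3. sw (s \<cdot>\<^bsub>Q\<^esub> t) (\<lambda>x y. (T x \<cdot>\<^bsub>Q\<^esub> y) \<cdot>\<^bsub>Q\<^esub> (T q\<^sub>3 \<cdot>\<^bsub>Q\<^esub> T p\<^sub>3))))"
    by (simp add: linearity cancel_antipode_left(1)[of "\<lambda>x. x \<cdot>\<^bsub>Q\<^esub> (T v \<cdot>\<^bsub>Q\<^esub> T u)" for u v])
      (simp add: linearity sweedler)
  also have "\<dots> = sw p (\<lambda>s p\<^sub>3. sw q (\<lambda>t q\<^sub>3. sw s (\<lambda>p\<^sub>1 p\<^sub>2. sw t (\<lambda>q\<^sub>1 q\<^sub>2. ?F p\<^sub>1 p\<^sub>2 p\<^sub>3 q\<^sub>1 q\<^sub>2 q\<^sub>3))))"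
    by (simp add: linearity sw_mult assoc)
  also have "\<dots> = sw p (\<lambda>s p\<^sub>3. sw s (\<lambda>p\<^sub>1 p\<^sub>2. sw q (\<lambda>t q\<^sub>3. sw t (\<lambda>q\<^sub>1 q\<^sub>2. ?F p\<^sub>1 p\<^sub>2 p\<^sub>3 q\<^sub>1 q\<^sub>2 q\<^sub>3))))"
    by (rule sw_cong, rule sw_swap) (simp_all add: linearity)
  also have "\<dots> = sw p (\<lambda>p\<^sub>1 p'. sw p' (\<lambda>p\<^sub>2 p\<^sub>3. sw q (\<lambda>q\<^sub>1 q'. sw q' (\<lambda>q\<^sub>2 q\<^sub>3. ?F p\<^sub>1 p\<^sub>2 p\<^sub>3 q\<^sub>1 q\<^sub>2 q\<^sub>3))))"
    by (simp add: linearity sw_assoc)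
  also have "\<dots> = sw p (\<lambda>p\<^sub>1 p'. sw p' (\<lambda>p\<^sub>2 p\<^sub>3. sw q (\<lambda>q\<^sub>1 q'. T (p\<^sub>1 \<cdot>\<^bsub>Q\<^esub> q\<^sub>1) \<cdot>\<^bsub>Q\<^esub> (p\<^sub>2 \<cdot>\<^bsub>Q\<^esub> (sw q' (\<lambda>q\<^sub>2 q\<^sub>3. q\<^sub>2 \<cdot>\<^bsub>Q\<^esub> T q\<^sub>3) \<cdot>\<^bsub>Q\<^esub> T p\<^sub>3)))))"
    by (simp add: linearity sweedler)
  also have "\<dots> = sw p (\<lambda>p\<^sub>1 p'. sw p' (\<lambda>p\<^sub>2 p\<^sub>3. T (p\<^sub>1 \<cdot>\<^bsub>Q\<^esub> q) \<cdot>\<^bsub>Q\<^esub> (p\<^sub>2 \<cdot>\<^bsub>Q\<^esub> T p\<^sub>3)))"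
    by (simp add: linearity sweedler sw_antipode_right)
  also have "\<dots> = T (p \<cdot>\<^bsub>Q\<^esub> q)"
    by (simp add: linearity sweedler cancel_antipode_right(1)[of "\<lambda>x. z \<cdot>\<^bsub>Q\<^esub> x" for z])
  finally show ?thesis ..
qed

text \<open>
  Both sides are convolution inverses of \<open>\<Delta>\<close> among the maps \<open>Q \<rightarrow> Q \<otimes> Q\<close>, on the left and on the
  right respectively.
\<close>

lemma comult_antipode: "\<Delta> (T q) = sw q (\<lambda>x y. T y \<otimes> T x)"
proof -
  interpret QQ: complex_algebra "tensor_alg Q Q"
    by (intro complex_algebra_tensor_alg complex_algebra_axioms)
  let ?m = "amult (tensor_alg Q Q)"
  have pure: "?m (a \<otimes> b) (c \<otimes> d) = (a \<cdot>\<^bsub>Q\<^esub> c) \<otimes> (b \<cdot>\<^bsub>Q\<^esub> d)" for a b c d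
    by (simp add: complex_algebra_axioms)
  have one: "\<one>\<^bsub>tensor_alg Q Q\<^esub> = \<one>\<^bsub>Q\<^esub> \<otimes> \<one>\<^bsub>Q\<^esub>" by (simp add: tensor_alg_def)
  have hom: "\<Delta> (x \<cdot>\<^bsub>Q\<^esub> y) = ?m (\<Delta> x) (\<Delta> y)" "\<Delta> \<one>\<^bsub>Q\<^esub> = \<one>\<^bsub>tensor_alg Q Q\<^esub>" for x y
    using comult_hom by (simp_all add: alg_hom_def)
  have out: "?m (sw q f) z = sw q (\<lambda>x y. ?m (f x y) z)" "?m z (sw q f) = sw q (\<lambda>x y. ?m z (f x y))"
    if "cbilinear f" for q f z
    using sw_linear[OF _ that, of "\<lambda>x. ?m x z"] sw_linear[OF _ that, of "\<lambda>x. ?m z x"]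
    by (simp_all add: linearity)
  let ?k = "\<lambda>q. sw q (\<lambda>x y. T y \<otimes> T x)"
  have k: "clinear ?k" by (simp add: linearity)
  note lin = linearity clinear_comp[OF k]
  have inverse: "sw r (\<lambda>x y. ?m (\<Delta> x) (?k y)) = \<epsilon> r *\<^sub>C \<one>\<^bsub>tensor_alg Q Q\<^esub>" for r
  proof -
    have "?m (\<Delta> s) (?k v) = sw s (\<lambda>a b. ?m (a \<otimes> b) (?k v))" for s v
      by (simp add: comult_eq_sw[of s] out(1) lin)
    then have "sw r (\<lambda>x y. ?m (\<Delta> x) (?k y)) = sw r (\<lambda>a u. sw u (\<lambda>b v. sw v (\<lambda>x y. (a \<cdot>\<^bsub>Q\<^esub> T y) \<otimes> (b \<cdot>\<^bsub>Q\<^esub> T x))))"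
      by (simp add: out(2) lin pure sw_assoc)
    also have "\<dots> = sw r (\<lambda>a u. (a \<cdot>\<^bsub>Q\<^esub> T u) \<otimes> \<one>\<^bsub>Q\<^esub>)"
      by (intro sw_cong cancel_antipode_right(2)) (simp_all add: linearity)
    also have "\<dots> = \<epsilon> r *\<^sub>C \<one>\<^bsub>tensor_alg Q Q\<^esub>"
      unfolding one by (rule cancel_antipode_right(1)) (simp_all add: linearity)
    finally show ?thesis .
  qed
  have "?k q = sw q (\<lambda>s z. sw s (\<lambda>x y. ?m (\<Delta> (T x \<cdot>\<^bsub>Q\<^esub> y)) (?k z)))"
    by (subst cancel_antipode_left(1)[of "\<lambda>x. ?m (\<Delta> x) w" for w])
      (simp_all add: lin hom sweedler QQ.unit_left)
  also have "\<dots> = sw q (\<lambda>x r. ?m (\<Delta> (T x)) (sw r (\<lambda>y z. ?m (\<Delta> y) (?k z))))"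
    by (simp add: lin hom sw_assoc QQ.assoc out)
  also have "\<dots> = \<Delta> (T q)"
    by (simp add: inverse lin sweedler QQ.mult_scale QQ.unit_right)
  finally show ?thesis ..
qed

lemma sw_antipode [sweedler]:
  assumes "\<And>y. clinear (\<lambda>x. f x y)" "\<And>x. clinear (f x)"
  shows "sw (T q) f = sw q (\<lambda>x y. f (T y) (T x))"
proof -
  have f: "cbilinear f" using assms by (intro cbilinearI)
  have "sw (T q) f = tlift f (sw q (\<lambda>x y. T y \<otimes> T x))"
    using comult_antipode by (simp add: sw_def)
  also have "\<dots> = sw q (\<lambda>x y. f (T y) (T x))"
    using sw_linear[OF tlift(1)[OF f], of "\<lambda>x y. T y \<otimes> T x"] f by (simp add: linearity tlift)
  finally show ?thesis .
qed

end

section \<open>Module algebras over an involutive Hopf algebra\<close>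

locale involutive_module_algebra =
  hopf_algebra Q \<Delta> \<epsilon> T + A: module_algebra Q \<Delta> \<epsilon> A act
  for Q :: "'q::complex_vector alg" and \<Delta> \<epsilon> T
    and A :: "'a::complex_vector alg" and act +
  assumes antipode_involutive [sweedler]: "T (T q) = q"
begin

lemmas clinear_act [linearity] = cbilinear_compose[OF A.act_bilinear]

lemmas act_sweedler [sweedler] =
  cbilinear_scale[OF A.act_bilinear] A.act_mult[symmetric] A.act_unit A.act_on_unit

lemma act_on_mult_sw [sweedler]: "act q (a \<cdot>\<^bsub>A\<^esub> b) = sw q (\<lambda>x y. act x a \<cdot>\<^bsub>A\<^esub> act y b)"
  unfolding sw_def by (rule A.act_on_mult)

lemma sw_out_act [sweedler]:
  "cbilinear f \<Longrightarrow> act (sw q f) a = sw q (\<lambda>x y. act (f x y) a)"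
  "cbilinear k \<Longrightarrow> act p (sw q k) = sw q (\<lambda>x y. act p (k x y))"
  using sw_linear[of "\<lambda>x. act x a" f q] sw_linear[of "act p" k q] by (simp_all add: linearity)

lemma sw_out_mult_A [sweedler]:
  "cbilinear f \<Longrightarrow> sw q f \<cdot>\<^bsub>A\<^esub> a = sw q (\<lambda>x y. f x y \<cdot>\<^bsub>A\<^esub> a)"
  "cbilinear f \<Longrightarrow> a \<cdot>\<^bsub>A\<^esub> sw q f = sw q (\<lambda>x y. a \<cdot>\<^bsub>A\<^esub> f x y)"
  using sw_linear[of "\<lambda>x. x \<cdot>\<^bsub>A\<^esub> a" f q] sw_linear[of "\<lambda>x. a \<cdot>\<^bsub>A\<^esub> x" f q]
  by (simp_all add: linearity)

text \<open>
  The antipode axioms with the factors interchanged: their images under \<open>T\<close>, in which \<open>T (T q)\<close> has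
  become \<open>q\<close>.
\<close>

lemma sw_antipode_left_op: "sw q (\<lambda>x y. T y \<cdot>\<^bsub>Q\<^esub> x) = \<epsilon> q *\<^sub>C \<one>\<^bsub>Q\<^esub>"
  and sw_antipode_right_op: "sw q (\<lambda>x y. y \<cdot>\<^bsub>Q\<^esub> T x) = \<epsilon> q *\<^sub>C \<one>\<^bsub>Q\<^esub>"
proof -
  have "T (sw q (\<lambda>x y. T x \<cdot>\<^bsub>Q\<^esub> y)) = sw q (\<lambda>x y. T y \<cdot>\<^bsub>Q\<^esub> x)"
    by (simp add: sw_linear[OF antipode_linear] linearity sweedler)
  then show "sw q (\<lambda>x y. T y \<cdot>\<^bsub>Q\<^esub> x) = \<epsilon> q *\<^sub>C \<one>\<^bsub>Q\<^esub>"
    unfolding sw_antipode_left by (simp add: sweedler)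
  have "T (sw q (\<lambda>x y. x \<cdot>\<^bsub>Q\<^esub> T y)) = sw q (\<lambda>x y. y \<cdot>\<^bsub>Q\<^esub> T x)"
    by (simp add: sw_linear[OF antipode_linear] linearity sweedler)
  then show "sw q (\<lambda>x y. y \<cdot>\<^bsub>Q\<^esub> T x) = \<epsilon> q *\<^sub>C \<one>\<^bsub>Q\<^esub>"
    unfolding sw_antipode_right by (simp add: sweedler)
qed

lemmas cancel_antipode_left_op = cancel_last[OF _ sw_antipode_left_op] cancel_first[OF _ sw_antipode_left_op]
lemmas cancel_antipode_right_op = cancel_last[OF _ sw_antipode_right_op] cancel_first[OF _ sw_antipode_right_op]


section \<open>The algebra \<open>A \<otimes> Q \<otimes> A\<close>\<close>

abbreviation H :: "('a \<otimes> 'q \<otimes> 'a) alg" where "H \<equiv> aqa_alg Q \<Delta> A act"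
abbreviation iL :: "'a \<Rightarrow> 'a \<otimes> 'q \<otimes> 'a" where "iL \<equiv> incl_left Q A"
abbreviation iR :: "'a \<Rightarrow> 'a \<otimes> 'q \<otimes> 'a" where "iR \<equiv> incl_right Q A"
definition incl_mid :: "'q \<Rightarrow> 'a \<otimes> 'q \<otimes> 'a" where "incl_mid q = \<one>\<^bsub>A\<^esub> \<otimes> q \<otimes> \<one>\<^bsub>A\<^esub>"

lemma bilinear_H: "cbilinear (amult H)"
  unfolding cbilinear_def aqa_alg_def
  by (simp add: tlift3_def comult3_def linearity)

lemmas clinear_H [linearity] = cbilinear_compose[OF bilinear_H]

lemma sw_out_H [sweedler]:
  "cbilinear f \<Longrightarrow> sw q f \<cdot>\<^bsub>H\<^esub> a = sw q (\<lambda>x y. f x y \<cdot>\<^bsub>H\<^esub> a)"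
  "cbilinear f \<Longrightarrow> a \<cdot>\<^bsub>H\<^esub> sw q f = sw q (\<lambda>x y. a \<cdot>\<^bsub>H\<^esub> f x y)"
  using sw_linear[of "\<lambda>x. x \<cdot>\<^bsub>H\<^esub> a" f q] sw_linear[of "\<lambda>x. a \<cdot>\<^bsub>H\<^esub> x" f q]
  by (simp_all add: linearity)

lemma mult_H [sweedler]:
  "(a \<otimes> q \<otimes> b) \<cdot>\<^bsub>H\<^esub> (a' \<otimes> q' \<otimes> b') = sw q (\<lambda>q\<^sub>1 r. sw r (\<lambda>q\<^sub>2 q\<^sub>3.
    (a \<cdot>\<^bsub>A\<^esub> act q\<^sub>1 a') \<otimes> (q\<^sub>2 \<cdot>\<^bsub>Q\<^esub> q') \<otimes> (act q\<^sub>3 b' \<cdot>\<^bsub>A\<^esub> b)))"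
proof -
  let ?f = "\<lambda>a q b a' q' b' q1 q2 q3. (a \<cdot>\<^bsub>A\<^esub> act q1 a') \<otimes> (q2 \<cdot>\<^bsub>Q\<^esub> q') \<otimes> (act q3 b' \<cdot>\<^bsub>A\<^esub> b)"
  have "(a \<otimes> q \<otimes> b) \<cdot>\<^bsub>H\<^esub> (a' \<otimes> q' \<otimes> b') = tlift3 (?f a q b a' q' b') (comult3 \<Delta> q)"
    unfolding aqa_alg_def
    by (simp add: tlift3_def comult3_def linearity tlift)
  also have "\<dots> = sw q (\<lambda>q\<^sub>1 r. sw r (\<lambda>q\<^sub>2 q\<^sub>3. ?f a q b a' q' b' q\<^sub>1 q\<^sub>2 q\<^sub>3))"
    by (rule comult3_eq_sw) (simp_all add: linearity)
  finally show ?thesis .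
qed

lemma unit_H [sweedler]: "\<one>\<^bsub>H\<^esub> = \<one>\<^bsub>A\<^esub> \<otimes> \<one>\<^bsub>Q\<^esub> \<otimes> \<one>\<^bsub>A\<^esub>"
  by (simp add: aqa_alg_def)

lemma clinear_incl [linearity]:
  "clinear f \<Longrightarrow> clinear (\<lambda>x. iL (f x))" "clinear f \<Longrightarrow> clinear (\<lambda>x. iR (f x))"
  by (simp_all add: incl_left_def incl_right_def linearity)

lemma mult_incl_left [sweedler]:
  "iL a \<cdot>\<^bsub>H\<^esub> (x \<otimes> q \<otimes> y) = (a \<cdot>\<^bsub>A\<^esub> x) \<otimes> q \<otimes> y"
  "(x \<otimes> q \<otimes> y) \<cdot>\<^bsub>H\<^esub> iL a = sw q (\<lambda>q\<^sub>1 q\<^sub>2. (x \<cdot>\<^bsub>A\<^esub> act q\<^sub>1 a) \<otimes> q\<^sub>2 \<otimes> y)"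
  by (simp_all add: incl_left_def linearity sweedler)

lemma mult_incl_right [sweedler]:
  "iR b \<cdot>\<^bsub>H\<^esub> (x \<otimes> q \<otimes> y) = x \<otimes> q \<otimes> (y \<cdot>\<^bsub>A\<^esub> b)"
  "(x \<otimes> q \<otimes> y) \<cdot>\<^bsub>H\<^esub> iR b = sw q (\<lambda>q\<^sub>1 q\<^sub>2. x \<otimes> q\<^sub>1 \<otimes> (act q\<^sub>2 b \<cdot>\<^bsub>A\<^esub> y))"
  by (simp_all add: incl_right_def linearity sweedler)

lemma mult_incl_mid [sweedler]:
  "(x \<otimes> q \<otimes> y) \<cdot>\<^bsub>H\<^esub> incl_mid p = x \<otimes> (q \<cdot>\<^bsub>Q\<^esub> p) \<otimes> y"
  by (simp_all add: incl_mid_def linearity sweedler)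

lemma pure_eq_product: "x \<otimes> q \<otimes> y = iL x \<cdot>\<^bsub>H\<^esub> (iR y \<cdot>\<^bsub>H\<^esub> incl_mid q)"
  unfolding incl_mid_def by (simp add: linearity sweedler)

text \<open>
  \<open>H\<close> is generated by the two copies of \<open>A\<close> and by the copy of \<open>Q\<close>.
\<close>

lemma H_induct [case_names incl_left incl_right incl_mid mult add]:
  assumes "\<And>a. P (iL a)" "\<And>b. P (iR b)" "\<And>q. P (incl_mid q)"
    and mult: "\<And>h k. P h \<Longrightarrow> P k \<Longrightarrow> P (h \<cdot>\<^bsub>H\<^esub> k)"
    and add: "\<And>h k. P h \<Longrightarrow> P k \<Longrightarrow> P (h + k)"
  shows "P h"
proof (induction h rule: tensor_induct)
  case (pure a t)
  show ?case
  proof (induction t rule: tensor_induct)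
    case (pure q b)
    show ?case unfolding pure_eq_product by (intro mult assms(1-3))
  next
    case (add s t)
    then show ?case using assms(5)[of "a \<otimes> s" "a \<otimes> t"]
      by (simp add: clinear_add[of "\<lambda>t. a \<otimes> t"] linearity)
  qed
qed (rule add)

lemma assoc_incl_left: "(h \<cdot>\<^bsub>H\<^esub> iL a) \<cdot>\<^bsub>H\<^esub> k = h \<cdot>\<^bsub>H\<^esub> (iL a \<cdot>\<^bsub>H\<^esub> k)"
proof (rule tensor_eq3[where x=h])
  show "(x \<otimes> q \<otimes> y \<cdot>\<^bsub>H\<^esub> iL a) \<cdot>\<^bsub>H\<^esub> k = x \<otimes> q \<otimes> y \<cdot>\<^bsub>H\<^esub> (iL a \<cdot>\<^bsub>H\<^esub> k)" for x q y
    by (rule tensor_eq3[where x=k]) (simp_all add: linearity sweedler)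
qed (simp_all add: linearity)

lemma assoc_incl_right: "(h \<cdot>\<^bsub>H\<^esub> iR a) \<cdot>\<^bsub>H\<^esub> k = h \<cdot>\<^bsub>H\<^esub> (iR a \<cdot>\<^bsub>H\<^esub> k)"
proof (rule tensor_eq3[where x=h])
  show "(x \<otimes> q \<otimes> y \<cdot>\<^bsub>H\<^esub> iR a) \<cdot>\<^bsub>H\<^esub> k = x \<otimes> q \<otimes> y \<cdot>\<^bsub>H\<^esub> (iR a \<cdot>\<^bsub>H\<^esub> k)" for x q y
    by (rule tensor_eq3[where x=k]) (simp_all add: linearity sweedler)
qed (simp_all add: linearity)

lemma assoc_incl_mid: "(h \<cdot>\<^bsub>H\<^esub> incl_mid p) \<cdot>\<^bsub>H\<^esub> k = h \<cdot>\<^bsub>H\<^esub> (incl_mid p \<cdot>\<^bsub>H\<^esub> k)"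
proof (rule tensor_eq3[where x=h])
  fix x q y
  show "(x \<otimes> q \<otimes> y \<cdot>\<^bsub>H\<^esub> incl_mid p) \<cdot>\<^bsub>H\<^esub> k = x \<otimes> q \<otimes> y \<cdot>\<^bsub>H\<^esub> (incl_mid p \<cdot>\<^bsub>H\<^esub> k)"
  proof (rule tensor_eq3[where x=k])
    fix a r b
    show "(x \<otimes> q \<otimes> y \<cdot>\<^bsub>H\<^esub> incl_mid p) \<cdot>\<^bsub>H\<^esub> (a \<otimes> r \<otimes> b) =
      x \<otimes> q \<otimes> y \<cdot>\<^bsub>H\<^esub> (incl_mid p \<cdot>\<^bsub>H\<^esub> (a \<otimes> r \<otimes> b))"
      unfolding mult_incl_mid
      \<comment> \<open>On the right-hand side the coproduct of \<open>p\<close> is bound outside that of \<open>q\<close>, on the left-hand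
        side inside.  Moving the coproduct of \<open>q\<close> inwards brings both into the same order.\<close>
      by (simp add: incl_mid_def linearity sweedler sw3_mult sw3_swap[of _ q] del: sw_mult)
  qed (simp_all add: linearity)
qed (simp_all add: linearity)

text \<open>
  The elements that associate in the middle position are closed under products and sums, and contain
  the generators.
\<close>

lemma assoc_H: "(h \<cdot>\<^bsub>H\<^esub> g) \<cdot>\<^bsub>H\<^esub> k = h \<cdot>\<^bsub>H\<^esub> (g \<cdot>\<^bsub>H\<^esub> k)"
proof -
  have "\<forall>h k. (h \<cdot>\<^bsub>H\<^esub> g) \<cdot>\<^bsub>H\<^esub> k = h \<cdot>\<^bsub>H\<^esub> (g \<cdot>\<^bsub>H\<^esub> k)"
  proof (induction g rule: H_induct)
    case (mult g g')
    then show ?case by metis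
  next
    case (add g g')
    then show ?case
      by (simp add: clinear_add[of "\<lambda>g. amult H h g" for h] clinear_add[of "\<lambda>g. amult H g k" for k] linearity)
  qed (simp_all add: assoc_incl_left assoc_incl_right assoc_incl_mid)
  then show ?thesis by blast
qed

lemma algebra_H: "complex_algebra H"
proof
  show "\<one>\<^bsub>H\<^esub> \<cdot>\<^bsub>H\<^esub> h = h" "h \<cdot>\<^bsub>H\<^esub> \<one>\<^bsub>H\<^esub> = h" for h
    by (rule tensor_eq3[where x=h]; simp add: linearity sweedler)+
qed (rule bilinear_H assoc_H)+

sublocale H: complex_algebra H by (rule algebra_H)

lemma alg_hom_incl_left: "alg_hom A H iL"
  unfolding alg_hom_def
  by (simp add: clinear_incl[OF clinear_ident] incl_left_def linearity sweedler)

lemma alg_hom_incl_right: "alg_hom (opposite A) H iR"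
  unfolding alg_hom_def
  by (simp add: clinear_incl[OF clinear_ident] incl_right_def opposite_def linearity sweedler)

lemma incl_commute: "iL a \<cdot>\<^bsub>H\<^esub> iR b = iR b \<cdot>\<^bsub>H\<^esub> iL a"
  by (simp add: incl_left_def incl_right_def linearity sweedler)

lemma incl_left_mult: "iL (a \<cdot>\<^bsub>A\<^esub> b) = iL a \<cdot>\<^bsub>H\<^esub> iL b"
  using alg_hom_incl_left by (simp add: alg_hom_def)

lemma incl_right_mult: "iR (a \<cdot>\<^bsub>A\<^esub> b) = iR b \<cdot>\<^bsub>H\<^esub> iR a"
  using alg_hom_incl_right by (simp add: alg_hom_def opposite_def)


section \<open>The common lift of the comultiplications\<close>

text \<open>
  The common lift of both comultiplications to \<open>H \<otimes> H\<close> over the complex numbers.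
\<close>

definition split_comult :: "'a \<otimes> 'q \<otimes> 'a \<Rightarrow> ('a \<otimes> 'q \<otimes> 'a) \<otimes> ('a \<otimes> 'q \<otimes> 'a)"
  where "split_comult = tlift3 (\<lambda>a q b. sw q (\<lambda>x y. (a \<otimes> x \<otimes> \<one>\<^bsub>A\<^esub>) \<otimes> (\<one>\<^bsub>A\<^esub> \<otimes> y \<otimes> b)))"

abbreviation HH where "HH \<equiv> tensor_alg H H"

sublocale HH: complex_algebra HH
  by (intro complex_algebra_tensor_alg algebra_H)

lemma mult_HH [sweedler]: "(a \<otimes> b) \<cdot>\<^bsub>HH\<^esub> (c \<otimes> d) = (a \<cdot>\<^bsub>H\<^esub> c) \<otimes> (b \<cdot>\<^bsub>H\<^esub> d)"
  by (simp add: algebra_H)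

lemma sw_out_HH [sweedler]:
  "cbilinear f \<Longrightarrow> sw q f \<cdot>\<^bsub>HH\<^esub> a = sw q (\<lambda>x y. f x y \<cdot>\<^bsub>HH\<^esub> a)"
  "cbilinear f \<Longrightarrow> a \<cdot>\<^bsub>HH\<^esub> sw q f = sw q (\<lambda>x y. a \<cdot>\<^bsub>HH\<^esub> f x y)"
  using sw_linear[of "\<lambda>x. x \<cdot>\<^bsub>HH\<^esub> a" f q] sw_linear[of "\<lambda>x. a \<cdot>\<^bsub>HH\<^esub> x" f q]
  by (simp_all add: linearity)

lemma clinear_split_comult [linearity]: "clinear f \<Longrightarrow> clinear (\<lambda>x. split_comult (f x))"
  unfolding split_comult_def tlift3_def by (simp add: linearity)

lemma split_comult_pure [sweedler]:
  "split_comult (a \<otimes> q \<otimes> b) = sw q (\<lambda>x y. (a \<otimes> x \<otimes> \<one>\<^bsub>A\<^esub>) \<otimes> (\<one>\<^bsub>A\<^esub> \<otimes> y \<otimes> b))"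
  unfolding split_comult_def by (subst tlift3_pure) (simp_all add: linearity)

lemma sw_out_split_comult [sweedler]:
  "cbilinear f \<Longrightarrow> split_comult (sw q f) = sw q (\<lambda>x y. split_comult (f x y))"
  using sw_linear[of split_comult f q] clinear_split_comult[OF clinear_ident] by simp

lemma split_comult_incl:
  "split_comult (iL a) = iL a \<otimes> \<one>\<^bsub>H\<^esub>" "split_comult (iR b) = \<one>\<^bsub>H\<^esub> \<otimes> iR b"
  by (simp_all add: incl_left_def incl_right_def linearity sweedler)

lemma split_comult_mult_incl:
  "split_comult (h \<cdot>\<^bsub>H\<^esub> iL a) = split_comult h \<cdot>\<^bsub>HH\<^esub> split_comult (iL a)"
  "split_comult (h \<cdot>\<^bsub>H\<^esub> iR a) = split_comult h \<cdot>\<^bsub>HH\<^esub> split_comult (iR a)"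
  "split_comult (h \<cdot>\<^bsub>H\<^esub> incl_mid p) = split_comult h \<cdot>\<^bsub>HH\<^esub> split_comult (incl_mid p)"
proof -
  show "split_comult (h \<cdot>\<^bsub>H\<^esub> iL a) = split_comult h \<cdot>\<^bsub>HH\<^esub> split_comult (iL a)"
    unfolding split_comult_incl
    by (rule tensor_eq3[where x=h]) (simp_all add: linearity sweedler)
  show "split_comult (h \<cdot>\<^bsub>H\<^esub> iR a) = split_comult h \<cdot>\<^bsub>HH\<^esub> split_comult (iR a)"
    unfolding split_comult_incl
    by (rule tensor_eq3[where x=h]) (simp_all add: linearity sweedler)
  show "split_comult (h \<cdot>\<^bsub>H\<^esub> incl_mid p) = split_comult h \<cdot>\<^bsub>HH\<^esub> split_comult (incl_mid p)"
  proof (rule tensor_eq3[where x=h])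
    fix x q y
    have "split_comult (x \<otimes> q \<otimes> y) \<cdot>\<^bsub>HH\<^esub> split_comult (incl_mid p) =
      sw q (\<lambda>u v. (x \<otimes> u \<otimes> \<one>\<^bsub>A\<^esub>) \<otimes> (\<one>\<^bsub>A\<^esub> \<otimes> v \<otimes> y) \<cdot>\<^bsub>HH\<^esub> split_comult (incl_mid p))"
      by (simp add: split_comult_pure sw_out_HH(1) linearity)
    also have "\<dots> = sw q (\<lambda>u v. sw p (\<lambda>u' v'. (x \<otimes> (u \<cdot>\<^bsub>Q\<^esub> u') \<otimes> \<one>\<^bsub>A\<^esub>) \<otimes> (\<one>\<^bsub>A\<^esub> \<otimes> (v \<cdot>\<^bsub>Q\<^esub> v') \<otimes> y)))"
      by (simp add: incl_mid_def split_comult_pure sw_out_HH(2) mult_HH linearity mult_incl_mid[unfolded incl_mid_def])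
    finally show "split_comult (x \<otimes> q \<otimes> y \<cdot>\<^bsub>H\<^esub> incl_mid p) =
      split_comult (x \<otimes> q \<otimes> y) \<cdot>\<^bsub>HH\<^esub> split_comult (incl_mid p)"
      by (simp add: mult_incl_mid split_comult_pure sw_mult linearity)
  qed (simp_all add: linearity)
qed

text \<open>
  The elements \<open>k\<close> with this property for all \<open>h\<close> are closed under products, as both \<open>H\<close> and
  \<open>H \<otimes> H\<close> are associative.
\<close>

lemma split_comult_mult: "split_comult (h \<cdot>\<^bsub>H\<^esub> k) = split_comult h \<cdot>\<^bsub>HH\<^esub> split_comult k"
proof -
  have "\<forall>h. split_comult (h \<cdot>\<^bsub>H\<^esub> k) = split_comult h \<cdot>\<^bsub>HH\<^esub> split_comult k"
  proof (induction k rule: H_induct)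
    case (mult g g')
    then show ?case by (metis H.assoc HH.assoc)
  next
    case (add g g')
    then show ?case
      by (simp add: clinear_add[of "\<lambda>g. amult H h g" for h] clinear_add[of "\<lambda>g. amult HH h g" for h]
          clinear_add[of split_comult] clinear_split_comult[OF clinear_ident] linearity)
  qed (simp_all add: split_comult_mult_incl)
  then show ?thesis by blast
qed

lemma split_comult_one: "split_comult \<one>\<^bsub>H\<^esub> = \<one>\<^bsub>H\<^esub> \<otimes> \<one>\<^bsub>H\<^esub>"
  by (simp add: linearity sweedler)

lemma mult_HH_eq_tmap:
  "(u \<otimes> v) \<cdot>\<^bsub>HH\<^esub> t = tmap (\<lambda>x. u \<cdot>\<^bsub>H\<^esub> x) (\<lambda>y. v \<cdot>\<^bsub>H\<^esub> y) t"
  "t \<cdot>\<^bsub>HH\<^esub> (u \<otimes> v) = tmap (\<lambda>x. x \<cdot>\<^bsub>H\<^esub> u) (\<lambda>y. y \<cdot>\<^bsub>H\<^esub> v) t"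
  by (rule tensor_eq[where x=t]; simp add: linearity mult_HH)+

lemma tmap_unit_H:
  "tmap (\<lambda>x. \<one>\<^bsub>H\<^esub> \<cdot>\<^bsub>H\<^esub> x) f = tmap id f" "tmap f (\<lambda>x. \<one>\<^bsub>H\<^esub> \<cdot>\<^bsub>H\<^esub> x) = tmap f id"
  "tmap (\<lambda>x. x \<cdot>\<^bsub>H\<^esub> \<one>\<^bsub>H\<^esub>) f = tmap id f" "tmap f (\<lambda>x. x \<cdot>\<^bsub>H\<^esub> \<one>\<^bsub>H\<^esub>) = tmap f id"
  by (simp_all add: H.unit_left H.unit_right id_def)

text \<open>
  Multiplication by the two copies of \<open>A\<close> acts on one tensor factor only: \<open>iL a\<close> on the first and
  \<open>iR b\<close> on the second, from either side.  This makes the lift compatible with the bimodule structures and with the balancing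
  relations of the neighbouring tensor sign.
\<close>

lemma split_comult_bimodule:
  "split_comult (iL a \<cdot>\<^bsub>H\<^esub> h) = tmap (\<lambda>x. iL a \<cdot>\<^bsub>H\<^esub> x) id (split_comult h)"
  "split_comult (iR b \<cdot>\<^bsub>H\<^esub> h) = tmap id (\<lambda>x. iR b \<cdot>\<^bsub>H\<^esub> x) (split_comult h)"
  "split_comult (h \<cdot>\<^bsub>H\<^esub> iL a) = tmap (\<lambda>x. x \<cdot>\<^bsub>H\<^esub> iL a) id (split_comult h)"
  "split_comult (h \<cdot>\<^bsub>H\<^esub> iR b) = tmap id (\<lambda>x. x \<cdot>\<^bsub>H\<^esub> iR b) (split_comult h)"
  by (simp_all only: split_comult_mult split_comult_incl mult_HH_eq_tmap tmap_unit_H)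

lemma split_comult_coassoc:
  "tassoc (tmap split_comult id (split_comult h)) = tmap id split_comult (split_comult h)"
proof (rule tensor_eq3[where x=h])
  have lin: "clinear split_comult" by (rule clinear_split_comult[OF clinear_ident])
  show "clinear (\<lambda>h. tassoc (tmap split_comult id (split_comult h)))"
    "clinear (\<lambda>h. tmap id split_comult (split_comult h))"
    by (simp_all add: linearity lin)
  have out: "tassoc (tmap split_comult id (sw q f)) = sw q (\<lambda>x y. tassoc (tmap split_comult id (f x y)))"
    "tmap id split_comult (sw q f) = sw q (\<lambda>x y. tmap id split_comult (f x y))"
    if "cbilinear f" for q f
    using sw_linear[OF _ that, of "\<lambda>t. tassoc (tmap split_comult id t)"]
      sw_linear[OF _ that, of "\<lambda>t. tmap id split_comult t"] by (simp_all add: linearity lin)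
  have out': "tassoc (sw q f \<otimes> z) = sw q (\<lambda>x y. tassoc (f x y \<otimes> z))"
    if "cbilinear f" for q f and z :: "'a \<otimes> 'q \<otimes> 'a"
    using sw_linear[OF _ that, of "\<lambda>t. tassoc (t \<otimes> z)"] by (simp_all add: linearity)
  show "tassoc (tmap split_comult id (split_comult (a \<otimes> q \<otimes> b))) =
      tmap id split_comult (split_comult (a \<otimes> q \<otimes> b))" for a q b
    by (simp add: out out' split_comult_pure lin linearity sw_out_pure(2) sw_assoc)
qed

text \<open>
  One statement for the four coassociativity laws: \<open>(r, l)\<close> and \<open>(r', l')\<close> each stand for the left or
  for the right balancing relations, and the same lift represents both comultiplications.
\<close>

lemma split_comult_mixed_coassoc:
  assumes "\<And>a. clinear (l a)" and "\<And>a. clinear (r' a)"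
    and "\<And>a h. split_comult (l a h) = tmap (l a) id (split_comult h)"
    and "\<And>a h. split_comult (r' a h) = tmap id (r' a) (split_comult h)"
  shows "map_left (balanced3 r l r' l') (\<lambda>h. split_comult h +o balanced r l) (split_comult h +o balanced r' l')
    = map_right (balanced3 r l r' l') (\<lambda>h. split_comult h +o balanced r' l') (split_comult h +o balanced r l)"
  by (subst map_left_coset; (subst map_right_coset)?)
    (simp_all add: assms clinear_split_comult[OF clinear_ident] split_comult_coassoc)


section \<open>The left bialgebroid\<close>

abbreviation NL where "NL \<equiv> balanced (\<lambda>a h. iR a \<cdot>\<^bsub>H\<^esub> h) (\<lambda>a h. iL a \<cdot>\<^bsub>H\<^esub> h)"
abbreviation NR where "NR \<equiv> balanced (\<lambda>a h. h \<cdot>\<^bsub>H\<^esub> iR a) (\<lambda>a h. h \<cdot>\<^bsub>H\<^esub> iL a)"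

lemma left_tensor_rel_H: "left_tensor_rel H iL iR = NL"
  by (simp add: left_tensor_rel_def)

lemma right_tensor_rel_H: "right_tensor_rel H iR iL = NR"
  by (simp add: right_tensor_rel_def)

lemma left_comult_eq: "aqa_left_comult Q \<Delta> A act = (\<lambda>h. split_comult h +o NL)"
  by (simp add: fun_eq_iff aqa_left_comult_def aqa_comult_def split_comult_def sw_def left_tensor_rel_H)

lemma right_comult_eq: "aqa_right_comult Q \<Delta> A act = (\<lambda>h. split_comult h +o NR)"
  by (simp add: fun_eq_iff aqa_right_comult_def aqa_comult_def split_comult_def sw_def right_tensor_rel_H)

lemma NL_right_ideal: "n \<in> NL \<Longrightarrow> n \<cdot>\<^bsub>HH\<^esub> t \<in> NL"
proof (induction t rule: tensor_induct)
  case (pure u v)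
  show ?case
  proof (rule balanced_mapped[where f="\<lambda>n. n \<cdot>\<^bsub>HH\<^esub> (u \<otimes> v)", OF pure _ subspace_balanced])
    show "((iR a \<cdot>\<^bsub>H\<^esub> x) \<otimes> y) \<cdot>\<^bsub>HH\<^esub> (u \<otimes> v) - (x \<otimes> (iL a \<cdot>\<^bsub>H\<^esub> y)) \<cdot>\<^bsub>HH\<^esub> (u \<otimes> v) \<in> NL" for a x y
      using balanced_relation[of "\<lambda>a h. iR a \<cdot>\<^bsub>H\<^esub> h" a "x \<cdot>\<^bsub>H\<^esub> u" "y \<cdot>\<^bsub>H\<^esub> v" "\<lambda>a h. iL a \<cdot>\<^bsub>H\<^esub> h"]
      by (simp add: mult_HH H.assoc)
  qed (simp add: linearity)
next
  case (add s t)
  then show ?case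
    by (simp add: clinear_add[of "amult HH n"] linearity complex_vector.subspace_add[OF subspace_balanced])
qed

text \<open>
  The two elements are \<open>(a \<otimes> q\<^sub>1 \<otimes> q\<^sub>2 c) \<otimes> (1 \<otimes> q\<^sub>3 \<otimes> b)\<close> and \<open>(a \<otimes> q\<^sub>1 \<otimes> 1) \<otimes> (q\<^sub>2 c \<otimes> q\<^sub>3 \<otimes> b)\<close>: the
  factor \<open>q\<^sub>2 c\<close> has moved across the tensor sign, which is a balancing relation for each \<open>q\<^sub>2\<close>.
\<close>

lemma left_takeuchi_split_comult:
  "split_comult h \<cdot>\<^bsub>HH\<^esub> (iR c \<otimes> \<one>\<^bsub>H\<^esub>) - split_comult h \<cdot>\<^bsub>HH\<^esub> (\<one>\<^bsub>H\<^esub> \<otimes> iL c) \<in> NL"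
proof (induction h rule: tensor_induct)
  case (pure a t)
  show ?case
  proof (induction t rule: tensor_induct)
    case (pure q b)
    let ?u = "\<lambda>x. a \<otimes> x \<otimes> \<one>\<^bsub>A\<^esub>" and ?v = "\<lambda>z. \<one>\<^bsub>A\<^esub> \<otimes> z \<otimes> b"
    have "split_comult (a \<otimes> q \<otimes> b) \<cdot>\<^bsub>HH\<^esub> (iR c \<otimes> \<one>\<^bsub>H\<^esub>) =
        sw q (\<lambda>x r. sw r (\<lambda>y z. (iR (act y c) \<cdot>\<^bsub>H\<^esub> ?u x) \<otimes> ?v z))"
      and "split_comult (a \<otimes> q \<otimes> b) \<cdot>\<^bsub>HH\<^esub> (\<one>\<^bsub>H\<^esub> \<otimes> iL c) =
        sw q (\<lambda>x r. sw r (\<lambda>y z. ?u x \<otimes> (iL (act y c) \<cdot>\<^bsub>H\<^esub> ?v z)))"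
      by (simp_all add: linearity sweedler)
    then have "split_comult (a \<otimes> q \<otimes> b) \<cdot>\<^bsub>HH\<^esub> (iR c \<otimes> \<one>\<^bsub>H\<^esub>) -
        split_comult (a \<otimes> q \<otimes> b) \<cdot>\<^bsub>HH\<^esub> (\<one>\<^bsub>H\<^esub> \<otimes> iL c) =
      sw q (\<lambda>x r. sw r (\<lambda>y z. (iR (act y c) \<cdot>\<^bsub>H\<^esub> ?u x) \<otimes> ?v z - ?u x \<otimes> (iL (act y c) \<cdot>\<^bsub>H\<^esub> ?v z)))"
      by (simp add: sw_diff linearity)
    also have "\<dots> \<in> NL"
      by (intro sw_in_subspace subspace_balanced balanced_relation) (simp_all add: linearity)
    finally show ?case .
  next
    case (add s t)
    then show ?case
      using complex_vector.subspace_add[OF subspace_balanced add]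
      by (simp add: clinear_add[of "\<lambda>t. split_comult (a \<otimes> t) \<cdot>\<^bsub>HH\<^esub> w" for w] linearity algebra_simps)
  qed
next
  case (add s t)
  then show ?case
    using complex_vector.subspace_add[OF subspace_balanced add]
    by (simp add: clinear_add[of "\<lambda>t. split_comult t \<cdot>\<^bsub>HH\<^esub> w" for w] linearity algebra_simps)
qed

text \<open>
  A product of representatives changes by \<open>n \<cdot> y' + split_comult h \<cdot> n'\<close> with \<open>n\<close> and \<open>n'\<close> in \<open>NL\<close>.
  The first term lies in \<open>NL\<close> because \<open>NL\<close> is a right ideal, the second because of the Takeuchi
  condition.
\<close>

lemma left_comult_mult_coset:
  "split_comult (h \<cdot>\<^bsub>H\<^esub> k) +o NL = coset_mult H NL (split_comult h +o NL) (split_comult k +o NL)"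
proof (subst coset_mult_coset[OF subspace_balanced])
  have ideal: "split_comult h \<cdot>\<^bsub>HH\<^esub> n \<in> NL" if "n \<in> NL" for n
  proof (rule balanced_mapped[where f="\<lambda>n. split_comult h \<cdot>\<^bsub>HH\<^esub> n", OF that _ subspace_balanced])
    fix a x y
    have "(split_comult h \<cdot>\<^bsub>HH\<^esub> (iR a \<otimes> \<one>\<^bsub>H\<^esub>) - split_comult h \<cdot>\<^bsub>HH\<^esub> (\<one>\<^bsub>H\<^esub> \<otimes> iL a)) \<cdot>\<^bsub>HH\<^esub> (x \<otimes> y) \<in> NL"
      by (intro NL_right_ideal left_takeuchi_split_comult)
    then show "split_comult h \<cdot>\<^bsub>HH\<^esub> ((iR a \<cdot>\<^bsub>H\<^esub> x) \<otimes> y) - split_comult h \<cdot>\<^bsub>HH\<^esub> (x \<otimes> (iL a \<cdot>\<^bsub>H\<^esub> y)) \<in> NL"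
      by (simp add: complex_vector.linear_diff[of "\<lambda>t. t \<cdot>\<^bsub>HH\<^esub> (x \<otimes> y)"] linearity HH.assoc mult_HH
          H.unit_left)
  qed (simp add: linearity)
  fix x' y' assume *: "x' - split_comult h \<in> NL" "y' - split_comult k \<in> NL"
  have "x' \<cdot>\<^bsub>HH\<^esub> y' - split_comult h \<cdot>\<^bsub>HH\<^esub> split_comult k =
    (x' - split_comult h) \<cdot>\<^bsub>HH\<^esub> y' + split_comult h \<cdot>\<^bsub>HH\<^esub> (y' - split_comult k)"
    by (simp add: complex_vector.linear_diff[of "\<lambda>t. t \<cdot>\<^bsub>HH\<^esub> y'"]
        complex_vector.linear_diff[of "\<lambda>t. split_comult h \<cdot>\<^bsub>HH\<^esub> t"] linearity)
  then show "x' \<cdot>\<^bsub>HH\<^esub> y' - split_comult h \<cdot>\<^bsub>HH\<^esub> split_comult k \<in> NL"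
    using * by (simp add: complex_vector.subspace_add[OF subspace_balanced] NL_right_ideal ideal)
qed (simp add: split_comult_mult)

abbreviation \<epsilon>L where "\<epsilon>L \<equiv> aqa_left_counit A act"

lemma clinear_left_counit [linearity]: "clinear f \<Longrightarrow> clinear (\<lambda>x. \<epsilon>L (f x))"
  unfolding aqa_left_counit_def tlift3_def by (simp add: linearity)

lemma left_counit_pure [sweedler]: "\<epsilon>L (a \<otimes> q \<otimes> b) = \<epsilon> q *\<^sub>C (a \<cdot>\<^bsub>A\<^esub> b)"
  unfolding aqa_left_counit_def by (subst tlift3_pure) (simp_all add: linearity sweedler)

lemma sw_out_left_counit [sweedler]: "cbilinear f \<Longrightarrow> \<epsilon>L (sw q f) = sw q (\<lambda>x y. \<epsilon>L (f x y))"
  using sw_linear[of \<epsilon>L f q] clinear_left_counit[OF clinear_ident] by simp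

lemmas left_counit_scale [sweedler] = clinear_scale[OF clinear_left_counit[OF clinear_ident]]

lemma left_counit_bimodule: "\<epsilon>L (iL a \<cdot>\<^bsub>H\<^esub> h) = a \<cdot>\<^bsub>A\<^esub> \<epsilon>L h" "\<epsilon>L (iR b \<cdot>\<^bsub>H\<^esub> h) = \<epsilon>L h \<cdot>\<^bsub>A\<^esub> b"
  by (rule tensor_eq3[where x=h]; simp add: linearity sweedler)+

lemma left_counit_mult:
  "\<epsilon>L (h \<cdot>\<^bsub>H\<^esub> k) = \<epsilon>L (h \<cdot>\<^bsub>H\<^esub> iL (\<epsilon>L k))" "\<epsilon>L (h \<cdot>\<^bsub>H\<^esub> k) = \<epsilon>L (h \<cdot>\<^bsub>H\<^esub> iR (\<epsilon>L k))"
proof -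
  have pure: "\<epsilon>L ((a \<otimes> q \<otimes> b) \<cdot>\<^bsub>H\<^esub> k) = \<epsilon>L ((a \<otimes> q \<otimes> b) \<cdot>\<^bsub>H\<^esub> iL (\<epsilon>L k))"
    "\<epsilon>L ((a \<otimes> q \<otimes> b) \<cdot>\<^bsub>H\<^esub> k) = \<epsilon>L ((a \<otimes> q \<otimes> b) \<cdot>\<^bsub>H\<^esub> iR (\<epsilon>L k))" for a q b
    by (rule tensor_eq3[where x=k]; simp add: linearity sweedler)+
  show "\<epsilon>L (h \<cdot>\<^bsub>H\<^esub> k) = \<epsilon>L (h \<cdot>\<^bsub>H\<^esub> iL (\<epsilon>L k))"
    by (rule tensor_eq3[where x=h]) (simp_all add: linearity pure(1))
  show "\<epsilon>L (h \<cdot>\<^bsub>H\<^esub> k) = \<epsilon>L (h \<cdot>\<^bsub>H\<^esub> iR (\<epsilon>L k))"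
    by (rule tensor_eq3[where x=h]) (simp_all add: linearity pure(2))
qed

lemma st_ring_left: "st_ring H A iL iR"
  using algebra_H A.complex_algebra_axioms alg_hom_incl_left alg_hom_incl_right incl_commute
  by (simp add: st_ring_def st_ring_axioms_def)

lemma left_bialgebroid_H:
  "left_bialgebroid H A iL iR (aqa_left_comult Q \<Delta> A act) \<epsilon>L"
  unfolding left_comult_eq left_bialgebroid_def
proof (intro conjI st_ring_left left_bialgebroid_axioms.intro; (unfold left_tensor_rel_H)?)
  show "linear_to_quotient NL (\<lambda>h. split_comult h +o NL)"
    by (rule linear_to_quotient_cosets[OF clinear_split_comult[OF clinear_ident] subspace_balanced])
next
  fix a b h
  have "induced (tmap (\<lambda>x. iL a \<cdot>\<^bsub>H\<^esub> x) (\<lambda>y. iR b \<cdot>\<^bsub>H\<^esub> y)) NL (split_comult h +o NL)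
    = tmap (\<lambda>x. iL a \<cdot>\<^bsub>H\<^esub> x) (\<lambda>y. iR b \<cdot>\<^bsub>H\<^esub> y) (split_comult h) +o NL"
  proof (rule induced_coset[OF _ subspace_balanced subspace_balanced])
    fix n assume "n \<in> NL"
    then show "tmap (\<lambda>x. iL a \<cdot>\<^bsub>H\<^esub> x) (\<lambda>y. iR b \<cdot>\<^bsub>H\<^esub> y) n \<in> NL"
    proof (rule balanced_mapped[OF _ _ subspace_balanced])
      fix c x y
      have "iL a \<cdot>\<^bsub>H\<^esub> (iR c \<cdot>\<^bsub>H\<^esub> x) = iR c \<cdot>\<^bsub>H\<^esub> (iL a \<cdot>\<^bsub>H\<^esub> x)"
        "iR b \<cdot>\<^bsub>H\<^esub> (iL c \<cdot>\<^bsub>H\<^esub> y) = iL c \<cdot>\<^bsub>H\<^esub> (iR b \<cdot>\<^bsub>H\<^esub> y)"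
        by (metis H.assoc incl_commute)+
      then show "tmap (\<lambda>x. iL a \<cdot>\<^bsub>H\<^esub> x) (\<lambda>y. iR b \<cdot>\<^bsub>H\<^esub> y) ((iR c \<cdot>\<^bsub>H\<^esub> x) \<otimes> y)
          - tmap (\<lambda>x. iL a \<cdot>\<^bsub>H\<^esub> x) (\<lambda>y. iR b \<cdot>\<^bsub>H\<^esub> y) (x \<otimes> (iL c \<cdot>\<^bsub>H\<^esub> y)) \<in> NL"
        using balanced_relation[of "\<lambda>a h. iR a \<cdot>\<^bsub>H\<^esub> h" c _ _ "\<lambda>a h. iL a \<cdot>\<^bsub>H\<^esub> h"]
        by (simp add: linearity)
    qed (simp add: linearity)
  qed (simp add: linearity)
  moreover have "split_comult (iL a \<cdot>\<^bsub>H\<^esub> iR b \<cdot>\<^bsub>H\<^esub> h) =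
      tmap (\<lambda>x. iL a \<cdot>\<^bsub>H\<^esub> x) (\<lambda>y. iR b \<cdot>\<^bsub>H\<^esub> y) (split_comult h)"
    by (simp add: H.assoc split_comult_bimodule tmap_tmap linearity)
  ultimately show "split_comult (iL a \<cdot>\<^bsub>H\<^esub> iR b \<cdot>\<^bsub>H\<^esub> h) +o NL =
      induced (tmap (\<lambda>x. iL a \<cdot>\<^bsub>H\<^esub> x) (\<lambda>y. iR b \<cdot>\<^bsub>H\<^esub> y)) NL (split_comult h +o NL)"
    by simp
next
  show "clinear \<epsilon>L" by (rule clinear_left_counit[OF clinear_ident])
next
  show "\<epsilon>L (iL a \<cdot>\<^bsub>H\<^esub> iR b \<cdot>\<^bsub>H\<^esub> h) = a \<cdot>\<^bsub>A\<^esub> \<epsilon>L h \<cdot>\<^bsub>A\<^esub> b" for a b h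
    by (simp add: H.assoc left_counit_bimodule A.assoc)
next
  fix h
  show "let N = balanced3 (\<lambda>a h. iR a \<cdot>\<^bsub>H\<^esub> h) (\<lambda>a h. iL a \<cdot>\<^bsub>H\<^esub> h) (\<lambda>a h. iR a \<cdot>\<^bsub>H\<^esub> h) (\<lambda>a h. iL a \<cdot>\<^bsub>H\<^esub> h)
    in map_left N (\<lambda>h. split_comult h +o NL) (split_comult h +o NL) =
       map_right N (\<lambda>h. split_comult h +o NL) (split_comult h +o NL)"
    unfolding Let_def
    by (rule split_comult_mixed_coassoc) (simp_all add: linearity split_comult_bimodule)
next
  fix x h assume x: "x \<in> split_comult h +o NL"
  have "tlift (\<lambda>u v. iL (\<epsilon>L u) \<cdot>\<^bsub>H\<^esub> v) x = tlift (\<lambda>u v. iL (\<epsilon>L u) \<cdot>\<^bsub>H\<^esub> v) (split_comult h)"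
    by (rule coset_evaluation[OF x])
      (simp_all add: linearity tlift left_counit_bimodule incl_left_mult H.assoc)
  also have "\<dots> = h"
    by (rule tensor_eq3[where x=h]) (simp_all add: linearity sweedler tlift)
  finally show "tlift (\<lambda>u v. iL (\<epsilon>L u) \<cdot>\<^bsub>H\<^esub> v) x = h" .
  have "tlift (\<lambda>u v. iR (\<epsilon>L v) \<cdot>\<^bsub>H\<^esub> u) x = tlift (\<lambda>u v. iR (\<epsilon>L v) \<cdot>\<^bsub>H\<^esub> u) (split_comult h)"
    by (rule coset_evaluation[OF x])
      (simp_all add: linearity tlift left_counit_bimodule incl_right_mult H.assoc)
  also have "\<dots> = h"
    by (rule tensor_eq3[where x=h]) (simp_all add: linearity sweedler tlift)
  finally show "tlift (\<lambda>u v. iR (\<epsilon>L v) \<cdot>\<^bsub>H\<^esub> u) x = h" .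
next
  fix h
  have "induced (tmap (\<lambda>h. h \<cdot>\<^bsub>H\<^esub> iR c) id) NL (split_comult h +o NL) =
      induced (tmap id (\<lambda>h. h \<cdot>\<^bsub>H\<^esub> iL c)) NL (split_comult h +o NL)" for c
  proof -
    have right_mult: "induced (\<lambda>t. t \<cdot>\<^bsub>HH\<^esub> w) NL (split_comult h +o NL) = split_comult h \<cdot>\<^bsub>HH\<^esub> w +o NL" for w
      by (rule induced_coset[OF _ subspace_balanced subspace_balanced])
        (simp_all add: linearity NL_right_ideal)
    have "tmap (\<lambda>h. h \<cdot>\<^bsub>H\<^esub> iR c) id = (\<lambda>t. t \<cdot>\<^bsub>HH\<^esub> (iR c \<otimes> \<one>\<^bsub>H\<^esub>))"
      "tmap id (\<lambda>h. h \<cdot>\<^bsub>H\<^esub> iL c) = (\<lambda>t. t \<cdot>\<^bsub>HH\<^esub> (\<one>\<^bsub>H\<^esub> \<otimes> iL c))"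
      by (simp_all add: mult_HH_eq_tmap tmap_unit_H)
    then show ?thesis
      by (simp add: right_mult coset_eqI[OF subspace_balanced left_takeuchi_split_comult])
  qed
  then show "split_comult h +o NL \<in> left_takeuchi H iL iR"
    by (auto simp: left_takeuchi_def left_tensor_rel_H quotient_space_def Let_def)
next
  show "split_comult \<one>\<^bsub>H\<^esub> +o NL = (\<one>\<^bsub>H\<^esub> \<otimes> \<one>\<^bsub>H\<^esub>) +o NL"
    by (simp add: split_comult_one)
next
  show "split_comult (h \<cdot>\<^bsub>H\<^esub> k) +o NL = coset_mult H NL (split_comult h +o NL) (split_comult k +o NL)" for h k
    by (rule left_comult_mult_coset)
next
  show "\<epsilon>L (h \<cdot>\<^bsub>H\<^esub> k) = \<epsilon>L (h \<cdot>\<^bsub>H\<^esub> iL (\<epsilon>L k))" "\<epsilon>L (h \<cdot>\<^bsub>H\<^esub> k) = \<epsilon>L (h \<cdot>\<^bsub>H\<^esub> iR (\<epsilon>L k))" for h k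
    by (rule left_counit_mult)+
qed


section \<open>The right bialgebroid\<close>

abbreviation \<epsilon>R where "\<epsilon>R \<equiv> aqa_right_counit T A act"

lemma clinear_right_counit [linearity]: "clinear f \<Longrightarrow> clinear (\<lambda>x. \<epsilon>R (f x))"
  unfolding aqa_right_counit_def tlift3_def by (simp add: linearity)

lemma right_counit_pure: "\<epsilon>R (a \<otimes> q \<otimes> b) = act (T q) (b \<cdot>\<^bsub>A\<^esub> a)"
  unfolding aqa_right_counit_def by (subst tlift3_pure) (simp_all add: linearity)

lemma sw_out_right_counit [sweedler]: "cbilinear f \<Longrightarrow> \<epsilon>R (sw q f) = sw q (\<lambda>x y. \<epsilon>R (f x y))"
  using sw_linear[of \<epsilon>R f q] clinear_right_counit[OF clinear_ident] by simp

text \<open>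
  For \<open>h = a \<otimes> q \<otimes> b\<close> the left-hand sides are \<open>T q\<^sub>3 (b a) \<cdot> (T q\<^sub>2 \<cdot> q\<^sub>1) c\<close> and \<open>(T q\<^sub>2 \<cdot> q\<^sub>3) c \<cdot> T q\<^sub>1 (b a)\<close>.
\<close>

lemma right_counit_bimodule:
  "\<epsilon>R (h \<cdot>\<^bsub>H\<^esub> iL c) = \<epsilon>R h \<cdot>\<^bsub>A\<^esub> c" "\<epsilon>R (h \<cdot>\<^bsub>H\<^esub> iR c) = c \<cdot>\<^bsub>A\<^esub> \<epsilon>R h"
proof -
  show "\<epsilon>R (h \<cdot>\<^bsub>H\<^esub> iL c) = \<epsilon>R h \<cdot>\<^bsub>A\<^esub> c"
  proof (rule tensor_eq3[where x=h])
    fix a q b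
    have "\<epsilon>R ((a \<otimes> q \<otimes> b) \<cdot>\<^bsub>H\<^esub> iL c) = sw q (\<lambda>x r. sw r (\<lambda>y z. act (T z) (b \<cdot>\<^bsub>A\<^esub> a) \<cdot>\<^bsub>A\<^esub> act (T y \<cdot>\<^bsub>Q\<^esub> x) c))"
      by (simp add: linearity sweedler right_counit_pure)
    also have "\<dots> = act (T q) (b \<cdot>\<^bsub>A\<^esub> a) \<cdot>\<^bsub>A\<^esub> c"
      by (subst cancel_antipode_left_op(2)[of "\<lambda>u z. act (T z) (b \<cdot>\<^bsub>A\<^esub> a) \<cdot>\<^bsub>A\<^esub> act u c"])
        (simp_all add: linearity A.act_unit)
    finally show "\<epsilon>R ((a \<otimes> q \<otimes> b) \<cdot>\<^bsub>H\<^esub> iL c) = \<epsilon>R (a \<otimes> q \<otimes> b) \<cdot>\<^bsub>A\<^esub> c"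
      by (simp add: right_counit_pure)
  qed (simp_all add: linearity)
  show "\<epsilon>R (h \<cdot>\<^bsub>H\<^esub> iR c) = c \<cdot>\<^bsub>A\<^esub> \<epsilon>R h"
  proof (rule tensor_eq3[where x=h])
    fix a q b
    have "\<epsilon>R ((a \<otimes> q \<otimes> b) \<cdot>\<^bsub>H\<^esub> iR c) = sw q (\<lambda>x r. sw r (\<lambda>y z. act (T y \<cdot>\<^bsub>Q\<^esub> z) c \<cdot>\<^bsub>A\<^esub> act (T x) (b \<cdot>\<^bsub>A\<^esub> a)))"
      by (simp add: linearity sweedler right_counit_pure)
    also have "\<dots> = c \<cdot>\<^bsub>A\<^esub> act (T q) (b \<cdot>\<^bsub>A\<^esub> a)"
      by (simp add: cancel_antipode_left(1)[of "\<lambda>u. act u c \<cdot>\<^bsub>A\<^esub> act (T x) (b \<cdot>\<^bsub>A\<^esub> a)" for x]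
          linearity A.act_unit sw_counit_right)
    finally show "\<epsilon>R ((a \<otimes> q \<otimes> b) \<cdot>\<^bsub>H\<^esub> iR c) = c \<cdot>\<^bsub>A\<^esub> \<epsilon>R (a \<otimes> q \<otimes> b)"
      by (simp add: right_counit_pure)
  qed (simp_all add: linearity)
qed

lemma right_counit_incl_mid: "\<epsilon>R (h \<cdot>\<^bsub>H\<^esub> incl_mid p) = act (T p) (\<epsilon>R h)"
proof (rule tensor_eq3[where x=h])
  show "\<epsilon>R ((a \<otimes> q \<otimes> b) \<cdot>\<^bsub>H\<^esub> incl_mid p) = act (T p) (\<epsilon>R (a \<otimes> q \<otimes> b))" for a q b
    by (simp add: mult_incl_mid right_counit_pure antipode_mult A.act_mult)
qed (simp_all add: linearity)

text \<open>
  Multiplying \<open>h\<close> by \<open>iL a\<close>, \<open>iR b\<close> and \<open>incl_mid q\<close> in turn shows that \<open>\<epsilon>R (h \<cdot> k)\<close> depends on \<open>h\<close> only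
  through \<open>\<epsilon>R h\<close>.  The multiplicativity laws of the counit follow, as \<open>iL (\<epsilon>R h)\<close> and \<open>iR (\<epsilon>R h)\<close> have
  the same value under \<open>\<epsilon>R\<close> as \<open>h\<close>.
\<close>

lemma right_counit_mult_pure: "\<epsilon>R (h \<cdot>\<^bsub>H\<^esub> (a \<otimes> q \<otimes> b)) = act (T q) (b \<cdot>\<^bsub>A\<^esub> (\<epsilon>R h \<cdot>\<^bsub>A\<^esub> a))"
  unfolding pure_eq_product H.assoc[symmetric]
  by (simp add: right_counit_incl_mid right_counit_bimodule)

lemma right_counit_incl: "\<epsilon>R (iL a) = a" "\<epsilon>R (iR a) = a"
  by (simp_all add: incl_left_def incl_right_def right_counit_pure A.unit_left A.unit_right
      antipode_one A.act_unit)

lemma right_counit_mult: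
  "\<epsilon>R (h \<cdot>\<^bsub>H\<^esub> k) = \<epsilon>R (iL (\<epsilon>R h) \<cdot>\<^bsub>H\<^esub> k)" "\<epsilon>R (h \<cdot>\<^bsub>H\<^esub> k) = \<epsilon>R (iR (\<epsilon>R h) \<cdot>\<^bsub>H\<^esub> k)"
  by (rule tensor_eq3[where x=k];
      simp add: linearity right_counit_mult_pure right_counit_incl)+

lemma NR_left_ideal: "n \<in> NR \<Longrightarrow> t \<cdot>\<^bsub>HH\<^esub> n \<in> NR"
proof (induction t rule: tensor_induct)
  case (pure u v)
  show ?case
  proof (rule balanced_mapped[where f="\<lambda>n. (u \<otimes> v) \<cdot>\<^bsub>HH\<^esub> n", OF pure _ subspace_balanced])
    show "(u \<otimes> v) \<cdot>\<^bsub>HH\<^esub> ((x \<cdot>\<^bsub>H\<^esub> iR a) \<otimes> y) - (u \<otimes> v) \<cdot>\<^bsub>HH\<^esub> (x \<otimes> (y \<cdot>\<^bsub>H\<^esub> iL a)) \<in> NR" for a x y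
      using balanced_relation[of "\<lambda>a h. h \<cdot>\<^bsub>H\<^esub> iR a" a "u \<cdot>\<^bsub>H\<^esub> x" "v \<cdot>\<^bsub>H\<^esub> y" "\<lambda>a h. h \<cdot>\<^bsub>H\<^esub> iL a"]
      by (simp add: mult_HH H.assoc)
  qed (simp add: linearity)
next
  case (add s t)
  then show ?case
    by (simp add: clinear_add[of "\<lambda>t. t \<cdot>\<^bsub>HH\<^esub> n"] linearity complex_vector.subspace_add[OF subspace_balanced])
qed

text \<open>
  Inserting \<open>\<epsilon> q\<^sub>2 = q\<^sub>2 \<cdot> T q\<^sub>3\<close> rewrites \<open>(a \<otimes> q\<^sub>1 \<otimes> c) \<otimes> (1 \<otimes> q\<^sub>2 \<otimes> b)\<close> as
  \<open>(a \<otimes> q\<^sub>1 \<otimes> 1) \<cdot> iR (T q\<^sub>2 c) \<otimes> (1 \<otimes> q\<^sub>3 \<otimes> b)\<close>.  The balancing relation moves \<open>T q\<^sub>2 c\<close> to the second factor,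
  where the coproduct of \<open>q\<^sub>3\<close> produces \<open>q\<^sub>3 \<cdot> T q\<^sub>2\<close>, which cancels again because \<open>T\<close> is an
  involution.
\<close>

lemma right_takeuchi_split_comult:
  "(iR c \<otimes> \<one>\<^bsub>H\<^esub>) \<cdot>\<^bsub>HH\<^esub> split_comult h - (\<one>\<^bsub>H\<^esub> \<otimes> iL c) \<cdot>\<^bsub>HH\<^esub> split_comult h \<in> NR"
proof (induction h rule: tensor_induct)
  case (pure a t)
  show ?case
  proof (induction t rule: tensor_induct)
    case (pure q b)
    let ?u = "\<lambda>x. a \<otimes> x \<otimes> \<one>\<^bsub>A\<^esub>" and ?v = "\<lambda>z. \<one>\<^bsub>A\<^esub> \<otimes> z \<otimes> b"
    have "sw q (\<lambda>x r. sw r (\<lambda>y z. (?u x \<cdot>\<^bsub>H\<^esub> iR (act (T y) c)) \<otimes> ?v z)) =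
        sw q (\<lambda>x s. sw s (\<lambda>x' r. sw r (\<lambda>y z. (a \<otimes> x \<otimes> act (x' \<cdot>\<^bsub>Q\<^esub> T y) c) \<otimes> ?v z)))"
      by (simp add: linearity sweedler)
    also have "\<dots> = sw q (\<lambda>x s. (a \<otimes> x \<otimes> c) \<otimes> ?v s)"
      by (simp add: cancel_antipode_right(2)[of "\<lambda>w z. (a \<otimes> x \<otimes> act w c) \<otimes> ?v z" for x]
          linearity A.act_unit)
    also have "\<dots> = (iR c \<otimes> \<one>\<^bsub>H\<^esub>) \<cdot>\<^bsub>HH\<^esub> split_comult (a \<otimes> q \<otimes> b)"
      by (simp add: linearity sweedler)
    finally have left: "(iR c \<otimes> \<one>\<^bsub>H\<^esub>) \<cdot>\<^bsub>HH\<^esub> split_comult (a \<otimes> q \<otimes> b) =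
        sw q (\<lambda>x r. sw r (\<lambda>y z. (?u x \<cdot>\<^bsub>H\<^esub> iR (act (T y) c)) \<otimes> ?v z))" ..
    have "sw q (\<lambda>x r. sw r (\<lambda>y z. ?u x \<otimes> (?v z \<cdot>\<^bsub>H\<^esub> iL (act (T y) c)))) =
        sw q (\<lambda>x s. sw s (\<lambda>y r. sw r (\<lambda>z' z. ?u x \<otimes> act (z' \<cdot>\<^bsub>Q\<^esub> T y) c \<otimes> z \<otimes> b)))"
      by (simp add: linearity sweedler)
    also have "\<dots> = sw q (\<lambda>x s. ?u x \<otimes> c \<otimes> s \<otimes> b)"
      by (simp add: cancel_antipode_right_op(2)[of "\<lambda>w z. ?u x \<otimes> act w c \<otimes> z \<otimes> b" for x]
          linearity A.act_unit)
    also have "\<dots> = (\<one>\<^bsub>H\<^esub> \<otimes> iL c) \<cdot>\<^bsub>HH\<^esub> split_comult (a \<otimes> q \<otimes> b)"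
      by (simp add: linearity sweedler)
    finally have right: "(\<one>\<^bsub>H\<^esub> \<otimes> iL c) \<cdot>\<^bsub>HH\<^esub> split_comult (a \<otimes> q \<otimes> b) =
        sw q (\<lambda>x r. sw r (\<lambda>y z. ?u x \<otimes> (?v z \<cdot>\<^bsub>H\<^esub> iL (act (T y) c))))" ..
    have "(iR c \<otimes> \<one>\<^bsub>H\<^esub>) \<cdot>\<^bsub>HH\<^esub> split_comult (a \<otimes> q \<otimes> b) - (\<one>\<^bsub>H\<^esub> \<otimes> iL c) \<cdot>\<^bsub>HH\<^esub> split_comult (a \<otimes> q \<otimes> b) =
      sw q (\<lambda>x r. sw r (\<lambda>y z. (?u x \<cdot>\<^bsub>H\<^esub> iR (act (T y) c)) \<otimes> ?v z - ?u x \<otimes> (?v z \<cdot>\<^bsub>H\<^esub> iL (act (T y) c))))"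
      unfolding left right by (simp add: sw_diff linearity)
    also have "\<dots> \<in> NR"
      by (intro sw_in_subspace subspace_balanced balanced_relation) (simp_all add: linearity)
    finally show ?case .
  next
    case (add s t)
    then show ?case
      using complex_vector.subspace_add[OF subspace_balanced add]
      by (simp add: clinear_add[of "\<lambda>t. w \<cdot>\<^bsub>HH\<^esub> split_comult (a \<otimes> t)" for w] linearity algebra_simps)
  qed
next
  case (add s t)
  then show ?case
    using complex_vector.subspace_add[OF subspace_balanced add]
    by (simp add: clinear_add[of "\<lambda>t. w \<cdot>\<^bsub>HH\<^esub> split_comult t" for w] linearity algebra_simps)
qed

text \<open>
  The mirror image of the argument on the left: \<open>NR\<close> is a left ideal, and the Takeuchi condition takes
  care of multiplication from the right.
\<close>

lemma right_comult_mult_coset: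
  "split_comult (h \<cdot>\<^bsub>H\<^esub> k) +o NR = coset_mult H NR (split_comult h +o NR) (split_comult k +o NR)"
proof (subst coset_mult_coset[OF subspace_balanced])
  have ideal: "n \<cdot>\<^bsub>HH\<^esub> split_comult k \<in> NR" if "n \<in> NR" for n
  proof (rule balanced_mapped[where f="\<lambda>n. n \<cdot>\<^bsub>HH\<^esub> split_comult k", OF that _ subspace_balanced])
    fix a x y
    have "(x \<otimes> y) \<cdot>\<^bsub>HH\<^esub> ((iR a \<otimes> \<one>\<^bsub>H\<^esub>) \<cdot>\<^bsub>HH\<^esub> split_comult k - (\<one>\<^bsub>H\<^esub> \<otimes> iL a) \<cdot>\<^bsub>HH\<^esub> split_comult k) \<in> NR"
      by (intro NR_left_ideal right_takeuchi_split_comult)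
    then show "((x \<cdot>\<^bsub>H\<^esub> iR a) \<otimes> y) \<cdot>\<^bsub>HH\<^esub> split_comult k - (x \<otimes> (y \<cdot>\<^bsub>H\<^esub> iL a)) \<cdot>\<^bsub>HH\<^esub> split_comult k \<in> NR"
      by (simp add: complex_vector.linear_diff[of "\<lambda>t. (x \<otimes> y) \<cdot>\<^bsub>HH\<^esub> t"] linearity HH.assoc[symmetric]
          mult_HH H.unit_right)
  qed (simp add: linearity)
  fix x' y' assume *: "x' - split_comult h \<in> NR" "y' - split_comult k \<in> NR"
  have "x' \<cdot>\<^bsub>HH\<^esub> y' - split_comult h \<cdot>\<^bsub>HH\<^esub> split_comult k =
    x' \<cdot>\<^bsub>HH\<^esub> (y' - split_comult k) + (x' - split_comult h) \<cdot>\<^bsub>HH\<^esub> split_comult k"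
    by (simp add: complex_vector.linear_diff[of "\<lambda>t. t \<cdot>\<^bsub>HH\<^esub> split_comult k"]
        complex_vector.linear_diff[of "\<lambda>t. x' \<cdot>\<^bsub>HH\<^esub> t"] linearity)
  then show "x' \<cdot>\<^bsub>HH\<^esub> y' - split_comult h \<cdot>\<^bsub>HH\<^esub> split_comult k \<in> NR"
    using * by (simp add: complex_vector.subspace_add[OF subspace_balanced] NR_left_ideal ideal)
qed (simp add: split_comult_mult)

lemma st_ring_right: "st_ring H (opposite A) iR iL"
  using algebra_H complex_algebra_opposite[OF A.complex_algebra_axioms]
    alg_hom_incl_left alg_hom_incl_right incl_commute
  by (simp add: st_ring_def st_ring_axioms_def)

lemma right_bialgebroid_H:
  "right_bialgebroid H (opposite A) iR iL (aqa_right_comult Q \<Delta> A act) \<epsilon>R"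
  unfolding right_comult_eq right_bialgebroid_def
proof (intro conjI st_ring_right right_bialgebroid_axioms.intro; (unfold right_tensor_rel_H)?)
  show "linear_to_quotient NR (\<lambda>h. split_comult h +o NR)"
    by (rule linear_to_quotient_cosets[OF clinear_split_comult[OF clinear_ident] subspace_balanced])
next
  fix a b h
  have "induced (tmap (\<lambda>x. x \<cdot>\<^bsub>H\<^esub> iL a) (\<lambda>y. y \<cdot>\<^bsub>H\<^esub> iR b)) NR (split_comult h +o NR)
    = tmap (\<lambda>x. x \<cdot>\<^bsub>H\<^esub> iL a) (\<lambda>y. y \<cdot>\<^bsub>H\<^esub> iR b) (split_comult h) +o NR"
  proof (rule induced_coset[OF _ subspace_balanced subspace_balanced])
    fix n assume "n \<in> NR"
    then show "tmap (\<lambda>x. x \<cdot>\<^bsub>H\<^esub> iL a) (\<lambda>y. y \<cdot>\<^bsub>H\<^esub> iR b) n \<in> NR"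
    proof (rule balanced_mapped[OF _ _ subspace_balanced])
      fix c x y
      have "x \<cdot>\<^bsub>H\<^esub> iR c \<cdot>\<^bsub>H\<^esub> iL a = x \<cdot>\<^bsub>H\<^esub> iL a \<cdot>\<^bsub>H\<^esub> iR c"
        "y \<cdot>\<^bsub>H\<^esub> iL c \<cdot>\<^bsub>H\<^esub> iR b = y \<cdot>\<^bsub>H\<^esub> iR b \<cdot>\<^bsub>H\<^esub> iL c"
        by (metis H.assoc incl_commute)+
      then show "tmap (\<lambda>x. x \<cdot>\<^bsub>H\<^esub> iL a) (\<lambda>y. y \<cdot>\<^bsub>H\<^esub> iR b) ((x \<cdot>\<^bsub>H\<^esub> iR c) \<otimes> y)
          - tmap (\<lambda>x. x \<cdot>\<^bsub>H\<^esub> iL a) (\<lambda>y. y \<cdot>\<^bsub>H\<^esub> iR b) (x \<otimes> (y \<cdot>\<^bsub>H\<^esub> iL c)) \<in> NR"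
        using balanced_relation[of "\<lambda>a h. h \<cdot>\<^bsub>H\<^esub> iR a" c _ _ "\<lambda>a h. h \<cdot>\<^bsub>H\<^esub> iL a"]
        by (simp add: linearity)
    qed (simp add: linearity)
  qed (simp add: linearity)
  moreover have "split_comult (h \<cdot>\<^bsub>H\<^esub> iL a \<cdot>\<^bsub>H\<^esub> iR b) =
      tmap (\<lambda>x. x \<cdot>\<^bsub>H\<^esub> iL a) (\<lambda>y. y \<cdot>\<^bsub>H\<^esub> iR b) (split_comult h)"
    by (simp add: split_comult_bimodule tmap_tmap linearity)
  ultimately show "split_comult (h \<cdot>\<^bsub>H\<^esub> iL a \<cdot>\<^bsub>H\<^esub> iR b) +o NR =
      induced (tmap (\<lambda>x. x \<cdot>\<^bsub>H\<^esub> iL a) (\<lambda>y. y \<cdot>\<^bsub>H\<^esub> iR b)) NR (split_comult h +o NR)"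
    by simp
next
  show "clinear \<epsilon>R" by (rule clinear_right_counit[OF clinear_ident])
next
  show "\<epsilon>R (h \<cdot>\<^bsub>H\<^esub> iL a \<cdot>\<^bsub>H\<^esub> iR b) = a \<cdot>\<^bsub>opposite A\<^esub> \<epsilon>R h \<cdot>\<^bsub>opposite A\<^esub> b" for a b h
    by (simp add: right_counit_bimodule opposite_def)
next
  fix h
  show "let N = balanced3 (\<lambda>a h. h \<cdot>\<^bsub>H\<^esub> iR a) (\<lambda>a h. h \<cdot>\<^bsub>H\<^esub> iL a) (\<lambda>a h. h \<cdot>\<^bsub>H\<^esub> iR a) (\<lambda>a h. h \<cdot>\<^bsub>H\<^esub> iL a)
    in map_left N (\<lambda>h. split_comult h +o NR) (split_comult h +o NR) =
       map_right N (\<lambda>h. split_comult h +o NR) (split_comult h +o NR)"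
    unfolding Let_def
    by (rule split_comult_mixed_coassoc) (simp_all add: linearity split_comult_bimodule)
next
  fix x h assume x: "x \<in> split_comult h +o NR"
  have "tlift (\<lambda>u v. v \<cdot>\<^bsub>H\<^esub> iL (\<epsilon>R u)) x = tlift (\<lambda>u v. v \<cdot>\<^bsub>H\<^esub> iL (\<epsilon>R u)) (split_comult h)"
    by (rule coset_evaluation[OF x])
      (simp_all add: linearity tlift right_counit_bimodule incl_left_mult H.assoc)
  also have "\<dots> = h"
  proof (rule tensor_eq3[where x=h])
    fix a q b
    have "tlift (\<lambda>u v. v \<cdot>\<^bsub>H\<^esub> iL (\<epsilon>R u)) (split_comult (a \<otimes> q \<otimes> b)) =
        sw q (\<lambda>x r. sw r (\<lambda>y z. act (y \<cdot>\<^bsub>Q\<^esub> T x) a \<otimes> z \<otimes> b))"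
      by (simp add: linearity sweedler tlift right_counit_pure)
    also have "\<dots> = a \<otimes> q \<otimes> b"
      by (subst cancel_antipode_right_op(2)[of "\<lambda>w z. act w a \<otimes> z \<otimes> b"])
        (simp_all add: linearity A.act_unit)
    finally show "tlift (\<lambda>u v. v \<cdot>\<^bsub>H\<^esub> iL (\<epsilon>R u)) (split_comult (a \<otimes> q \<otimes> b)) = a \<otimes> q \<otimes> b" .
  qed (simp_all add: linearity)
  finally show "tlift (\<lambda>u v. v \<cdot>\<^bsub>H\<^esub> iL (\<epsilon>R u)) x = h" .
  have "tlift (\<lambda>u v. u \<cdot>\<^bsub>H\<^esub> iR (\<epsilon>R v)) x = tlift (\<lambda>u v. u \<cdot>\<^bsub>H\<^esub> iR (\<epsilon>R v)) (split_comult h)"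
    by (rule coset_evaluation[OF x])
      (simp_all add: linearity tlift right_counit_bimodule incl_right_mult H.assoc)
  also have "\<dots> = h"
  proof (rule tensor_eq3[where x=h])
    fix a q b
    have "tlift (\<lambda>u v. u \<cdot>\<^bsub>H\<^esub> iR (\<epsilon>R v)) (split_comult (a \<otimes> q \<otimes> b)) =
        sw q (\<lambda>x r. sw r (\<lambda>y z. a \<otimes> x \<otimes> act (y \<cdot>\<^bsub>Q\<^esub> T z) b))"
      by (simp add: linearity sweedler tlift right_counit_pure)
    also have "\<dots> = a \<otimes> q \<otimes> b"
      by (simp add: cancel_antipode_right(1)[of "\<lambda>w. a \<otimes> x \<otimes> act w b" for x]
          linearity A.act_unit sw_counit_right)
    finally show "tlift (\<lambda>u v. u \<cdot>\<^bsub>H\<^esub> iR (\<epsilon>R v)) (split_comult (a \<otimes> q \<otimes> b)) = a \<otimes> q \<otimes> b" .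
  qed (simp_all add: linearity)
  finally show "tlift (\<lambda>u v. u \<cdot>\<^bsub>H\<^esub> iR (\<epsilon>R v)) x = h" .
next
  fix h
  have "induced (tmap (\<lambda>h. iR c \<cdot>\<^bsub>H\<^esub> h) id) NR (split_comult h +o NR) =
      induced (tmap id (\<lambda>h. iL c \<cdot>\<^bsub>H\<^esub> h)) NR (split_comult h +o NR)" for c
  proof -
    have left_mult: "induced (\<lambda>t. w \<cdot>\<^bsub>HH\<^esub> t) NR (split_comult h +o NR) = w \<cdot>\<^bsub>HH\<^esub> split_comult h +o NR" for w
      by (rule induced_coset[OF _ subspace_balanced subspace_balanced])
        (simp_all add: linearity NR_left_ideal)
    have "tmap (\<lambda>h. iR c \<cdot>\<^bsub>H\<^esub> h) id = (\<lambda>t. (iR c \<otimes> \<one>\<^bsub>H\<^esub>) \<cdot>\<^bsub>HH\<^esub> t)"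
      "tmap id (\<lambda>h. iL c \<cdot>\<^bsub>H\<^esub> h) = (\<lambda>t. (\<one>\<^bsub>H\<^esub> \<otimes> iL c) \<cdot>\<^bsub>HH\<^esub> t)"
      by (simp_all only: mult_HH_eq_tmap tmap_unit_H)
    then show ?thesis
      using left_mult coset_eqI[OF subspace_balanced right_takeuchi_split_comult] by simp
  qed
  then show "split_comult h +o NR \<in> right_takeuchi H iR iL"
    by (auto simp: right_takeuchi_def right_tensor_rel_H quotient_space_def Let_def)
next
  show "split_comult \<one>\<^bsub>H\<^esub> +o NR = (\<one>\<^bsub>H\<^esub> \<otimes> \<one>\<^bsub>H\<^esub>) +o NR"
    by (simp add: split_comult_one)
next
  show "split_comult (h \<cdot>\<^bsub>H\<^esub> k) +o NR = coset_mult H NR (split_comult h +o NR) (split_comult k +o NR)" for h k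
    by (rule right_comult_mult_coset)
next
  show "\<epsilon>R (h \<cdot>\<^bsub>H\<^esub> k) = \<epsilon>R (iR (\<epsilon>R h) \<cdot>\<^bsub>H\<^esub> k)" "\<epsilon>R (h \<cdot>\<^bsub>H\<^esub> k) = \<epsilon>R (iL (\<epsilon>R h) \<cdot>\<^bsub>H\<^esub> k)" for h k
    by (rule right_counit_mult)+
qed


section \<open>The antipode of the Hopf algebroid\<close>

abbreviation S where "S \<equiv> aqa_antipode \<Delta> T act"

lemma clinear_S [linearity]: "clinear f \<Longrightarrow> clinear (\<lambda>x. S (f x))"
  unfolding aqa_antipode_def tlift3_def comult3_def by (simp add: linearity)

lemma S_pure:
  "S (a \<otimes> q \<otimes> b) = sw q (\<lambda>x r. sw r (\<lambda>y z. act (T z) b \<otimes> T y \<otimes> act (T x) a))"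
proof -
  have "S (a \<otimes> q \<otimes> b) = tlift3 (\<lambda>x y z. act (T z) b \<otimes> T y \<otimes> act (T x) a) (comult3 \<Delta> q)"
    unfolding aqa_antipode_def
    by (subst tlift3_pure) (simp_all add: tlift3_def comult3_def linearity)
  also have "\<dots> = sw q (\<lambda>x r. sw r (\<lambda>y z. act (T z) b \<otimes> T y \<otimes> act (T x) a))"
    by (rule comult3_eq_sw) (simp_all add: linearity)
  finally show ?thesis .
qed

lemma sw_out_S: "cbilinear f \<Longrightarrow> S (sw q f) = sw q (\<lambda>x y. S (f x y))"
  using sw_linear[of S f q] clinear_S[OF clinear_ident] by simp

text \<open>
  As \<open>T\<close> reverses coproducts, \<open>S (S (a \<otimes> q \<otimes> b)) = (q\<^sub>2 \<cdot> T q\<^sub>1) a \<otimes> q\<^sub>3 \<otimes> (q\<^sub>4 \<cdot> T q\<^sub>5) b\<close>.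
\<close>

lemma S_involutive: "S (S h) = h"
proof (rule tensor_eq3[where x=h])
  fix a q b
  have "S (S (a \<otimes> q \<otimes> b)) = sw q (\<lambda>x r. sw r (\<lambda>x' r. sw r (\<lambda>y r. sw r (\<lambda>z' z.
      act (x' \<cdot>\<^bsub>Q\<^esub> T x) a \<otimes> y \<otimes> act (z' \<cdot>\<^bsub>Q\<^esub> T z) b))))"
    by (simp add: S_pure sw_out_S linearity sweedler)
  also have "\<dots> = sw q (\<lambda>x r. sw r (\<lambda>x' y. act (x' \<cdot>\<^bsub>Q\<^esub> T x) a \<otimes> y \<otimes> b))"
    by (simp add: cancel_antipode_right(1)[of "\<lambda>w. act u a \<otimes> y \<otimes> act w b" for u y]
        linearity A.act_unit sw_counit_right)
  also have "\<dots> = a \<otimes> q \<otimes> b"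
    by (subst cancel_antipode_right_op(2)[of "\<lambda>w y. act w a \<otimes> y \<otimes> b"])
      (simp_all add: linearity A.act_unit)
  finally show "S (S (a \<otimes> q \<otimes> b)) = a \<otimes> q \<otimes> b" .
qed (simp_all add: linearity)

lemma S_incl_right_mult: "S (iR c \<cdot>\<^bsub>H\<^esub> h) = S h \<cdot>\<^bsub>H\<^esub> iL c"
  by (rule tensor_eq3[where x=h]) (simp_all add: S_pure linearity sweedler)

text \<open>
  The left-hand side is \<open>T q\<^sub>5 b \<otimes> T q\<^sub>4 \<otimes> (T q\<^sub>3 a \<cdot> (T q\<^sub>2 \<cdot> q\<^sub>1) c)\<close>.
\<close>

lemma S_mult_incl_left: "S (h \<cdot>\<^bsub>H\<^esub> iL c) = iR c \<cdot>\<^bsub>H\<^esub> S h"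
proof (rule tensor_eq3[where x=h])
  fix a q b
  have "S ((a \<otimes> q \<otimes> b) \<cdot>\<^bsub>H\<^esub> iL c) = sw q (\<lambda>x r. sw r (\<lambda>x' r. sw r (\<lambda>u r. sw r (\<lambda>y z.
      act (T z) b \<otimes> T y \<otimes> (act (T u) a \<cdot>\<^bsub>A\<^esub> act (T x' \<cdot>\<^bsub>Q\<^esub> x) c)))))"
    by (simp add: S_pure sw_out_S linearity sweedler)
  also have "\<dots> = sw q (\<lambda>u r. sw r (\<lambda>y z. act (T z) b \<otimes> T y \<otimes> (act (T u) a \<cdot>\<^bsub>A\<^esub> c)))"
    by (subst cancel_antipode_left_op(2)[of "\<lambda>w r. sw r (\<lambda>u r. sw r (\<lambda>y z.
        act (T z) b \<otimes> T y \<otimes> (act (T u) a \<cdot>\<^bsub>A\<^esub> act w c)))"])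
      (simp_all add: linearity A.act_unit)
  also have "\<dots> = iR c \<cdot>\<^bsub>H\<^esub> S (a \<otimes> q \<otimes> b)"
    by (simp add: S_pure linearity sweedler)
  finally show "S ((a \<otimes> q \<otimes> b) \<cdot>\<^bsub>H\<^esub> iL c) = iR c \<cdot>\<^bsub>H\<^esub> S (a \<otimes> q \<otimes> b)" .
qed (simp_all add: linearity)

text \<open>
  The left-hand side is \<open>1 \<otimes> T q\<^sub>3 \<cdot> q\<^sub>4 \<otimes> (T q\<^sub>2 b \<cdot> T q\<^sub>1 a)\<close>, and \<open>T q\<^sub>2 b \<cdot> T q\<^sub>1 a = T q (b a)\<close>.
\<close>

lemma S_mult_left: "tlift (\<lambda>u v. S u \<cdot>\<^bsub>H\<^esub> v) (split_comult h) = iR (\<epsilon>R h)"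
proof (rule tensor_eq3[where x=h])
  fix a q b
  have "tlift (\<lambda>u v. S u \<cdot>\<^bsub>H\<^esub> v) (split_comult (a \<otimes> q \<otimes> b)) =
      sw q (\<lambda>x r. sw r (\<lambda>u r. sw r (\<lambda>v y. \<one>\<^bsub>A\<^esub> \<otimes> (T v \<cdot>\<^bsub>Q\<^esub> y) \<otimes> (act (T u) b \<cdot>\<^bsub>A\<^esub> act (T x) a))))"
    by (simp add: S_pure linearity sweedler tlift)
  also have "\<dots> = sw q (\<lambda>x u. iR (act (T u) b \<cdot>\<^bsub>A\<^esub> act (T x) a))"
    by (simp add: cancel_antipode_left(1)[of "\<lambda>w. \<one>\<^bsub>A\<^esub> \<otimes> w \<otimes> (act (T u) b \<cdot>\<^bsub>A\<^esub> act (T x) a)" for u x]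
        linearity sw_counit_right incl_right_def)
  also have "\<dots> = iR (\<epsilon>R (a \<otimes> q \<otimes> b))"
    by (simp add: right_counit_pure sw_linear[of iR, OF clinear_incl(2)[OF clinear_ident]] linearity sweedler)
  finally show "tlift (\<lambda>u v. S u \<cdot>\<^bsub>H\<^esub> v) (split_comult (a \<otimes> q \<otimes> b)) = iR (\<epsilon>R (a \<otimes> q \<otimes> b))" .
qed (simp_all add: linearity)

text \<open>
  The left-hand side is \<open>a \<cdot> (q\<^sub>1 \<cdot> T q\<^sub>4) b \<otimes> q\<^sub>2 \<cdot> T q\<^sub>3 \<otimes> 1\<close>: cancelling in the middle makes \<open>q\<^sub>1\<close> and
  \<open>q\<^sub>4\<close> adjacent.
\<close>

lemma S_mult_right: "tlift (\<lambda>u v. u \<cdot>\<^bsub>H\<^esub> S v) (split_comult h) = iL (\<epsilon>L h)"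
proof (rule tensor_eq3[where x=h])
  fix a q b
  have "tlift (\<lambda>u v. u \<cdot>\<^bsub>H\<^esub> S v) (split_comult (a \<otimes> q \<otimes> b)) =
      sw q (\<lambda>x r. sw r (\<lambda>u r. sw r (\<lambda>v y. (a \<cdot>\<^bsub>A\<^esub> act (x \<cdot>\<^bsub>Q\<^esub> T y) b) \<otimes> (u \<cdot>\<^bsub>Q\<^esub> T v) \<otimes> \<one>\<^bsub>A\<^esub>)))"
    by (simp add: S_pure linearity sweedler tlift)
  also have "\<dots> = sw q (\<lambda>x y. (a \<cdot>\<^bsub>A\<^esub> act (x \<cdot>\<^bsub>Q\<^esub> T y) b) \<otimes> \<one>\<^bsub>Q\<^esub> \<otimes> \<one>\<^bsub>A\<^esub>)"
    by (simp add: cancel_antipode_right(2)[of "\<lambda>w y. (a \<cdot>\<^bsub>A\<^esub> act (x \<cdot>\<^bsub>Q\<^esub> T y) b) \<otimes> w \<otimes> \<one>\<^bsub>A\<^esub>" for x]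
        linearity)
  also have "\<dots> = \<epsilon> q *\<^sub>C ((a \<cdot>\<^bsub>A\<^esub> b) \<otimes> \<one>\<^bsub>Q\<^esub> \<otimes> \<one>\<^bsub>A\<^esub>)"
    by (subst cancel_antipode_right(1)[of "\<lambda>w. (a \<cdot>\<^bsub>A\<^esub> act w b) \<otimes> \<one>\<^bsub>Q\<^esub> \<otimes> \<one>\<^bsub>A\<^esub>"])
      (simp_all add: linearity A.act_unit)
  also have "\<dots> = iL (\<epsilon>L (a \<otimes> q \<otimes> b))"
    by (simp add: incl_left_def linearity sweedler)
  finally show "tlift (\<lambda>u v. u \<cdot>\<^bsub>H\<^esub> S v) (split_comult (a \<otimes> q \<otimes> b)) = iL (\<epsilon>L (a \<otimes> q \<otimes> b))" .
qed (simp_all add: linearity)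

lemma left_counit_incl: "\<epsilon>L (iL a) = a" "\<epsilon>L (iR a) = a"
  by (simp_all add: incl_left_def incl_right_def linearity sweedler)

lemma hopf_algebroid_H:
  "hopf_algebroid H A iL iR (aqa_left_comult Q \<Delta> A act) \<epsilon>L
    (opposite A) iR iL (aqa_right_comult Q \<Delta> A act) \<epsilon>R S"
  unfolding hopf_algebroid_def
proof (intro conjI left_bialgebroid_H right_bialgebroid_H hopf_algebroid_axioms.intro;
    (unfold left_comult_eq right_comult_eq)?)
  show "clinear S" by (rule clinear_S[OF clinear_ident])
  show "bij S" by (rule involuntory_imp_bij) (rule S_involutive)
next
  show "iL (\<epsilon>L (iL b)) = iL b" "iR (\<epsilon>L (iR b)) = iR b" "iR (\<epsilon>R (iR b)) = iR b" "iL (\<epsilon>R (iL b)) = iL b" for b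
    by (simp_all add: left_counit_incl right_counit_incl)
next
  fix h
  show "let N = balanced3 (\<lambda>a h. iR a \<cdot>\<^bsub>H\<^esub> h) (\<lambda>a h. iL a \<cdot>\<^bsub>H\<^esub> h) (\<lambda>b h. h \<cdot>\<^bsub>H\<^esub> iR b) (\<lambda>b h. h \<cdot>\<^bsub>H\<^esub> iL b)
    in map_left N (\<lambda>h. split_comult h +o NL) (split_comult h +o NR) =
       map_right N (\<lambda>h. split_comult h +o NR) (split_comult h +o NL)"
    unfolding Let_def
    by (rule split_comult_mixed_coassoc) (simp_all add: linearity split_comult_bimodule)
  show "let N = balanced3 (\<lambda>b h. h \<cdot>\<^bsub>H\<^esub> iR b) (\<lambda>b h. h \<cdot>\<^bsub>H\<^esub> iL b) (\<lambda>a h. iR a \<cdot>\<^bsub>H\<^esub> h) (\<lambda>a h. iL a \<cdot>\<^bsub>H\<^esub> h)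
    in map_left N (\<lambda>h. split_comult h +o NR) (split_comult h +o NL) =
       map_right N (\<lambda>h. split_comult h +o NL) (split_comult h +o NR)"
    unfolding Let_def
    by (rule split_comult_mixed_coassoc) (simp_all add: linearity split_comult_bimodule)
next
  show "S (iR a \<cdot>\<^bsub>H\<^esub> h \<cdot>\<^bsub>H\<^esub> iL b) = iR b \<cdot>\<^bsub>H\<^esub> S h \<cdot>\<^bsub>H\<^esub> iL a" for a b h
    by (simp add: S_mult_incl_left S_incl_right_mult H.assoc)
next
  fix x h assume "x \<in> split_comult h +o NL"
  then have "tlift (\<lambda>u v. S u \<cdot>\<^bsub>H\<^esub> v) x = tlift (\<lambda>u v. S u \<cdot>\<^bsub>H\<^esub> v) (split_comult h)"
    by (rule coset_evaluation) (simp_all add: linearity tlift S_incl_right_mult H.assoc)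
  then show "tlift (\<lambda>u v. S u \<cdot>\<^bsub>H\<^esub> v) x = iR (\<epsilon>R h)" by (simp add: S_mult_left)
next
  fix x h assume "x \<in> split_comult h +o NR"
  then have "tlift (\<lambda>u v. u \<cdot>\<^bsub>H\<^esub> S v) x = tlift (\<lambda>u v. u \<cdot>\<^bsub>H\<^esub> S v) (split_comult h)"
    by (rule coset_evaluation) (simp_all add: linearity tlift S_mult_incl_left H.assoc)
  then show "tlift (\<lambda>u v. u \<cdot>\<^bsub>H\<^esub> S v) x = iL (\<epsilon>L h)" by (simp add: S_mult_right)
qed

end

theorem theorem2p3p1:
  fixes Q :: "'q::complex_vector alg"
    and \<Delta> :: "'q \<Rightarrow> 'q \<otimes> 'q"
    and \<epsilon> :: "'q \<Rightarrow> complex"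
    and T :: "'q \<Rightarrow> 'q"
    and A :: "'a::complex_vector alg"
    and act :: "'q \<Rightarrow> 'a \<Rightarrow> 'a"
  assumes "hopf_algebra Q \<Delta> \<epsilon> T"
    and "T \<circ> T = id"
    and "module_algebra Q \<Delta> \<epsilon> A act"
  shows "hopf_algebroid (aqa_alg Q \<Delta> A act)
    A (incl_left Q A) (incl_right Q A) (aqa_left_comult Q \<Delta> A act) (aqa_left_counit A act)
    (opposite A) (incl_right Q A) (incl_left Q A) (aqa_right_comult Q \<Delta> A act) (aqa_right_counit T A act)
    (aqa_antipode \<Delta> T act)"
proof -
  have "involutive_module_algebra Q \<Delta> \<epsilon> T A act"
    using assms
    by (simp add: involutive_module_algebra_def involutive_module_algebra_axioms_def fun_eq_iff)
  then show ?thesis by (rule involutive_module_algebra.hopf_algebroid_H)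
qed

end
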